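(* Let $n\ge 2$. Then the $\mathbb{Z}[z]$-algebra $\mathrm{VTL}_n$ has a presentation with generators $E_1,\dots,E_{n-1},v_1,\dots,v_{n-1}$ (the flat virtual $n$-tangles $E_i$, $v_i$ specified in the context) and relations $$E_i^2=zE_i,\quad v_i^2=1,\quad E_iv_i=v_iE_i=E_i,\qquad\text{for }1\le i\le n-1,$$ $$E_iE_j=E_jE_i,\quad v_iv_j=v_jv_i,\quad v_iE_j=E_jv_i,\qquad\text{for }|i-j|\ge 2,$$ $$E_iv_jE_i=E_i,\quad v_iv_jv_i=v_jv_iv_j,\quad v_iv_jE_i=E_jv_iv_j,\qquad\text{for }|i-j|=1.$$
   Context: Let $R_0^f=\mathbb{Z}[z]$. For $n\ge 1$, a flat virtual $n$-tangle is a partition of $V_n=\{0,1\}\times\{1,\dots,n\}$ into ($n$) pairs; $\mathcal{E}_n$ is the set of flat virtual $n$-tangles. $\mathrm{VTL}_n$ (the $n$-th virtual Temperley--Lieb algebra) is the free $R_0^f$-module with basis $\mathcal{E}_n$, with the following bilinear multiplication. For $E,E'\in\mathcal{E}_n$, view the pairs as edges (arcs) and concatenate: take disjoint copies of the two and glue the point $(1,i)$ of $E$ to the point $(0,i)$ of $E'$ for each $i$. The result consists of $n$ arcs, whose endpoints are the points $(0,i)$ of $E$ and the points $(1,i)$ of $E'$, and some number $m$ of closed curves. The $n$ arcs determine a flat virtual $n$-tangle $E*E'$, and $E\,E'=z^m(E*E')$. This is an associative algebra with unit $\{\{(0,k),(1,k)\}\mid 1\le k\le n\}$. For $1\le i\le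 n-1$: $E_i=\{\{(0,i),(0,i+1)\},\{(1,i),(1,i+1)\}\}\cup\{\{(0,k),(1,k)\}\mid k\ne i,i+1\}$ and $v_i=\{\{(0,i),(1,i+1)\},\{(0,i+1),(1,i)\}\}\cup\{\{(0,k),(1,k)\}\mid k\neq i,i+1\}$. *)

theory Defs
  imports
    "HOL-Library.Poly_Mapping"
    "HOL-Library.Disjoint_Sets"
    "HOL-Computational_Algebra.Polynomial"
    "HOL-Algebra.QuotRing"
    "HOL-Algebra.Module"
begin

section \<open>Free associative algebras and presentations\<close>

text \<open>
  Words under concatenation, written additively because the monoid-algebra product of
  \<^theory>\<open>HOL-Library.Poly_Mapping\<close> convolves over an additive monoid. With this instance
  the type \<open>'x list \<Rightarrow>\<^sub>0 'r\<close> is the ring of noncommutative polynomials over \<open>'r\<close>.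
\<close>

instantiation list :: (type) monoid_add
begin

definition zero_list :: "'a list" where "zero_list = []"

definition plus_list :: "'a list \<Rightarrow> 'a list \<Rightarrow> 'a list" where "plus_list u v = u @ v"

instance
  by standard (simp_all add: zero_list_def plus_list_def)

end

definition pm_scale :: "'r::comm_ring_1 \<Rightarrow> ('k \<Rightarrow>\<^sub>0 'r) \<Rightarrow> ('k \<Rightarrow>\<^sub>0 'r)" where
  "pm_scale c x = Poly_Mapping.map ((*) c) x"

definition free_algebra :: "'x set \<Rightarrow> ('r::comm_ring_1, 'x list \<Rightarrow>\<^sub>0 'r) module" where
  "free_algebra X =
    \<lparr> carrier = {x. \<forall>w \<in> Poly_Mapping.keys x. set w \<subseteq> X},
      mult = (*), one = 1, zero = 0, add = (+), smult = pm_scale \<rparr>"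

definition free_gen :: "'x \<Rightarrow> ('x list \<Rightarrow>\<^sub>0 'r::comm_ring_1)" where
  "free_gen x = Poly_Mapping.single [x] 1"

definition relation_ideal ::
  "'x set \<Rightarrow> (('x list \<Rightarrow>\<^sub>0 'r::comm_ring_1) \<times> ('x list \<Rightarrow>\<^sub>0 'r)) set \<Rightarrow> ('x list \<Rightarrow>\<^sub>0 'r) set" where
  "relation_ideal X R = genideal (free_algebra X) ((\<lambda>(l, r). l - r) ` R)"

text \<open>
  \<open>A\<close> has the presentation with generators \<open>f x\<close> (\<open>x \<in> X\<close>) and relations \<open>l = r\<close>
  (\<open>(l, r) \<in> R\<close>): the quotient of the free algebra on \<open>X\<close> by the two-sided ideal generated by
  all \<open>l - r\<close> is isomorphic to \<open>A\<close>, by an isomorphism that is linear over the coefficients and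
  sends the class of \<open>x\<close> to \<open>f x\<close>. No algebra axioms are assumed of \<open>A\<close>: they transfer
  from the quotient along the isomorphism.
\<close>

definition has_presentation ::
  "('r::comm_ring_1, 'a) module \<Rightarrow> 'x set \<Rightarrow> ('x \<Rightarrow> 'a) \<Rightarrow>
    (('x list \<Rightarrow>\<^sub>0 'r) \<times> ('x list \<Rightarrow>\<^sub>0 'r)) set \<Rightarrow> bool" where
  "has_presentation A X f R \<longleftrightarrow>
    (let F = free_algebra X; I = relation_ideal X R in
      \<exists>\<phi> \<in> ring_iso (F Quot I) A.
        (\<forall>x \<in> X. \<phi> (I +>\<^bsub>F\<^esub> free_gen x) = f x) \<and>
        (\<forall>c. \<forall>u \<in> carrier F. \<phi> (I +>\<^bsub>F\<^esub> (c \<odot>\<^bsub>F\<^esub> u)) = c \<odot>\<^bsub>A\<^esub> \<phi> (I +>\<^bsub>F\<^esub> u)))"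

lemma lookup_pm_scale: "Poly_Mapping.lookup (pm_scale c x) k = c * Poly_Mapping.lookup x k"
  by (simp add: pm_scale_def Poly_Mapping.map.rep_eq when_def)

lemma free_algebra_ring: "ring (free_algebra X :: ('r::comm_ring_1, 'x list \<Rightarrow>\<^sub>0 'r) module)"
proof -
  let ?F = "free_algebra X :: ('r, 'x list \<Rightarrow>\<^sub>0 'r) module"
  have carr: "x \<in> carrier ?F \<longleftrightarrow> (\<forall>w \<in> Poly_Mapping.keys x. set w \<subseteq> X)" for x
    by (simp add: free_algebra_def)
  have ops: "mult ?F = (*)" "one ?F = 1" "add ?F = (+)" "zero ?F = 0"
    by (simp_all add: free_algebra_def)
  have mult: "x * y \<in> carrier ?F" if "x \<in> carrier ?F" "y \<in> carrier ?F" for x y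
    using that keys_mult[of x y] unfolding carr by (fastforce simp: plus_list_def)
  have add: "x + y \<in> carrier ?F" if "x \<in> carrier ?F" "y \<in> carrier ?F" for x y
    using that Poly_Mapping.keys_add[of x y] unfolding carr by blast
  have neg: "- x \<in> carrier ?F" if "x \<in> carrier ?F" for x
    using that by (simp add: carr)
  have one: "1 \<in> carrier ?F" and zero: "0 \<in> carrier ?F"
    by (simp_all add: carr zero_list_def)
  show ?thesis
  proof (rule ringI)
    show "abelian_group ?F"
    proof (rule abelian_groupI)
      fix x assume "x \<in> carrier ?F"
      then show "\<exists>y \<in> carrier ?F. y \<oplus>\<^bsub>?F\<^esub> x = \<zero>\<^bsub>?F\<^esub>"
        using neg by (auto simp: ops intro!: bexI[of _ "- x"])
    qed (simp_all only: ops add zero ac_simps add_0 add_0_right)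
    show "Group.monoid ?F"
      by (rule monoidI) (simp_all only: ops mult one mult.assoc mult_1 mult_1_right)
  qed (simp_all only: ops distrib_left distrib_right)
qed

section \<open>Flat virtual tangles\<close>

type_synonym tangle = "(nat \<times> nat) set set"

definition tangle_points :: "nat \<Rightarrow> (nat \<times> nat) set" where
  "tangle_points n = {0, 1} \<times> {1..n}"

definition flat_tangles :: "nat \<Rightarrow> tangle set" where
  "flat_tangles n = {E. partition_on (tangle_points n) E \<and> (\<forall>p \<in> E. card p = 2)}"

definition id_tangle :: "nat \<Rightarrow> tangle" where
  "id_tangle n = {{(0, k), (1, k)} | k. k \<in> {1..n}}"

definition E_tangle :: "nat \<Rightarrow> nat \<Rightarrow> tangle" where
  "E_tangle n i = {{(0, i), (0, i + 1)}, {(1, i), (1, i + 1)}}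
     \<union> {{(0, k), (1, k)} | k. k \<in> {1..n} - {i, i + 1}}"

definition v_tangle :: "nat \<Rightarrow> nat \<Rightarrow> tangle" where
  "v_tangle n i = {{(0, i), (1, i + 1)}, {(0, i + 1), (1, i)}}
     \<union> {{(0, k), (1, k)} | k. k \<in> {1..n} - {i, i + 1}}"

text \<open>
  Concatenation takes place on three levels of points: \<open>E\<close> occupies levels 0 and 1, the second
  factor \<open>E'\<close> is moved to levels 1 and 2, so that level 1 is the glued one.
  The connected components of the resulting graph are the arcs and closed curves; as every
  point of level 1 lies on one edge of each factor, the closed curves are precisely the components
  that stay within level 1.
\<close>

definition glued_edges :: "tangle \<Rightarrow> tangle \<Rightarrow> (nat \<times> nat) set set" where
  "glued_edges E E' = E \<union> (`) (map_prod Suc id) ` E'"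

definition glued_components :: "nat \<Rightarrow> tangle \<Rightarrow> tangle \<Rightarrow> (nat \<times> nat) set set" where
  "glued_components n E E' =
     ({0, 1, 2} \<times> {1..n}) // {(x, y). {x, y} \<in> glued_edges E E'}\<^sup>*"

definition middle_level :: "(nat \<times> nat) set" where
  "middle_level = {1} \<times> UNIV"

definition closed_curves :: "nat \<Rightarrow> tangle \<Rightarrow> tangle \<Rightarrow> (nat \<times> nat) set set" where
  "closed_curves n E E' = {C \<in> glued_components n E E'. C \<subseteq> middle_level}"

text \<open>\<open>map_prod (\<lambda>k. k div 2) id\<close> renames level 2 to level 1 and keeps level 0.\<close>

definition tangle_concat :: "nat \<Rightarrow> tangle \<Rightarrow> tangle \<Rightarrow> tangle" where
  "tangle_concat n E E' =
     (\<lambda>C. map_prod (\<lambda>k. k div 2) id ` (C - middle_level))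
       ` (glued_components n E E' - closed_curves n E E')"

section \<open>The virtual Temperley--Lieb algebra\<close>

definition zvar :: "int poly" where
  "zvar = [:0, 1:]"

definition VTL_mult ::
  "nat \<Rightarrow> (tangle \<Rightarrow>\<^sub>0 int poly) \<Rightarrow> (tangle \<Rightarrow>\<^sub>0 int poly) \<Rightarrow> (tangle \<Rightarrow>\<^sub>0 int poly)" where
  "VTL_mult n x y =
     (\<Sum>E \<in> Poly_Mapping.keys x. \<Sum>E' \<in> Poly_Mapping.keys y.
        Poly_Mapping.single (tangle_concat n E E')
          (Poly_Mapping.lookup x E * Poly_Mapping.lookup y E' *
             zvar ^ card (closed_curves n E E')))"

definition VTL :: "nat \<Rightarrow> (int poly, tangle \<Rightarrow>\<^sub>0 int poly) module" where
  "VTL n =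
    \<lparr> carrier = {x. Poly_Mapping.keys x \<subseteq> flat_tangles n},
      mult = VTL_mult n, one = Poly_Mapping.single (id_tangle n) 1,
      zero = 0, add = (+), smult = pm_scale \<rparr>"

datatype vtl_gen = GenE nat | GenV nat

definition vtl_gens :: "nat \<Rightarrow> vtl_gen set" where
  "vtl_gens n = GenE ` {1..n - 1} \<union> GenV ` {1..n - 1}"

fun vtl_gen_val :: "nat \<Rightarrow> vtl_gen \<Rightarrow> (tangle \<Rightarrow>\<^sub>0 int poly)" where
  "vtl_gen_val n (GenE i) = Poly_Mapping.single (E_tangle n i) 1"
| "vtl_gen_val n (GenV i) = Poly_Mapping.single (v_tangle n i) 1"

definition vtl_relations ::
  "nat \<Rightarrow> ((vtl_gen list \<Rightarrow>\<^sub>0 int poly) \<times> (vtl_gen list \<Rightarrow>\<^sub>0 int poly)) set" where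
  "vtl_relations n =
    (let e = (\<lambda>i. free_gen (GenE i)); v = (\<lambda>i. free_gen (GenV i)); N = {1..n - 1} in
      (\<Union>i \<in> N. {(e i ^ 2, pm_scale zvar (e i)), (v i ^ 2, 1),
                (e i * v i, v i * e i), (v i * e i, e i)}) \<union>
      (\<Union>(i, j) \<in> {(i, j). i \<in> N \<and> j \<in> N \<and> \<bar>int i - int j\<bar> \<ge> 2}.
               {(e i * e j, e j * e i), (v i * v j, v j * v i), (v i * e j, e j * v i)}) \<union>
      (\<Union>(i, j) \<in> {(i, j). i \<in> N \<and> j \<in> N \<and> \<bar>int i - int j\<bar> = 1}.
               {(e i * v j * e i, e i), (v i * v j * v i, v j * v i * v j),
                (v i * v j * e i, e j * v i * v j)}))"

end

theory Submission
  imports Defs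
begin

text \<open>
  Specialise \<open>z\<close> to \<open>2\<close> and let a tangle act on functions of two-colourings of \<open>n\<close> points, its matrix
  entry at a pair of colourings being \<open>1\<close> if the two ends of every arc have the same colour and \<open>0\<close>
  otherwise. Counting the colourings of the glued points shows that the product of the matrices of \<open>E\<close>
  and \<open>E'\<close> is \<open>2\<^sup>m\<close> times the matrix of \<open>E * E'\<close>, where \<open>m\<close> is the number of closed curves. As the
  matrix determines both \<open>m\<close> and the tangle, associativity of the algebra and the validity of the
  relations become identities between explicit operators.

  It remains to see that two words in the generators with the same operator are equal modulo the
  relations. Writing \<open>Q m\<close> for the monoid generated by \<open>z\<close> and the generators of index below \<open>m\<close>,
  the relations alone give, according to the point joined to the last bottom point,
  \<open>Q (m + 1) = (\<Union>k. v\<^sub>k \<cdots> v\<^sub>m Q m) \<union> (\<Union>k. Q m e\<^sub>m v\<^sub>m\<^sub>-\<^sub>1 \<cdots> v\<^sub>k)\<close>.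
  The operator of such a product determines the piece, and the factor in \<open>Q m\<close> can be recovered
  from it, so the claim follows by induction on \<open>m\<close>.
\<close>

section \<open>Consequences of the relations\<close>

text \<open>Every relation equates monomials, a power of \<open>z\<close> times a word, and only
  such monomials are compared. Replacing \<open>z\<close> by 2 therefore loses nothing: at the
  constant colourings the matrix of a tangle has entry 1, so the exponent can be read off a power of
  2. The number 2 is the number of colours, as a closed curve can be coloured in two ways, and two
  colours suffice to tell partitions of the points apart. The \<open>2 m + 1\<close> pieces of
  \<open>Q (m + 1)\<close> correspond to the possible partners of the last bottom point among the
  other \<open>2 m + 1\<close> points. Two difficulties shape the rest. Tracing arcs through the
  glued graph is avoided: a concatenation is shown directly only to be a partition, and comparison
  of matrices identifies it with the tangle of a word, which is already known to consist of pairs.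
  The monoid laws of the locale below hold on a whole type, whereas the quotient algebra lives on
  cosets inside a carrier set; it enters through maps on sets, composed as functions.\<close>

locale brauer_relations =
  fixes mul :: "'a \<Rightarrow> 'a \<Rightarrow> 'a" (infixl \<open>\<cdot>\<close> 70)
    and unit :: 'a and z :: 'a and e v :: "nat \<Rightarrow> 'a" and n :: nat
  assumes assoc: "x \<cdot> y \<cdot> w = x \<cdot> (y \<cdot> w)"
    and unit_left [simp]: "unit \<cdot> x = x"
    and unit_right [simp]: "x \<cdot> unit = x"
    and z_e: "1 \<le> i \<Longrightarrow> i < n \<Longrightarrow> z \<cdot> e i = e i \<cdot> z"
    and z_v: "1 \<le> i \<Longrightarrow> i < n \<Longrightarrow> z \<cdot> v i = v i \<cdot> z"
    and e_e: "1 \<le> i \<Longrightarrow> i < n \<Longrightarrow> e i \<cdot> e i = z \<cdot> e i"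
    and v_v: "1 \<le> i \<Longrightarrow> i < n \<Longrightarrow> v i \<cdot> v i = unit"
    and e_v: "1 \<le> i \<Longrightarrow> i < n \<Longrightarrow> e i \<cdot> v i = e i"
    and v_e: "1 \<le> i \<Longrightarrow> i < n \<Longrightarrow> v i \<cdot> e i = e i"
    and e_e_far: "1 \<le> i \<Longrightarrow> i < n \<Longrightarrow> 1 \<le> j \<Longrightarrow> j < n \<Longrightarrow>
      i + 2 \<le> j \<or> j + 2 \<le> i \<Longrightarrow> e i \<cdot> e j = e j \<cdot> e i"
    and v_v_far: "1 \<le> i \<Longrightarrow> i < n \<Longrightarrow> 1 \<le> j \<Longrightarrow> j < n \<Longrightarrow>
      i + 2 \<le> j \<or> j + 2 \<le> i \<Longrightarrow> v i \<cdot> v j = v j \<cdot> v i"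
    and v_e_far: "1 \<le> i \<Longrightarrow> i < n \<Longrightarrow> 1 \<le> j \<Longrightarrow> j < n \<Longrightarrow>
      i + 2 \<le> j \<or> j + 2 \<le> i \<Longrightarrow> v i \<cdot> e j = e j \<cdot> v i"
    and e_v_e: "1 \<le> i \<Longrightarrow> i < n \<Longrightarrow> 1 \<le> j \<Longrightarrow> j < n \<Longrightarrow>
      i = j + 1 \<or> j = i + 1 \<Longrightarrow> e i \<cdot> v j \<cdot> e i = e i"
    and v_v_v: "1 \<le> i \<Longrightarrow> i < n \<Longrightarrow> 1 \<le> j \<Longrightarrow> j < n \<Longrightarrow>
      i = j + 1 \<or> j = i + 1 \<Longrightarrow> v i \<cdot> v j \<cdot> v i = v j \<cdot> v i \<cdot> v j"
    and v_v_e: "1 \<le> i \<Longrightarrow> i < n \<Longrightarrow> 1 \<le> j \<Longrightarrow> j < n \<Longrightarrow>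
      i = j + 1 \<or> j = i + 1 \<Longrightarrow> v i \<cdot> v j \<cdot> e i = e j \<cdot> v i \<cdot> v j"
begin

lemma v_v_cancel: "1 \<le> i \<Longrightarrow> i < n \<Longrightarrow> v i \<cdot> (v i \<cdot> x) = x"
  by (metis assoc unit_left v_v)

lemma e_v_cancel: "1 \<le> i \<Longrightarrow> i < n \<Longrightarrow> e i \<cdot> (v i \<cdot> x) = e i \<cdot> x"
  by (metis assoc e_v)

section \<open>Temperley-Lieb identities for neighbouring indices\<close>

context
  fixes i j
  assumes ij: "1 \<le> i" "i < n" "1 \<le> j" "j < n" "i = j + 1 \<or> j = i + 1"
begin

text \<open>The last mixed relation, multiplied on the right by the inverse of
  \<open>v i \<cdot> v j\<close>. Neighbouring \<open>e\<close> are thus conjugate, and the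
  identities below follow by absorbing \<open>v\<close> into \<open>e\<close>.\<close>

lemma e_conj: "e j = v i \<cdot> (v j \<cdot> (e i \<cdot> (v j \<cdot> v i)))"
  using v_v_e[OF ij] ij by (metis assoc unit_right v_v)

lemma e_e_adj: "e j \<cdot> e i = v i \<cdot> (v j \<cdot> e i)"
  using e_conj e_v_e[OF ij] ij by (metis assoc v_e)

lemma e_e_adj': "e i \<cdot> e j = e i \<cdot> (v j \<cdot> v i)"
  using e_conj e_v_e[OF ij] ij by (metis assoc e_v)

lemma e_e_e: "e i \<cdot> (e j \<cdot> e i) = e i"
  using e_e_adj e_v_e[OF ij] ij by (metis assoc e_v)

text \<open>Behind \<open>e i\<close>, a crossing \<open>v j\<close> can be traded for
  \<open>e j\<close> followed by the neighbouring crossing. Iterated, this gives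
  \<open>e_up\<close>.\<close>

lemma e_v_adj: "e i \<cdot> v j = e i \<cdot> (e j \<cdot> v i)"
  using e_e_adj' ij by (metis assoc unit_right v_v)

lemma v_e_e_adj: "v i \<cdot> (e j \<cdot> e i) = v j \<cdot> e i"
  using e_e_adj ij by (metis assoc unit_left v_v)

lemma e_e_v_v: "e i \<cdot> (e j \<cdot> (v i \<cdot> v j)) = e i"
  using e_v_adj ij by (metis assoc unit_right v_v)

end

section \<open>Words in the generators of small index\<close>

inductive_set Q :: "nat \<Rightarrow> 'a set" for m where
  Q_unit: "unit \<in> Q m"
| Q_z: "z \<in> Q m"
| Q_e: "1 \<le> i \<Longrightarrow> i < m \<Longrightarrow> e i \<in> Q m"
| Q_v: "1 \<le> i \<Longrightarrow> i < m \<Longrightarrow> v i \<in> Q m"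
| Q_mul: "x \<in> Q m \<Longrightarrow> y \<in> Q m \<Longrightarrow> x \<cdot> y \<in> Q m"

lemma Q_mono: "x \<in> Q m \<Longrightarrow> m \<le> m' \<Longrightarrow> x \<in> Q m'"
  by (induction rule: Q.induct) (auto intro: Q.intros)

lemma mul_commute:
  assumes "x \<cdot> w = w \<cdot> x" "y \<cdot> w = w \<cdot> y" shows "x \<cdot> y \<cdot> w = w \<cdot> (x \<cdot> y)"
  using assms by (metis assoc)

text \<open>Products are normalised to the right, so an equation for a prefix can rewrite only after
  an arbitrary tail has been added.\<close>

lemma mul_extend: "x \<cdot> y = w \<Longrightarrow> x \<cdot> (y \<cdot> t) = w \<cdot> t"
  by (simp add: assoc[symmetric])

lemma swap_commute: "x \<cdot> y = y \<cdot> x \<Longrightarrow> y \<cdot> (x \<cdot> w) = x \<cdot> (y \<cdot> w)"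
  by (simp add: assoc[symmetric])

text \<open>Generators in \<open>Q m\<close> have index below \<open>m < p\<close>, hence at
  distance at least 2 from \<open>p\<close>.\<close>

lemma Q_e_commute: "x \<in> Q m \<Longrightarrow> m < p \<Longrightarrow> p < n \<Longrightarrow> x \<cdot> e p = e p \<cdot> x"
  by (induction rule: Q.induct) (auto intro: mul_commute simp: z_e e_e_far v_e_far)

lemma Q_v_commute: "x \<in> Q m \<Longrightarrow> m < p \<Longrightarrow> p < n \<Longrightarrow> x \<cdot> v p = v p \<cdot> x"
  by (induction rule: Q.induct) (auto intro: mul_commute simp: z_v v_v_far v_e_far[symmetric])

lemma z_Q_commute: "x \<in> Q m \<Longrightarrow> m \<le> n \<Longrightarrow> z \<cdot> x = x \<cdot> z"
  by (induction rule: Q.induct) (auto simp: z_v z_e assoc, metis assoc)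

text \<open>\<open>up k m\<close>, \<open>dn k m\<close> and \<open>eu k m\<close> are \<open>v\<^sub>k \<cdots> v\<^sub>m\<^sub>-\<^sub>1\<close>, \<open>v\<^sub>m\<^sub>-\<^sub>1 \<cdots> v\<^sub>k\<close> and \<open>e\<^sub>k \<cdots> e\<^sub>m\<^sub>-\<^sub>1\<close>.\<close>

primrec up :: "nat \<Rightarrow> nat \<Rightarrow> 'a" where
  "up k 0 = unit"
| "up k (Suc m) = (if k \<le> m then up k m \<cdot> v m else unit)"

primrec dn :: "nat \<Rightarrow> nat \<Rightarrow> 'a" where
  "dn k 0 = unit"
| "dn k (Suc m) = (if k \<le> m then v m \<cdot> dn k m else unit)"

primrec eu :: "nat \<Rightarrow> nat \<Rightarrow> 'a" where
  "eu k 0 = unit"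
| "eu k (Suc m) = (if k \<le> m then eu k m \<cdot> e m else unit)"

lemma up_trivial [simp]: "m \<le> k \<Longrightarrow> up k m = unit" by (cases m) auto
lemma dn_trivial [simp]: "m \<le> k \<Longrightarrow> dn k m = unit" by (cases m) auto
lemma eu_trivial [simp]: "m \<le> k \<Longrightarrow> eu k m = unit" by (cases m) auto

lemma up_Q: "1 \<le> k \<Longrightarrow> up k m \<in> Q m"
proof (induction m)
  case (Suc m)
  then show ?case using Q_mono[of "up k m" m "Suc m"] by (auto intro!: Q_mul Q_e Q_v Q_unit)
qed (auto intro: Q.intros)

lemma dn_Q: "1 \<le> k \<Longrightarrow> dn k m \<in> Q m"
proof (induction m)
  case (Suc m)
  then show ?case using Q_mono[of "dn k m" m "Suc m"] by (auto intro!: Q_mul Q_e Q_v Q_unit)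
qed (auto intro: Q.intros)

lemma eu_Q: "1 \<le> k \<Longrightarrow> eu k m \<in> Q m"
proof (induction m)
  case (Suc m)
  then show ?case using Q_mono[of "eu k m" m "Suc m"] by (auto intro!: Q_mul Q_e Q_v Q_unit)
qed (auto intro: Q.intros)

section \<open>Moving generators past chains of crossings\<close>

lemma up_front: "k < m \<Longrightarrow> up k m = v k \<cdot> up (Suc k) m"
proof (induction m)
  case (Suc m)
  then show ?case by (cases "k = m") (auto simp: assoc)
qed auto

lemma up_commute: "(\<And>j. k \<le> j \<Longrightarrow> j < m \<Longrightarrow> x \<cdot> v j = v j \<cdot> x) \<Longrightarrow> x \<cdot> up k m = up k m \<cdot> x"
proof (induction m)
  case (Suc m)
  then have "up k m \<cdot> x = x \<cdot> up k m" by auto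
  then show ?case using Suc.prems[of m] mul_commute[of "up k m" x "v m"] by auto
qed auto

text \<open>The chain carries one strand across all strands from \<open>k + 1\<close> to
  \<open>m\<close> and moves each of them by one place. Algebraically, a single braid relation does
  the shift and far commutation the rest.\<close>

lemma v_up_shift: "1 \<le> k \<Longrightarrow> k < i \<Longrightarrow> i < m \<Longrightarrow> m \<le> n \<Longrightarrow> v i \<cdot> up k m = up k m \<cdot> v (i - 1)"
proof (induction m)
  case (Suc m)
  show ?case
  proof (cases "i = m")
    case True
    then obtain p where p: "m = Suc p" "k \<le> p" using Suc.prems by (cases m) auto
    have "v m \<cdot> up k p = up k p \<cdot> v m"
      using Suc.prems p by (intro up_commute v_v_far) auto
    from mul_extend[OF this] have "v m \<cdot> (up k p \<cdot> (v p \<cdot> v m)) = up k p \<cdot> (v m \<cdot> v p \<cdot> v m)"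
      by (simp add: assoc)
    also have "v m \<cdot> v p \<cdot> v m = v p \<cdot> v m \<cdot> v p" using Suc.prems p by (intro v_v_v) auto
    finally show ?thesis using Suc.prems p True by (simp add: assoc)
  next
    case False
    then have "v i \<cdot> up k m = up k m \<cdot> v (i - 1)" using Suc by auto
    note mul_extend[OF this]
    moreover have "v (i - 1) \<cdot> v m = v m \<cdot> v (i - 1)" using Suc.prems False by (intro v_v_far) auto
    ultimately show ?thesis using Suc.prems by (simp add: assoc)
  qed
qed auto

lemma e_up_shift: "1 \<le> k \<Longrightarrow> k < i \<Longrightarrow> i < m \<Longrightarrow> m \<le> n \<Longrightarrow> e i \<cdot> up k m = up k m \<cdot> e (i - 1)"
proof (induction m)
  case (Suc m)
  show ?case
  proof (cases "i = m")
    case True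
    then obtain p where p: "m = Suc p" "k \<le> p" using Suc.prems by (cases m) auto
    have "e m \<cdot> up k p = up k p \<cdot> e m"
      using Suc.prems p by (intro up_commute v_e_far[symmetric]) auto
    from mul_extend[OF this] have "e m \<cdot> (up k p \<cdot> (v p \<cdot> v m)) = up k p \<cdot> (e m \<cdot> v p \<cdot> v m)"
      by (simp add: assoc)
    also have "e m \<cdot> v p \<cdot> v m = v p \<cdot> v m \<cdot> e p" using Suc.prems p by (intro v_v_e[symmetric]) auto
    finally show ?thesis using Suc.prems p True by (simp add: assoc)
  next
    case False
    then have "e i \<cdot> up k m = up k m \<cdot> e (i - 1)" using Suc by auto
    note mul_extend[OF this]
    moreover have "e (i - 1) \<cdot> v m = v m \<cdot> e (i - 1)" using Suc.prems False by (intro v_e_far[symmetric]) auto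
    ultimately show ?thesis using Suc.prems by (simp add: assoc)
  qed
qed auto

text \<open>Iterating \<open>e_v_adj\<close> turns the crossings into a chain of \<open>e\<close>
  and leaves a descending chain of crossings behind. Index \<open>p\<close> then occurs only once,
  in \<open>e p\<close>, between two factors from \<open>Q p\<close>.\<close>

lemma e_up: "1 \<le> k \<Longrightarrow> k \<le> p \<Longrightarrow> p < n \<Longrightarrow> e k \<cdot> up k (Suc p) = eu k p \<cdot> (e p \<cdot> dn k p)"
proof (induction p)
  case (Suc p)
  show ?case
  proof (cases "k = Suc p")
    case True then show ?thesis using Suc.prems by (simp add: e_v)
  next
    case False
    have c: "dn k p \<cdot> v (Suc p) = v (Suc p) \<cdot> dn k p"
      using Suc.prems by (intro Q_v_commute[OF dn_Q]) auto
    have "e k \<cdot> up k (Suc (Suc p)) = e k \<cdot> up k (Suc p) \<cdot> v (Suc p)"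
      using Suc.prems False by (simp add: assoc)
    also have "\<dots> = eu k p \<cdot> (e p \<cdot> dn k p) \<cdot> v (Suc p)" using Suc False by simp
    also have "\<dots> = eu k p \<cdot> (e p \<cdot> v (Suc p) \<cdot> dn k p)" using c by (simp add: assoc)
    also have "e p \<cdot> v (Suc p) = e p \<cdot> (e (Suc p) \<cdot> v p)" using Suc.prems False by (intro e_v_adj) auto
    finally show ?thesis using Suc.prems False by (simp add: assoc)
  qed
qed auto

text \<open>Every index in the chain of \<open>e\<close> lies strictly inside the range of the
  crossings, so \<open>e_up_shift\<close> applies to each factor.\<close>

lemma eu_up_below:
  assumes "1 \<le> j" "j < k" "k \<le> p" "p < n"
  shows "eu k p \<cdot> up j (Suc p) = up j (Suc p) \<cdot> eu (k - 1) (p - 1)"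
proof -
  \<comment> \<open>The chain of crossings stays fixed while the chain of \<open>e\<close> grows,
    hence the separate bound \<open>q\<close>.\<close>
  have "q \<le> p \<Longrightarrow> eu k q \<cdot> up j (Suc p) = up j (Suc p) \<cdot> eu (k - 1) (q - 1)" for q
  proof (induction q)
    case (Suc q)
    show ?case
    proof (cases "k \<le> q")
      case True
      then obtain r where r: "q = Suc r" "k - 1 \<le> r" using assms by (cases q) auto
      have "e q \<cdot> up j (Suc p) = up j (Suc p) \<cdot> e (q - 1)"
        using assms True Suc.prems by (intro e_up_shift) auto
      moreover have "eu k q \<cdot> up j (Suc p) = up j (Suc p) \<cdot> eu (k - 1) (q - 1)" using Suc by simp
      from mul_extend[OF this] calculation have "eu k q \<cdot> e q \<cdot> up j (Suc p) = up j (Suc p) \<cdot> (eu (k - 1) (q - 1) \<cdot> e (q - 1))"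
        by (simp add: assoc del: up.simps eu.simps)
      then show ?thesis using True r by simp
    next
      case False
      then have "Suc q - 1 \<le> k - 1" by simp
      then show ?thesis using False by simp
    qed
  qed simp
  then show ?thesis by simp
qed

text \<open>Where the chains meet, \<open>e_e_v_v\<close> absorbs the first two crossings. The
  \<open>e\<close> of smaller index commute with the remaining crossings, those of larger index are
  shifted.\<close>

lemma eu_up_above:
  assumes "1 \<le> k" "k \<le> j" "j + 2 \<le> p" "p < n"
  shows "eu k p \<cdot> up j (Suc p) = up (j + 2) (Suc p) \<cdot> eu k (p - 1)"
proof -
  let ?m = "Suc p"
  have step: "j + 2 \<le> q \<Longrightarrow> q \<le> p \<Longrightarrow> eu k q \<cdot> up j ?m = up (j + 2) ?m \<cdot> eu k (q - 1)" for q
  proof (induction q)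
    case (Suc q)
    show ?case
    proof (cases "q = Suc j")
      case True
      have up: "up j ?m = v j \<cdot> (v (Suc j) \<cdot> up (j + 2) ?m)"
        using assms up_front[of j ?m] up_front[of "Suc j" ?m] by simp
      have "e j \<cdot> (e (Suc j) \<cdot> (v j \<cdot> v (Suc j))) = e j" using assms by (intro e_e_v_v) auto
      then have "eu k (Suc q) \<cdot> up j ?m = eu k j \<cdot> e j \<cdot> up (j + 2) ?m"
        using True up assms by (simp add: assoc) (simp add: assoc[symmetric])
      also have "eu k j \<cdot> e j = eu k q" using True assms by simp
      also have "eu k q \<cdot> up (j + 2) ?m = up (j + 2) ?m \<cdot> eu k q"
        using assms True by (intro up_commute Q_v_commute[OF eu_Q]) auto
      finally show ?thesis by simp
    next
      case False
      then obtain r where r: "q = Suc r" "j < r" using Suc.prems by (cases q) auto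
      have "e q \<cdot> up j ?m = up j ?m \<cdot> e (q - 1)" using assms Suc.prems r by (intro e_up_shift) auto
      moreover have "eu k q \<cdot> up j ?m = up (j + 2) ?m \<cdot> eu k (q - 1)" using Suc r by simp
      from mul_extend[OF this] calculation have "eu k q \<cdot> e q \<cdot> up j ?m = up (j + 2) ?m \<cdot> (eu k (q - 1) \<cdot> e (q - 1))"
        by (simp add: assoc del: up.simps eu.simps)
      then show ?thesis using r assms by simp
    qed
  qed auto
  then show ?thesis using assms by simp
qed

text \<open>
  The two parts of \<open>F m\<close> collect the products in which the last bottom point is joined to the \<open>k\<close>-th
  top point, respectively to the \<open>k\<close>-th bottom point; \<open>F' m\<close> is the mirror image, which classifies by
  the last top point. The inductive step for \<open>F\<close> needs the decomposition by \<open>F'\<close> one level below.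
\<close>

definition F :: "nat \<Rightarrow> 'a set" where
  "F m = {up k m \<cdot> x | k x. 1 \<le> k \<and> k \<le> m \<and> x \<in> Q (m - 1)} \<union>
    {x \<cdot> (e (m - 1) \<cdot> dn k (m - 1)) | k x. 1 \<le> k \<and> k < m \<and> x \<in> Q (m - 1)}"

definition F' :: "nat \<Rightarrow> 'a set" where
  "F' m = {x \<cdot> dn k m | k x. 1 \<le> k \<and> k \<le> m \<and> x \<in> Q (m - 1)} \<union>
    {up k (m - 1) \<cdot> e (m - 1) \<cdot> x | k x. 1 \<le> k \<and> k < m \<and> x \<in> Q (m - 1)}"

lemma F_I1: "1 \<le> k \<Longrightarrow> k \<le> Suc p \<Longrightarrow> x \<in> Q p \<Longrightarrow> up k (Suc p) \<cdot> x \<in> F (Suc p)"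
  unfolding F_def diff_Suc_1 by blast

lemma F_I2: "1 \<le> k \<Longrightarrow> k \<le> p \<Longrightarrow> x \<in> Q p \<Longrightarrow> x \<cdot> (e p \<cdot> dn k p) \<in> F (Suc p)"
  unfolding F_def diff_Suc_1 less_Suc_eq_le by blast

section \<open>Inductive step: closure under left multiplication\<close>

context
  fixes p
  assumes p: "1 \<le> p" "p < n" and dec: "Q p \<subseteq> F p" "Q p \<subseteq> F' p"
begin

text \<open>So the products \<open>x \<cdot> e p\<close> with \<open>x\<close> in \<open>Q p\<close>
  form a left ideal of \<open>Q (Suc p)\<close>, which keeps the second part of
  \<open>F (Suc p)\<close> stable. By the decomposition of \<open>x\<close>, at most one generator
  of index \<open>p - 1\<close> separates the two generators of index \<open>p\<close>; all other
  factors commute with them.\<close>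

lemma left_ideal:
  assumes x: "x \<in> Q p"
  shows "\<exists>y \<in> Q p. v p \<cdot> (x \<cdot> e p) = y \<cdot> e p" "\<exists>y \<in> Q p. e p \<cdot> (x \<cdot> e p) = y \<cdot> e p"
proof -
  from x dec(1) have "x \<in> F p" by auto
  then consider
      (1) k y where "x = up k p \<cdot> y" "1 \<le> k" "k \<le> p" "y \<in> Q (p - 1)"
    | (2) k y where "x = y \<cdot> (e (p - 1) \<cdot> dn k (p - 1))" "1 \<le> k" "k < p" "y \<in> Q (p - 1)"
    unfolding F_def by blast
  then have "(\<exists>y \<in> Q p. v p \<cdot> (x \<cdot> e p) = y \<cdot> e p) \<and> (\<exists>y \<in> Q p. e p \<cdot> (x \<cdot> e p) = y \<cdot> e p)"
  proof cases
    case 1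
    have ye: "y \<cdot> e p = e p \<cdot> y" and yv: "y \<cdot> v p = v p \<cdot> y" and yQ: "y \<in> Q p"
      using 1 p Q_e_commute[of y "p - 1" p] Q_v_commute[of y "p - 1" p] Q_mono[of y "p - 1" p] by auto
    show ?thesis
    proof (cases "k = p")
      case True
      then have "x = y" using 1 by simp
      moreover have "v p \<cdot> (y \<cdot> e p) = y \<cdot> e p" using p by (simp add: swap_commute[OF yv] v_e)
      moreover have "e p \<cdot> (y \<cdot> e p) = (z \<cdot> y) \<cdot> e p" using p by (simp add: swap_commute[OF ye] e_e) (simp add: assoc[symmetric] z_Q_commute[OF yQ])
      ultimately show ?thesis using yQ by (auto intro: Q.intros)
    next
      case False
      then obtain r where r: "p = Suc r" "1 \<le> r" "k \<le> r" using 1 by (cases p) auto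
      have ue: "up k r \<cdot> e p = e p \<cdot> up k r" and uv: "up k r \<cdot> v p = v p \<cdot> up k r"
        and uQ: "up k r \<in> Q p"
        using 1 p r up_Q[of k r] Q_e_commute[of _ r p] Q_v_commute[of _ r p] Q_mono[of _ r p] by auto
      have x: "x = up k r \<cdot> (v r \<cdot> y)" using 1 r by (simp add: assoc)
      have eq: "e r \<cdot> e p = v p \<cdot> (v r \<cdot> e p)" "e p \<cdot> v r \<cdot> e p = e p"
        using r p by (auto intro!: e_e_adj e_v_e)
      have "v p \<cdot> (x \<cdot> e p) = up k r \<cdot> (v p \<cdot> (v r \<cdot> e p)) \<cdot> y"
        unfolding x by (simp add: assoc ye swap_commute[OF uv])
      also have "\<dots> = (up k r \<cdot> (e r \<cdot> y)) \<cdot> e p" by (simp add: eq(1)[symmetric] assoc ye)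
      finally have 3: "v p \<cdot> (x \<cdot> e p) = (up k r \<cdot> (e r \<cdot> y)) \<cdot> e p" .
      have "e p \<cdot> (x \<cdot> e p) = up k r \<cdot> (e p \<cdot> v r \<cdot> e p) \<cdot> y"
        unfolding x by (simp add: assoc ye swap_commute[OF ue])
      also have "\<dots> = (up k r \<cdot> y) \<cdot> e p" unfolding eq by (simp add: assoc ye)
      finally show ?thesis using 3 uQ yQ r by (auto intro!: Q.intros)
    qed
  next
    case 2
    then obtain r where r: "p = Suc r" "1 \<le> r" "k \<le> r" by (cases p) auto
    have ye: "y \<cdot> e p = e p \<cdot> y" and yv: "y \<cdot> v p = v p \<cdot> y" and yQ: "y \<in> Q p"
      using 2 p Q_e_commute[of y "p - 1" p] Q_v_commute[of y "p - 1" p] Q_mono[of y "p - 1" p] by auto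
    have de: "dn k r \<cdot> e p = e p \<cdot> dn k r" and dQ: "dn k r \<in> Q p"
      using 2 p r dn_Q[of k r] Q_e_commute[of _ r p] Q_mono[of _ r p] by auto
    have x: "x = y \<cdot> (e r \<cdot> dn k r)" using 2 r by simp
    have eq: "v p \<cdot> (e r \<cdot> e p) = v r \<cdot> e p" "e p \<cdot> (e r \<cdot> e p) = e p"
      using r p by (auto intro!: v_e_e_adj e_e_e)
    have "v p \<cdot> (x \<cdot> e p) = y \<cdot> (v p \<cdot> (e r \<cdot> e p)) \<cdot> dn k r"
      unfolding x by (simp add: assoc de swap_commute[OF yv])
    also have "\<dots> = (y \<cdot> (v r \<cdot> dn k r)) \<cdot> e p" unfolding eq by (simp add: assoc de)
    finally have 3: "v p \<cdot> (x \<cdot> e p) = (y \<cdot> (v r \<cdot> dn k r)) \<cdot> e p" .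
    have "e p \<cdot> (x \<cdot> e p) = y \<cdot> (e p \<cdot> (e r \<cdot> e p)) \<cdot> dn k r"
      unfolding x by (simp add: assoc de swap_commute[OF ye])
    also have "\<dots> = (y \<cdot> dn k r) \<cdot> e p" unfolding eq by (simp add: assoc de)
    finally show ?thesis using 3 dQ yQ r by (auto intro!: Q.intros)
  qed
  then show "\<exists>y \<in> Q p. v p \<cdot> (x \<cdot> e p) = y \<cdot> e p" "\<exists>y \<in> Q p. e p \<cdot> (x \<cdot> e p) = y \<cdot> e p" by auto
qed

text \<open>This is what \<open>e_up\<close> leaves to be done. Here \<open>x\<close> stands to the
  right of \<open>e p\<close>, so it is split by \<open>F'\<close>, which offers a factor from
  \<open>Q (p - 1)\<close> on the left that commutes with \<open>e p\<close>, or a chain to be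
  combined with \<open>e p\<close>.\<close>

lemma eu_e_F:
  assumes k: "1 \<le> k" "k \<le> p" and x: "x \<in> Q p"
  shows "eu k p \<cdot> (e p \<cdot> x) \<in> F (Suc p)"
proof -
  have euQ: "eu k p \<in> Q p" using k eu_Q by auto
  from x dec(2) have "x \<in> F' p" by auto
  then consider
      (1) j y where "x = y \<cdot> dn j p" "1 \<le> j" "j \<le> p" "y \<in> Q (p - 1)"
    | (2) j y where "x = up j (p - 1) \<cdot> e (p - 1) \<cdot> y" "1 \<le> j" "j < p" "y \<in> Q (p - 1)"
    unfolding F'_def by blast
  then show ?thesis
  proof cases
    case 1
    have ye: "y \<cdot> e p = e p \<cdot> y" and yQ: "y \<in> Q p"
      using 1 p Q_e_commute[of y "p - 1" p] Q_mono[of y "p - 1" p] by auto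
    have "eu k p \<cdot> (e p \<cdot> x) = (eu k p \<cdot> y) \<cdot> (e p \<cdot> dn j p)" using 1 ye by (metis assoc)
    then show ?thesis using 1 F_I2[of j p "eu k p \<cdot> y"] euQ yQ by (auto intro: Q.intros)
  next
    case 2
    then obtain r where r: "p = Suc r" "1 \<le> r" "j \<le> r" by (cases p) auto
    have ue: "up j r \<cdot> e p = e p \<cdot> up j r"
      using 2 p r up_Q[of j r] Q_e_commute[of _ r p] by auto
    have yQ: "y \<in> Q p" using 2 Q_mono[of y "p - 1" p] by auto
    \<comment> \<open>This completes the crossings of \<open>x\<close> to a chain up to index
      \<open>p\<close>, as the first part of \<open>F\<close> requires.\<close>
    have eq: "e p \<cdot> e r = v r \<cdot> (v p \<cdot> e r)" using r p by (auto intro!: e_e_adj)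
    have "e p \<cdot> x = up j r \<cdot> (e p \<cdot> e r) \<cdot> y" using 2 r ue by (simp add: assoc) (metis assoc)
    also have "\<dots> = up j (Suc p) \<cdot> (e r \<cdot> y)" using eq r by (simp add: assoc)
    finally have ex: "e p \<cdot> x = up j (Suc p) \<cdot> (e r \<cdot> y)" .
    have eyQ: "e r \<cdot> y \<in> Q p" using yQ r by (auto intro!: Q_mul Q_e)
    \<comment> \<open>If \<open>j < k\<close>, the chain of \<open>e\<close> is shifted through the
      crossings; if \<open>j = r\<close>, the two chains cancel at the turn; otherwise two crossings
      are absorbed.\<close>
    consider (a) "j < k" | (b) "k \<le> j" "j = r" | (c) "k \<le> j" "j < r" using r by linarith
    then show ?thesis
    proof cases
      case a
      have "eu k p \<cdot> (e p \<cdot> x) = up j (Suc p) \<cdot> (eu (k - 1) (p - 1) \<cdot> (e r \<cdot> y))"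
        using eu_up_below[of j k p] a k p 2 ex by (metis assoc)
      moreover have "eu (k - 1) (p - 1) \<in> Q p"
        using a 2 eu_Q[of "k - 1" "p - 1"] Q_mono[of _ "p - 1" p] by auto
      ultimately show ?thesis using F_I1[of j p] 2 r eyQ by (auto intro: Q.intros)
    next
      case b
      have "e r \<cdot> (v p \<cdot> e r) = e r" using e_v_e[of r p] r p by (simp add: assoc)
      moreover have "e r \<cdot> v r = e r" using e_v r p by auto
      moreover have "eu k p = eu k r \<cdot> e r" "up j (Suc p) = v r \<cdot> v p" using b r by auto
      ultimately have "eu k p \<cdot> (e p \<cdot> x) = eu k p \<cdot> y" using ex by (metis assoc)
      \<comment> \<open>The crossings have disappeared: this is the piece of \<open>F\<close> with
        the empty chain.\<close>
      then show ?thesis using F_I1[of "Suc p" p "eu k p \<cdot> y"] euQ yQ by (auto intro: Q.intros)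
    next
      case c
      have "eu k p \<cdot> (e p \<cdot> x) = up (j + 2) (Suc p) \<cdot> (eu k (p - 1) \<cdot> (e r \<cdot> y))"
        using eu_up_above[of k j p] c k p r ex by (metis Suc_leI add_2_eq_Suc' assoc not_less_eq_eq)
      moreover have "eu k (p - 1) \<in> Q p"
        using k eu_Q[of k "p - 1"] Q_mono[of _ "p - 1" p] by auto
      ultimately show ?thesis using F_I1[of "j + 2" p "eu k (p - 1) \<cdot> (e r \<cdot> y)"] c r eyQ Q_mul by (simp del: up.simps eu.simps)
    qed
  qed
qed

text \<open>In the first part of \<open>F\<close>, \<open>v i\<close> lengthens the chain if
  \<open>i + 1 = k\<close>, shortens it if \<open>i = k\<close>, and otherwise passes through
  it.\<close>

lemma v_F:
  assumes i: "1 \<le> i" "i \<le> p" and w: "w \<in> F (Suc p)"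
  shows "v i \<cdot> w \<in> F (Suc p)"
proof -
  from w consider
      (1) k x where "w = up k (Suc p) \<cdot> x" "1 \<le> k" "k \<le> Suc p" "x \<in> Q p"
    | (2) k x where "w = x \<cdot> (e p \<cdot> dn k p)" "1 \<le> k" "k \<le> p" "x \<in> Q p"
    unfolding F_def by auto
  then show ?thesis
  proof cases
    case 1
    consider (low) "i + 1 < k" | (2) "i + 1 = k" | (3) "i = k" | (4) "k < i" by linarith
    then show ?thesis
    proof cases
      case low
      have "v i \<cdot> up k (Suc p) = up k (Suc p) \<cdot> v i"
        using 1 low p i by (intro up_commute v_v_far) auto
      then have "v i \<cdot> w = up k (Suc p) \<cdot> (v i \<cdot> x)" using 1 by (metis assoc)
      then show ?thesis using 1 low i by (auto intro!: F_I1 Q.intros simp del: up.simps)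
    next
      case 2
      then have "v i \<cdot> w = up i (Suc p) \<cdot> x" using up_front[of i "Suc p"] 1 i by (simp add: assoc)
      then show ?thesis using 1 i F_I1[of i p x] by auto
    next
      case 3
      then have "v i \<cdot> w = up (Suc i) (Suc p) \<cdot> x"
        using up_front[of i "Suc p"] 1 i p v_v_cancel by (simp add: assoc del: up.simps)
      then show ?thesis using 1 i 3 F_I1[of "Suc i" p x] by auto
    next
      case 4
      have "v i \<cdot> up k (Suc p) = up k (Suc p) \<cdot> v (i - 1)" using 1 4 p i by (intro v_up_shift) auto
      then have "v i \<cdot> w = up k (Suc p) \<cdot> (v (i - 1) \<cdot> x)" using 1 by (metis assoc)
      then show ?thesis using 1 4 i by (auto intro!: F_I1 Q.intros simp del: up.simps)
    qed
  next
    case 2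
    have "\<exists>y \<in> Q p. v i \<cdot> (x \<cdot> e p) = y \<cdot> e p"
    proof (cases "i = p")
      case False
      then have "v i \<cdot> x \<in> Q p" using i 2 by (auto intro!: Q_mul Q_v Q_e)
      then show ?thesis by (metis assoc)
    qed (use left_ideal 2 in auto)
    then obtain y where y: "y \<in> Q p" "v i \<cdot> (x \<cdot> e p) = y \<cdot> e p" by auto
    then have "v i \<cdot> w = y \<cdot> (e p \<cdot> dn k p)" using 2 by (metis assoc)
    then show ?thesis using F_I2 2 y by auto
  qed
qed

lemma e_F:
  assumes i: "1 \<le> i" "i \<le> p" and w: "w \<in> F (Suc p)"
  shows "e i \<cdot> w \<in> F (Suc p)"
proof -
  from w consider
      (1) k x where "w = up k (Suc p) \<cdot> x" "1 \<le> k" "k \<le> Suc p" "x \<in> Q p"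
    | (2) k x where "w = x \<cdot> (e p \<cdot> dn k p)" "1 \<le> k" "k \<le> p" "x \<in> Q p"
    unfolding F_def by auto
  then show ?thesis
  proof cases
    case 1
    \<comment> \<open>The case \<open>i + 1 = k\<close> reduces to this one too, since
      \<open>e i\<close> absorbs the missing crossing \<open>v i\<close>.\<close>
    have diag: "e i \<cdot> (up i (Suc p) \<cdot> x) \<in> F (Suc p)"
    proof -
      have "dn i p \<cdot> x \<in> Q p" using 1 i dn_Q by (auto intro: Q.intros)
      then have "eu i p \<cdot> (e p \<cdot> (dn i p \<cdot> x)) \<in> F (Suc p)" using eu_e_F i by auto
      then show ?thesis using e_up[of i p] i p by (metis assoc)
    qed
    consider (low) "i + 1 < k" | (2) "i + 1 = k" | (3) "i = k" | (4) "k < i" by linarith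
    then show ?thesis
    proof cases
      case low
      have "e i \<cdot> up k (Suc p) = up k (Suc p) \<cdot> e i"
        using 1 low p i by (intro up_commute v_e_far[symmetric]) auto
      then have "e i \<cdot> w = up k (Suc p) \<cdot> (e i \<cdot> x)" using 1 by (metis assoc)
      then show ?thesis using 1 low i by (auto intro!: F_I1 Q.intros simp del: up.simps)
    next
      case 2
      have "e i \<cdot> (up i (Suc p) \<cdot> x) = e i \<cdot> w"
        using 2 1 up_front[of i "Suc p"] i p e_v_cancel by (simp add: assoc del: up.simps)
      then show ?thesis using diag by simp
    next
      case 3
      then show ?thesis using diag 1 by simp
    next
      case 4
      have "e i \<cdot> up k (Suc p) = up k (Suc p) \<cdot> e (i - 1)" using 1 4 p i by (intro e_up_shift) auto
      then have "e i \<cdot> w = up k (Suc p) \<cdot> (e (i - 1) \<cdot> x)" using 1 by (metis assoc)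
      then show ?thesis using 1 4 i by (auto intro!: F_I1 Q.intros simp del: up.simps)
    qed
  next
    case 2
    have "\<exists>y \<in> Q p. e i \<cdot> (x \<cdot> e p) = y \<cdot> e p"
    proof (cases "i = p")
      case False
      then have "e i \<cdot> x \<in> Q p" using i 2 by (auto intro!: Q_mul Q_v Q_e)
      then show ?thesis by (metis assoc)
    qed (use left_ideal 2 in auto)
    then obtain y where y: "y \<in> Q p" "e i \<cdot> (x \<cdot> e p) = y \<cdot> e p" by auto
    then have "e i \<cdot> w = y \<cdot> (e p \<cdot> dn k p)" using 2 by (metis assoc)
    then show ?thesis using F_I2 2 y by auto
  qed
qed

lemma z_F: "w \<in> F (Suc p) \<Longrightarrow> z \<cdot> w \<in> F (Suc p)"
proof -
  assume "w \<in> F (Suc p)"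
  then consider
      (1) k x where "w = up k (Suc p) \<cdot> x" "1 \<le> k" "k \<le> Suc p" "x \<in> Q p"
    | (2) k x where "w = x \<cdot> (e p \<cdot> dn k p)" "1 \<le> k" "k \<le> p" "x \<in> Q p"
    unfolding F_def by auto
  then show ?thesis
  proof cases
    case 1
    have "z \<cdot> up k (Suc p) = up k (Suc p) \<cdot> z" using z_Q_commute[OF up_Q] 1 p by (auto simp del: up.simps)
    then have "z \<cdot> w = up k (Suc p) \<cdot> (z \<cdot> x)" using 1 by (metis assoc)
    then show ?thesis using 1 by (auto intro!: F_I1 Q.intros simp del: up.simps)
  next
    case 2
    then have "z \<cdot> w = (z \<cdot> x) \<cdot> (e p \<cdot> dn k p)" by (metis assoc)
    then show ?thesis using 2 by (auto intro!: F_I2 Q.intros simp del: dn.simps)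
  qed
qed

lemma Q_F_Suc: "Q (Suc p) \<subseteq> F (Suc p)"
proof
  fix x assume "x \<in> Q (Suc p)"
  then have "\<forall>w \<in> F (Suc p). x \<cdot> w \<in> F (Suc p)"
    by (induction rule: Q.induct) (auto simp: z_F e_F v_F assoc)
  moreover have "unit \<in> F (Suc p)" using F_I1[of "Suc p" p unit] Q_unit by simp
  ultimately show "x \<in> F (Suc p)" by (metis unit_right)
qed

end

section \<open>Base case, mirror symmetry and the decomposition\<close>

lemma Q_F_1: "Q (Suc 0) \<subseteq> F (Suc 0)" "Q (Suc 0) \<subseteq> F' (Suc 0)"
proof -
  have "Q (Suc 0) \<subseteq> Q 0"
  proof
    fix x assume "x \<in> Q (Suc 0)" then show "x \<in> Q 0" by (induction rule: Q.induct) (auto intro: Q.intros)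
  qed
  then show "Q (Suc 0) \<subseteq> F (Suc 0)" "Q (Suc 0) \<subseteq> F' (Suc 0)"
    unfolding F_def F'_def by force+
qed

text \<open>Reversing words turns the relations into relations, so everything proved for
  \<open>F\<close> yields its counterpart for \<open>F'\<close> by interpreting the locale with
  reversed multiplication.\<close>

lemma mirror: "brauer_relations (\<lambda>x y. y \<cdot> x) unit z e v n"
proof
  fix i j assume "1 \<le> i" "i < n" "1 \<le> j" "j < n" and ij: "i = j + 1 \<or> j = i + 1"
  note i = this(1-4)
  show "e i \<cdot> (v j \<cdot> e i) = e i" using e_v_e[OF i ij] by (simp add: assoc)
  show "v i \<cdot> (v j \<cdot> v i) = v j \<cdot> (v i \<cdot> v j)" using v_v_v[OF i ij] by (simp add: assoc)
  show "e i \<cdot> (v j \<cdot> v i) = v j \<cdot> (v i \<cdot> e j)" using v_v_e[of j i] i ij by (auto simp: assoc)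
qed (simp_all add: assoc z_e z_v e_e v_v e_v v_e v_e_far, use e_e_far v_v_far in auto)

lemma mirror_F:
  "brauer_relations.Q (\<lambda>x y. y \<cdot> x) unit z e v m = Q m"
  "brauer_relations.up (\<lambda>x y. y \<cdot> x) unit v k m = dn k m"
  "brauer_relations.dn (\<lambda>x y. y \<cdot> x) unit v k m = up k m"
  "brauer_relations.F (\<lambda>x y. y \<cdot> x) unit z e v m = F' m"
  "brauer_relations.F' (\<lambda>x y. y \<cdot> x) unit z e v m = F m"
proof -
  interpret M: brauer_relations "\<lambda>x y. y \<cdot> x" unit z e v n by (rule mirror)
  have Q: "M.Q m = Q m" for m
  proof (intro subset_antisym subsetI)
    fix x assume "x \<in> M.Q m" then show "x \<in> Q m" by (induction rule: M.Q.induct) (auto intro: Q.intros)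
  next
    fix x assume "x \<in> Q m" then show "x \<in> M.Q m" by (induction rule: Q.induct) (auto intro: M.Q.intros)
  qed
  have up: "M.up k m = dn k m" and dn: "M.dn k m = up k m" for k m by (induction m) auto
  show "M.Q m = Q m" "M.up k m = dn k m" "M.dn k m = up k m" by (rule Q up dn)+
  show "M.F m = F' m" "M.F' m = F m" unfolding M.F_def F'_def M.F'_def F_def Q up dn by (auto simp: assoc)
qed

lemma Q_decomposition: "1 \<le> m \<Longrightarrow> m \<le> n \<Longrightarrow> Q m \<subseteq> F m \<and> Q m \<subseteq> F' m"
proof (induction m rule: nat_induct_at_least)
  case base then show ?case using Q_F_1 by simp
next
  case (Suc p)
  interpret M: brauer_relations "\<lambda>x y. y \<cdot> x" unit z e v n by (rule mirror)
  have "Q (Suc p) \<subseteq> F (Suc p)" using Suc by (intro Q_F_Suc) auto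
  moreover have "M.Q (Suc p) \<subseteq> M.F (Suc p)" using Suc by (intro M.Q_F_Suc) (auto simp: mirror_F)
  ultimately show ?case by (simp add: mirror_F)
qed

text \<open>Used to recover the factor in \<open>Q p\<close>: it strips the chain from the front in
  the first part of \<open>F\<close> and from the end in the second.\<close>

lemma dn_up: "1 \<le> k \<Longrightarrow> m \<le> n \<Longrightarrow> dn k m \<cdot> up k m = unit"
proof (induction m)
  case (Suc m)
  then have "dn k m \<cdot> (up k m \<cdot> v m) = v m" by (simp add: assoc[symmetric])
  then show ?case using Suc.prems v_v[of m] by (auto simp: assoc)
qed auto

end

section \<open>Injectivity of the representation by colourings\<close>

type_synonym colour_fn = "(nat \<Rightarrow> bool) \<Rightarrow> int"

definition opZ :: "colour_fn \<Rightarrow> colour_fn" where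
  "opZ f a = 2 * f a"

definition opV :: "nat \<Rightarrow> colour_fn \<Rightarrow> colour_fn" where
  "opV i f a = f (a(i := a (Suc i), Suc i := a i))"

text \<open>Multiplication by the matrix of \<open>E_i\<close>: the top arc forces equal colours,
  and the sum runs over the colour of the bottom arc.\<close>

definition opE :: "nat \<Rightarrow> colour_fn \<Rightarrow> colour_fn" where
  "opE i f a = (if a i = a (Suc i)
     then f (a(i := True, Suc i := True)) + f (a(i := False, Suc i := False)) else 0)"

text \<open>Multiplicativity is asked for on \<open>Q n\<close> because the representation
  constructed later chooses a representing monomial, which is available for the elements of
  \<open>Q n\<close>.\<close>

locale brauer_representation = brauer_relations +
  fixes R :: "'a \<Rightarrow> colour_fn \<Rightarrow> colour_fn"
  assumes R_unit: "R unit = id"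
    and R_z: "R z = opZ"
    and R_e: "1 \<le> i \<Longrightarrow> i < n \<Longrightarrow> R (e i) = opE i"
    and R_v: "1 \<le> i \<Longrightarrow> i < n \<Longrightarrow> R (v i) = opV i"
    and R_mul: "x \<in> Q n \<Longrightarrow> y \<in> Q n \<Longrightarrow> R (x \<cdot> y) = R x \<circ> R y"
begin

lemma R_mul': "x \<in> Q m \<Longrightarrow> y \<in> Q m \<Longrightarrow> m \<le> n \<Longrightarrow> R (x \<cdot> y) f = R x (R y f)"
  using R_mul Q_mono[of x m n] Q_mono[of y m n] by simp

lemma R_add: "x \<in> Q m \<Longrightarrow> m \<le> n \<Longrightarrow> R x (\<lambda>a. f a + g a) = (\<lambda>a. R x f a + R x g a)"
proof (induction arbitrary: f g rule: Q.induct)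
  case (Q_e i) then show ?case by (auto simp: R_e opE_def)
next
  case (Q_v i) then show ?case by (auto simp: R_v opV_def)
next
  case (Q_mul x y) then show ?case by (simp add: R_mul'[of _ m])
qed (auto simp: R_unit R_z opZ_def)

lemma R_zero: "x \<in> Q m \<Longrightarrow> m \<le> n \<Longrightarrow> R x (\<lambda>a. 0) = (\<lambda>a. 0)"
proof (induction rule: Q.induct)
  case (Q_e i) then show ?case by (auto simp: R_e opE_def)
next
  case (Q_v i) then show ?case by (auto simp: R_v opV_def)
next
  case (Q_mul x y) then show ?case by (simp add: R_mul'[of _ m])
qed (auto simp: R_unit R_z opZ_def)

text \<open>A constant colouring meets the constraint of every generator and is among the colourings
  summed over, so positivity there survives. This is how operators are shown not to vanish.\<close>

lemma R_pos:
  "x \<in> Q m \<Longrightarrow> m \<le> n \<Longrightarrow> (\<And>a. 0 \<le> f a) \<Longrightarrow> 0 < f (\<lambda>_. t) \<Longrightarrow> (\<forall>a. 0 \<le> R x f a) \<and> 0 < R x f (\<lambda>_. t)"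
proof (induction arbitrary: f rule: Q.induct)
  case (Q_e i)
  have "(\<lambda>_. t)(i := t, Suc i := t) = (\<lambda>_. t)" by (simp add: fun_eq_iff)
  with Q_e show ?case by (cases t) (auto simp: R_e opE_def add_pos_nonneg add_nonneg_pos)
next
  case (Q_v i)
  have "(\<lambda>_. t)(i := t, Suc i := t) = (\<lambda>_. t)" by (simp add: fun_eq_iff)
  with Q_v show ?case by (auto simp: R_v opV_def)
next
  case (Q_mul x y) then show ?case by (simp add: R_mul'[of _ m])
qed (auto simp: R_unit R_z opZ_def)

text \<open>Generators in \<open>Q m\<close> touch strands up to \<open>m\<close> only, so the
  colour of a later strand is a parameter.\<close>

lemma R_subst:
  "x \<in> Q m \<Longrightarrow> m \<le> n \<Longrightarrow> m < j \<Longrightarrow> R x (\<lambda>a. f (a(j := t))) a = R x f (a(j := t))"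
proof (induction arbitrary: f a rule: Q.induct)
  case (Q_e i)
  then have upd: "(a(j := t))(i := b, Suc i := c) = (a(i := b, Suc i := c))(j := t)"
    "(a(j := t)) i = a i" "(a(j := t)) (Suc i) = a (Suc i)" for b c
    by (simp_all add: fun_eq_iff)
  have "R (e i) = opE i" using Q_e R_e by simp
  then show ?case by (simp only: opE_def upd)
next
  case (Q_v i)
  then have upd: "(a(j := t))(i := b, Suc i := c) = (a(i := b, Suc i := c))(j := t)"
    "(a(j := t)) i = a i" "(a(j := t)) (Suc i) = a (Suc i)" for b c
    by (simp_all add: fun_eq_iff)
  have "R (v i) = opV i" using Q_v R_v by simp
  then show ?case by (simp only: opV_def upd)
next
  case (Q_mul x y)
  have y: "R y (\<lambda>a. f (a(j := t))) = (\<lambda>a. R y f (a(j := t)))" using Q_mul by blast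
  have xy: "R (x \<cdot> y) g = R x (R y g)" for g using Q_mul R_mul' by blast
  show ?case unfolding xy y using Q_mul by blast
qed (auto simp: R_unit R_z opZ_def)

lemma R_up:
  "1 \<le> k \<Longrightarrow> k \<le> m \<Longrightarrow> m \<le> n \<Longrightarrow>
    R (up k m) f a = f (\<lambda>j. if j = m then a k else if k \<le> j \<and> j < m then a (Suc j) else a j)"
proof (induction m arbitrary: f)
  case (Suc m)
  show ?case
  proof (cases "k = Suc m")
    case True
    then have "(\<lambda>j. if j = Suc m then a k else if k \<le> j \<and> j < Suc m then a (Suc j) else a j) = a"
      by (simp add: fun_eq_iff)
    then show ?thesis using True by (simp only: up_trivial R_unit id_apply order_refl)
  next
    case False
    have "up k m \<in> Q (Suc m)" "v m \<in> Q (Suc m)"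
      using Suc.prems False up_Q[of k m] Q_mono[of "up k m" m "Suc m"] by (auto intro: Q_v)
    then have "R (up k (Suc m)) f a = R (up k m) (opV m f) a"
      using Suc.prems False by (simp add: R_mul'[of _ "Suc m"] R_v)
    also have "\<dots> = f (\<lambda>j. if j = Suc m then a k else if k \<le> j \<and> j < Suc m then a (Suc j) else a j)"
    proof -
      let ?b = "\<lambda>j. if j = m then a k else if k \<le> j \<and> j < m then a (Suc j) else a j"
      have "?b(m := ?b (Suc m), Suc m := ?b m) =
          (\<lambda>j. if j = Suc m then a k else if k \<le> j \<and> j < Suc m then a (Suc j) else a j)"
        using Suc.prems False by (auto simp: fun_eq_iff)
      moreover have "R (up k m) (opV m f) a = opV m f ?b" using Suc False by (intro Suc.IH) auto
      ultimately show ?thesis by (simp only: opV_def)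
    qed
    finally show ?thesis .
  qed
qed auto

lemma R_dn:
  "1 \<le> k \<Longrightarrow> k \<le> m \<Longrightarrow> m \<le> n \<Longrightarrow>
    R (dn k m) f a = f (\<lambda>j. if j = k then a m else if k < j \<and> j \<le> m then a (j - 1) else a j)"
proof (induction m arbitrary: f a)
  case (Suc m)
  show ?case
  proof (cases "k = Suc m")
    case True
    then have "(\<lambda>j. if j = k then a (Suc m) else if k < j \<and> j \<le> Suc m then a (j - 1) else a j) = a"
      by (simp add: fun_eq_iff)
    then show ?thesis using True by (simp only: dn_trivial R_unit id_apply order_refl)
  next
    case False
    have "dn k m \<in> Q (Suc m)" "v m \<in> Q (Suc m)"
      using Suc.prems False dn_Q[of k m] Q_mono[of "dn k m" m "Suc m"] by (auto intro: Q_v)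
    then have "R (dn k (Suc m)) f a = opV m (R (dn k m) f) a"
      using Suc.prems False by (simp add: R_mul'[of _ "Suc m"] R_v)
    also have "\<dots> = f (\<lambda>j. if j = k then a (Suc m) else if k < j \<and> j \<le> Suc m then a (j - 1) else a j)"
    proof -
      let ?b = "a(m := a (Suc m), Suc m := a m)"
      have "(\<lambda>j. if j = k then ?b m else if k < j \<and> j \<le> m then ?b (j - 1) else ?b j) =
          (\<lambda>j. if j = k then a (Suc m) else if k < j \<and> j \<le> Suc m then a (j - 1) else a j)"
      proof
        fix j
        consider "j < k" | "j = k" | "k < j" "j \<le> m" | "j = Suc m" | "Suc m < j" by linarith
        then show "(if j = k then ?b m else if k < j \<and> j \<le> m then ?b (j - 1) else ?b j) =
          (if j = k then a (Suc m) else if k < j \<and> j \<le> Suc m then a (j - 1) else a j)"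
          using Suc.prems False by cases auto
      qed
      moreover have "R (dn k m) f ?b = f (\<lambda>j. if j = k then ?b m else if k < j \<and> j \<le> m then ?b (j - 1) else ?b j)"
        using Suc False by (intro Suc.IH) auto
      ultimately show ?thesis by (simp only: opV_def)
    qed
    finally show ?thesis .
  qed
qed auto

text \<open>Only the top point \<open>k\<close> is marked; the chain carries the mark to strand
  \<open>p + 1\<close>, which \<open>x\<close> leaves alone.\<close>

lemma R_up_mul:
  assumes "1 \<le> k" "k \<le> Suc p" "Suc p \<le> n" "x \<in> Q p"
  shows "R (up k (Suc p) \<cdot> x) f ((\<lambda>_. False)(k := True)) = R x (\<lambda>c. f (c(Suc p := True))) (\<lambda>_. False)"
proof -
  have "R (up k (Suc p) \<cdot> x) f = R (up k (Suc p)) (R x f)"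
    using assms up_Q[of k "Suc p"] Q_mono[of x p "Suc p"] by (intro R_mul'[of _ "Suc p"]) auto
  moreover have "(\<lambda>j. if j = Suc p then ((\<lambda>_. False)(k := True)) k else if k \<le> j \<and> j < Suc p
      then ((\<lambda>_. False)(k := True)) (Suc j) else ((\<lambda>_. False)(k := True)) j) = (\<lambda>_. False)(Suc p := True)"
    using assms by (auto simp: fun_eq_iff)
  ultimately show ?thesis
    using R_up[of k "Suc p"] assms R_subst[of x p "Suc p" f True "\<lambda>_. False"] by (simp del: up.simps)
qed

lemma R_e_dn_mul:
  assumes "1 \<le> k" "k \<le> p" "p < n" "x \<in> Q p"
  shows "R (x \<cdot> (e p \<cdot> dn k p)) f =
    R x (opE p (\<lambda>a. f (\<lambda>j. if j = k then a p else if k < j \<and> j \<le> p then a (j - 1) else a j)))"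
proof -
  have Q: "x \<in> Q (Suc p)" "e p \<in> Q (Suc p)" "dn k p \<in> Q (Suc p)"
    using assms dn_Q[of k p] Q_mono[of _ p "Suc p"] by (auto intro: Q_e)
  have "R (x \<cdot> (e p \<cdot> dn k p)) f = R x (opE p (R (dn k p) f))"
    using assms Q by (simp add: R_mul'[of _ "Suc p"] Q_mul R_e)
  also have "R (dn k p) f = (\<lambda>a. f (\<lambda>j. if j = k then a p else if k < j \<and> j \<le> p then a (j - 1) else a j))"
    using R_dn[of k p f] assms by auto
  finally show ?thesis .
qed

text \<open>
  The factor \<open>e p\<close> copies the colour of strand \<open>p\<close> to strand \<open>p + 1\<close>, where \<open>x\<close> and \<open>y\<close> act trivially,
  so that nothing is lost.
\<close>

lemma R_cancel_e:
  assumes x: "x \<in> Q p" and y: "y \<in> Q p" and p: "1 \<le> p" "p < n" and eq: "R (x \<cdot> e p) = R (y \<cdot> e p)"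
  shows "R x = R y"
proof (intro ext)
  fix f :: colour_fn and a :: "nat \<Rightarrow> bool"
  let ?m = "Suc p"
  define t where "t = a ?m"
  \<comment> \<open>\<open>h s\<close> sees only colourings in which both strands are True, so
    exactly one summand of \<open>opE p (h s)\<close> survives. At a colouring whose strand
    \<open>p + 1\<close> has colour \<open>s\<close>, the constraint of \<open>opE\<close> then
    tests whether strand \<open>p\<close> has colour \<open>s\<close>, which gives
    \<open>g s\<close>. Summing \<open>g s\<close> over both \<open>s\<close> restores
    \<open>f\<close>.\<close>
  define h where "h s c = (if c p \<and> c ?m then f (c(p := s, ?m := t)) else 0)" for s and c :: "nat \<Rightarrow> bool"
  define g where "g s c = (if c p = s then f (c(p := s, ?m := t)) else 0)" for s and c :: "nat \<Rightarrow> bool"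
  have g: "g s c = opE p (h s) (c(?m := s))" for s c
    by (auto simp: g_def h_def opE_def fun_upd_twist)
  have R: "R w f a = R (w \<cdot> e p) (h True) (a(?m := True)) + R (w \<cdot> e p) (h False) (a(?m := False))"
    if w: "w \<in> Q p" for w
  proof -
    have we: "R (w \<cdot> e p) f = R w (opE p f)" for f
      using w p Q_mono[of w p ?m] by (subst R_mul'[of _ ?m]) (auto simp: R_e intro: Q_e)
    have "R w f a = R w (\<lambda>c. f (c(?m := t))) a"
      using R_subst[of w p ?m f t a] w p by (simp add: t_def)
    also have "(\<lambda>c. f (c(?m := t))) = (\<lambda>c. g True c + g False c)"
    proof
      fix c show "f (c(?m := t)) = g True c + g False c"
        using fun_upd_triv[of c p] by (cases "c p") (auto simp: g_def)
    qed
    also have "R w \<dots> a = R w (g True) a + R w (g False) a" using R_add[of w p] w p by simp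
    finally have "R w f a = R w (g True) a + R w (g False) a" .
    moreover have "R w (g s) a = R (w \<cdot> e p) (h s) (a(?m := s))" for s
    proof -
      have "g s = (\<lambda>c. opE p (h s) (c(?m := s)))" using g by blast
      then show ?thesis using R_subst[of w p ?m "opE p (h s)" s a] w p we[of "h s"] by simp
    qed
    ultimately show ?thesis by simp
  qed
  show "R x f a = R y f a" using R[OF x] R[OF y] eq by simp
qed

text \<open>Without generators of index below 1 there are only powers of \<open>z\<close>, told
  apart by their value on the constant function 1.\<close>

lemma R_inj_1:
  assumes "x \<in> Q 1" "y \<in> Q 1" "R x = R y" "1 \<le> n"
  shows "x = y"
proof -
  have zpow: "((\<cdot>) z ^^ k) unit \<cdot> w = ((\<cdot>) z ^^ k) w" for k w by (induction k) (auto simp: assoc)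
  have ex: "\<exists>k. w = ((\<cdot>) z ^^ k) unit" if "w \<in> Q 1" for w
    using that
  proof (induction rule: Q.induct)
    case Q_unit then show ?case by (intro exI[of _ 0]) simp
  next
    case Q_z then show ?case by (intro exI[of _ 1]) simp
  next
    case (Q_mul x y)
    then obtain k l where "x = ((\<cdot>) z ^^ k) unit" "y = ((\<cdot>) z ^^ l) unit" by auto
    then show ?case by (intro exI[of _ "k + l"]) (simp add: zpow funpow_add)
  qed auto
  have Qz: "((\<cdot>) z ^^ k) unit \<in> Q 1" for k by (induction k) (auto intro: Q.intros)
  have R: "R (((\<cdot>) z ^^ k) unit) (\<lambda>_. 1) = (\<lambda>_. 2 ^ k)" for k
  proof (induction k)
    case (Suc k)
    then show ?case using R_mul'[of z 1 "((\<cdot>) z ^^ k) unit"] Qz assms(4) by (simp add: R_z opZ_def Q_z)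
  qed (simp add: R_unit)
  obtain k l where kl: "x = ((\<cdot>) z ^^ k) unit" "y = ((\<cdot>) z ^^ l) unit" using ex assms by blast
  then have "(2::int) ^ k = 2 ^ l" using R[of k] R[of l] assms(3) by (metis)
  then show ?thesis using kl by simp
qed

section \<open>Separating the pieces of the decomposition\<close>

lemma R_up_ne_up:
  assumes "1 \<le> k" "k \<le> Suc p" "1 \<le> j" "j \<le> Suc p" "Suc p \<le> n" "x \<in> Q p" "y \<in> Q p" "k \<noteq> j"
  shows "R (up k (Suc p) \<cdot> x) \<noteq> R (up j (Suc p) \<cdot> y)"
proof
  \<comment> \<open>The function reads the colour of strand \<open>p + 1\<close>, and the colouring
    marks the top point \<open>k\<close>. The chain from \<open>k\<close> brings the mark to strand
    \<open>p + 1\<close>; the chain from \<open>j\<close> brings the unmarked colour of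
    \<open>j\<close>.\<close>
  let ?m = "Suc p" and ?f = "\<lambda>a. of_bool (a (Suc p)) :: int" and ?a = "(\<lambda>_. False)(k := True)"
  let ?b = "\<lambda>i. if i = ?m then ?a j else if j \<le> i \<and> i < ?m then ?a (Suc i) else ?a i"
  assume eq: "R (up k ?m \<cdot> x) = R (up j ?m \<cdot> y)"
  have "R (up k ?m \<cdot> x) ?f ?a = R x (\<lambda>c. 1) (\<lambda>_. False)" using assms R_up_mul[of k p x ?f] by simp
  also have "\<dots> > 0" using R_pos[of x p "\<lambda>_. 1"] assms by simp
  finally have "R (up j ?m \<cdot> y) ?f ?a > 0" using eq by simp
  moreover have "R (up j ?m \<cdot> y) ?f ?a = R y ?f ?b"
    using assms up_Q[of j ?m] Q_mono[of y p ?m] R_up[of j ?m] R_mul'[of _ ?m] by (simp del: up.simps)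
  moreover have "?b = ?b(?m := False)" using assms by (auto simp: fun_eq_iff)
  moreover have "R y ?f (?b(?m := False)) = 0"
    using R_subst[of y p ?m ?f False ?b] R_zero[of y p] assms by simp
  ultimately show False by simp
qed

lemma R_up_ne_e_dn:
  assumes "1 \<le> k" "k \<le> Suc p" "1 \<le> j" "j \<le> p" "Suc p \<le> n" "x \<in> Q p" "y \<in> Q p"
  shows "R (up k (Suc p) \<cdot> x) \<noteq> R (y \<cdot> (e p \<cdot> dn j p))"
proof
  let ?m = "Suc p"
  \<comment> \<open>The function vanishes when the bottom points \<open>j\<close> and
    \<open>p + 1\<close> share a colour. The arc joining them in the second product therefore kills
    it, while in the first product \<open>p + 1\<close> receives the mark and \<open>j\<close> can
    stay unmarked.\<close>
  let ?f = "\<lambda>a. of_bool (a j \<noteq> a ?m) :: int"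
  assume eq: "R (up k ?m \<cdot> x) = R (y \<cdot> (e p \<cdot> dn j p))"
  have "opE p (\<lambda>a. ?f (\<lambda>i. if i = j then a p else if j < i \<and> i \<le> p then a (i - 1) else a i)) = (\<lambda>_. 0)"
    using assms by (auto simp: opE_def fun_eq_iff)
  then have "R (y \<cdot> (e p \<cdot> dn j p)) ?f = (\<lambda>_. 0)"
    using R_e_dn_mul[of j p y ?f] R_zero[of y p] assms by simp
  moreover have "R (up k ?m \<cdot> x) ?f ((\<lambda>_. False)(k := True)) > 0"
    using R_up_mul[of k p x ?f] R_pos[of x p "\<lambda>a. of_bool (\<not> a j)" False] assms by simp
  ultimately show False using eq by simp
qed

lemma R_e_dn_ne_e_dn:
  assumes "1 \<le> k" "k \<le> p" "1 \<le> j" "j \<le> p" "Suc p \<le> n" "x \<in> Q p" "y \<in> Q p" "k \<noteq> j"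
  shows "R (x \<cdot> (e p \<cdot> dn k p)) \<noteq> R (y \<cdot> (e p \<cdot> dn j p))"
proof
  let ?m = "Suc p"
  let ?f = "\<lambda>a. of_bool (a k \<noteq> a ?m) :: int"
  assume eq: "R (x \<cdot> (e p \<cdot> dn k p)) = R (y \<cdot> (e p \<cdot> dn j p))"
  have "opE p (\<lambda>a. ?f (\<lambda>i. if i = k then a p else if k < i \<and> i \<le> p then a (i - 1) else a i)) = (\<lambda>_. 0)"
    using assms by (auto simp: opE_def fun_eq_iff)
  then have "R (x \<cdot> (e p \<cdot> dn k p)) ?f = (\<lambda>_. 0)"
    using R_e_dn_mul[of k p x ?f] R_zero[of x p] assms by simp
  \<comment> \<open>For \<open>k \<noteq> j\<close> the colour compared with strand
    \<open>p + 1\<close> comes from a strand other than \<open>p\<close> and \<open>p + 1\<close>,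
    so exactly one of the two summed colours differs from it.\<close>
  moreover have "opE p (\<lambda>a. ?f (\<lambda>i. if i = j then a p else if j < i \<and> i \<le> p then a (i - 1) else a i))
    = (\<lambda>a. of_bool (a p = a ?m))"
    using assms by (auto simp: opE_def fun_eq_iff)
  then have "R (y \<cdot> (e p \<cdot> dn j p)) ?f (\<lambda>_. True) > 0"
    using R_e_dn_mul[of j p y ?f] R_pos[of y p "\<lambda>a. of_bool (a p = a ?m)" True] assms by simp
  ultimately show False using eq by simp
qed

theorem R_inj:
  assumes "1 \<le> m" "m \<le> n" "x \<in> Q m" "y \<in> Q m" "R x = R y"
  shows "x = y"
  using assms
proof (induction m arbitrary: x y rule: nat_induct_at_least)
  case base then show ?case using R_inj_1 by simp
next
  case (Suc p)
  let ?m = "Suc p"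
  have dec: "(\<exists>k w. x = up k ?m \<cdot> w \<and> 1 \<le> k \<and> k \<le> ?m \<and> w \<in> Q p) \<or>
      (\<exists>k w. x = w \<cdot> (e p \<cdot> dn k p) \<and> 1 \<le> k \<and> k \<le> p \<and> w \<in> Q p)" if "x \<in> Q ?m" for x
    proof -
    have "x \<in> F ?m" using Q_decomposition[of ?m] that Suc.prems by auto
    then show ?thesis unfolding F_def diff_Suc_1 less_Suc_eq_le by blast
  qed
  show ?case
  proof (cases "\<exists>k w. x = up k ?m \<cdot> w \<and> 1 \<le> k \<and> k \<le> ?m \<and> w \<in> Q p")
    case True
    then obtain k w where x: "x = up k ?m \<cdot> w" "1 \<le> k" "k \<le> ?m" "w \<in> Q p" by blast
    have "\<not> (\<exists>j u. y = u \<cdot> (e p \<cdot> dn j p) \<and> 1 \<le> j \<and> j \<le> p \<and> u \<in> Q p)"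
      using R_up_ne_e_dn x Suc.prems by blast
    then obtain j u where y: "y = up j ?m \<cdot> u" "1 \<le> j" "j \<le> ?m" "u \<in> Q p"
      using dec Suc.prems by blast
    have j: "k = j" using R_up_ne_up x y Suc.prems by blast
    have w: "dn k ?m \<cdot> x = w" and u: "dn k ?m \<cdot> y = u"
      using x y j dn_up[of k ?m] Suc.prems by (simp_all add: assoc[symmetric] del: up.simps dn.simps)
    have "R w = R u" 
      using R_mul'[of "dn k ?m" ?m] dn_Q[of k ?m] x(2) Suc.prems
      unfolding w[symmetric] u[symmetric] by (intro ext) (simp del: dn.simps)
    then have "w = u" using Suc.IH Suc.prems(1) x(4) y(4) by simp
    then show ?thesis using x(1) y(1) j by simp
  next
    case False
    then obtain k w where x: "x = w \<cdot> (e p \<cdot> dn k p)" "1 \<le> k" "k \<le> p" "w \<in> Q p"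
      using dec Suc.prems by blast
    have "\<not> (\<exists>j u. y = up j ?m \<cdot> u \<and> 1 \<le> j \<and> j \<le> ?m \<and> u \<in> Q p)"
      using R_up_ne_e_dn[symmetric] x Suc.prems by blast
    then obtain j u where y: "y = u \<cdot> (e p \<cdot> dn j p)" "1 \<le> j" "j \<le> p" "u \<in> Q p"
      using dec Suc.prems by blast
    have j: "k = j" using R_e_dn_ne_e_dn x y Suc.prems by blast
    \<comment> \<open>Here only the descending chain can be inverted; the factor \<open>e p\<close>
      has no inverse and is removed by \<open>R_cancel_e\<close>.\<close>
    have w: "x \<cdot> up k p = w \<cdot> e p" and u: "y \<cdot> up k p = u \<cdot> e p"
      using x y j dn_up[of k p] Suc.prems by (simp_all add: assoc)
    have "up k p \<in> Q ?m" using up_Q[of k p] Q_mono[of "up k p" p ?m] x(2) by simp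
    then have "R (x \<cdot> up k p) = R (y \<cdot> up k p)"
      using Suc.prems R_mul'[of x ?m "up k p"] R_mul'[of y ?m "up k p"] by (intro ext) metis
    then have "R (w \<cdot> e p) = R (u \<cdot> e p)" using w u by simp
    then have "R w = R u" using R_cancel_e[OF x(4) y(4)] Suc by simp
    then have "w = u" using Suc.IH Suc.prems(1) x(4) y(4) by simp
    then show ?thesis using x(1) y(1) j by simp
  qed
qed

end

section \<open>Tangles as matrices\<close>

definition col :: "(nat \<Rightarrow> bool) \<Rightarrow> (nat \<Rightarrow> bool) \<Rightarrow> nat \<times> nat \<Rightarrow> bool" where
  "col a b x = (if fst x = 0 then a (snd x) else b (snd x))"

definition blockwise :: "'a set set \<Rightarrow> ('a \<Rightarrow> bool) \<Rightarrow> bool" where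
  "blockwise E f \<longleftrightarrow> (\<forall>p \<in> E. \<forall>x \<in> p. \<forall>y \<in> p. f x = f y)"

text \<open>The column of the matrix at the bottom colouring \<open>b\<close>, as a function of the
  top colouring \<open>a\<close>. With this order of arguments the operators act on
  \<open>kern E b\<close> directly.\<close>

definition kern :: "tangle \<Rightarrow> (nat \<Rightarrow> bool) \<Rightarrow> colour_fn" where
  "kern E b a = of_bool (blockwise E (col a b))"

lemma flat_tangles_iff:
  "E \<in> flat_tangles n \<longleftrightarrow>
    \<Union> E = tangle_points n \<and> (\<forall>p \<in> E. card p = 2) \<and> (\<forall>p \<in> E. \<forall>q \<in> E. p \<noteq> q \<longrightarrow> p \<inter> q = {})"
  unfolding flat_tangles_def partition_on_def disjoint_def by auto

lemma flat_partner:
  assumes "E \<in> flat_tangles n" "x \<in> tangle_points n"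
  obtains y where "y \<noteq> x" "{x, y} \<in> E" "y \<in> tangle_points n"
proof -
  obtain p where p: "p \<in> E" "x \<in> p" using assms unfolding flat_tangles_iff by blast
  then have "card p = 2" using assms unfolding flat_tangles_iff by blast
  then obtain u v where "p = {u, v}" "u \<noteq> v" by (auto simp: card_2_iff)
  then obtain y where y: "y \<noteq> x" "p = {x, y}" using p that by (metis insertE insert_commute singletonD)
  moreover have "y \<in> tangle_points n" using p y assms unfolding flat_tangles_iff by blast
  ultimately show ?thesis using that p by blast
qed

lemma flat_block_unique:
  assumes "E \<in> flat_tangles n" "p \<in> E" "q \<in> E" "x \<in> p" "x \<in> q"
  shows "p = q"
  using assms unfolding flat_tangles_iff by blast

lemma flat_unique:
  assumes "E \<in> flat_tangles n" "{x, y} \<in> E" "{x, z} \<in> E"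
  shows "y = z"
  using assms unfolding flat_tangles_iff by (metis IntI doubleton_eq_iff empty_iff insertI1)

lemma flat_distinct:
  assumes "E \<in> flat_tangles n" "{x, y} \<in> E"
  shows "x \<noteq> y" "x \<in> tangle_points n" "y \<in> tangle_points n"
proof -
  show "x \<noteq> y" using assms unfolding flat_tangles_iff by fastforce
  show "x \<in> tangle_points n" "y \<in> tangle_points n" using assms unfolding flat_tangles_iff by blast+
qed

text \<open>The block of \<open>x\<close> consists of the points that no blockwise function
  separates from \<open>x\<close>, because the indicator function of a block is blockwise.\<close>

lemma partition_eq_if_blockwise:
  assumes "partition_on P E" "partition_on P E'" and eq: "\<And>f. blockwise E f = blockwise E' f"
  shows "E = E'"
proof -
  have block: "p = {y \<in> P. \<forall>f. blockwise E f \<longrightarrow> f x = f y}" if E: "partition_on P E" and p: "p \<in> E" "x \<in> p" for E p x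
  proof
    show "p \<subseteq> {y \<in> P. \<forall>f. blockwise E f \<longrightarrow> f x = f y}"
      using E p unfolding partition_on_def blockwise_def by blast
    show "{y \<in> P. \<forall>f. blockwise E f \<longrightarrow> f x = f y} \<subseteq> p"
    proof clarify
      fix y assume "\<forall>f. blockwise E f \<longrightarrow> f x = f y"
      moreover have "blockwise E (\<lambda>u. u \<in> p)"
        using E p unfolding partition_on_def blockwise_def disjoint_def by blast
      ultimately show "y \<in> p" using p by blast
    qed
  qed
  have "E \<subseteq> E'" if E: "partition_on P E" "partition_on P E'" "\<And>f. blockwise E f = blockwise E' f" for E E'
  proof
    fix p assume p: "p \<in> E"
    then have "p \<noteq> {}" "p \<subseteq> P" using E(1) unfolding partition_on_def by auto
    then obtain x where x: "x \<in> p" "x \<in> P" by blast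
    then obtain q where q: "q \<in> E'" "x \<in> q" using E(2) unfolding partition_on_def by blast
    have "p = q" using block[OF E(1) p x(1)] block[OF E(2) q] E(3) by simp
    then show "p \<in> E'" using q by simp
  qed
  from this[OF assms] this[OF assms(2,1) eq[symmetric]] show ?thesis by blast
qed

text \<open>Every two-colouring of the points splits into a top and a bottom colouring, so the
  matrix entries test all of them.\<close>

lemma blockwise_col:
  assumes "\<Union> E \<subseteq> tangle_points n"
  shows "blockwise E (col (\<lambda>k. f (0, k)) (\<lambda>k. f (1, k))) = blockwise E f"
proof -
  have "col (\<lambda>k. f (0, k)) (\<lambda>k. f (1, k)) x = f x" if "x \<in> tangle_points n" for x
    using that by (auto simp: tangle_points_def col_def)
  then show ?thesis using assms unfolding blockwise_def by (smt (verit) Union_iff subsetD)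
qed

text \<open>The all-True entry is 1 and gives the exponent. Partitions, rather than flat tangles,
  are the right generality: a concatenation enters before its blocks are known to be pairs.\<close>

lemma kern_inject:
  assumes "partition_on (tangle_points n) E" "partition_on (tangle_points n) E'"
    and eq: "\<And>a b. 2 ^ k * kern E b a = 2 ^ l * kern E' b a"
  shows "k = l" "E = E'"
proof -
  have "kern E (\<lambda>_. True) (\<lambda>_. True) = 1" for E by (simp add: kern_def blockwise_def col_def)
  then have "(2::int) ^ k = 2 ^ l" using eq[of "\<lambda>_. True" "\<lambda>_. True"] by simp
  then show "k = l" by simp
  then have "blockwise E (col a b) = blockwise E' (col a b)" for a b
    using eq[of b a] by (simp add: kern_def of_bool_def split: if_splits)
  then show "E = E'"
    using assms blockwise_col[of E n] blockwise_col[of E' n]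
    by (intro partition_eq_if_blockwise[of "tangle_points n"]) (auto simp: partition_on_def)
qed

lemma flat_partition: "E \<in> flat_tangles n \<Longrightarrow> partition_on (tangle_points n) E"
  by (simp add: flat_tangles_def)

lemma blockwise_cong: "(\<And>x. x \<in> \<Union> E \<Longrightarrow> f x = g x) \<Longrightarrow> blockwise E f = blockwise E g"
  unfolding blockwise_def by (metis UnionI)

lemma kern_cong:
  assumes "E \<in> flat_tangles n" "\<And>k. k \<in> {1..n} \<Longrightarrow> a k = a' k" "\<And>k. k \<in> {1..n} \<Longrightarrow> b k = b' k"
  shows "kern E b a = kern E b' a'"
proof -
  have "blockwise E (col a b) = blockwise E (col a' b')"
    using assms by (intro blockwise_cong) (auto simp: flat_tangles_iff tangle_points_def col_def)
  then show ?thesis by (simp add: kern_def)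
qed

lemma id_tangle_image: "id_tangle n = (\<lambda>k. {(0, k), (1, k)}) ` {1..n}"
  unfolding id_tangle_def by auto

lemma id_tangle_flat: "id_tangle n \<in> flat_tangles n"
  unfolding flat_tangles_iff id_tangle_image tangle_points_def by auto

lemma kern_id: "kern (id_tangle n) b a = of_bool (\<forall>k \<in> {1..n}. a k = b k)"
  unfolding kern_def blockwise_def id_tangle_image col_def by auto

section \<open>Action of the generators on matrices of tangles\<close>

definition flip :: "'a \<Rightarrow> 'a \<Rightarrow> 'a \<Rightarrow> 'a" where
  "flip p q x = (if x = p then q else if x = q then p else x)"

lemma flip_flip [simp]: "flip p q (flip p q x) = x"
  by (simp add: flip_def)

definition top_flip :: "nat \<Rightarrow> nat \<Rightarrow> tangle \<Rightarrow> tangle" where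
  "top_flip i j E = (`) (flip (0, i) (0, j)) ` E"

lemma top_flip_flat:
  assumes "E \<in> flat_tangles n" "i \<in> {1..n}" "j \<in> {1..n}"
  shows "top_flip i j E \<in> flat_tangles n"
proof -
  let ?t = "flip (0::nat, i) (0, j)"
  have inj: "inj ?t" by (metis flip_flip injI)
  have "?t ` tangle_points n = tangle_points n"
  proof
    show s: "?t ` tangle_points n \<subseteq> tangle_points n"
      using assms by (auto simp: tangle_points_def flip_def)
    show "tangle_points n \<subseteq> ?t ` tangle_points n"
      using s by (metis flip_flip image_subset_iff subsetI rev_image_eqI)
  qed
  then have "\<Union> (top_flip i j E) = tangle_points n"
    using assms(1) unfolding top_flip_def flat_tangles_iff by (simp add: image_Union[symmetric])
  moreover have "\<forall>p \<in> top_flip i j E. card p = 2"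
    using assms(1) inj unfolding top_flip_def flat_tangles_iff by (auto simp: card_image inj_on_subset)
  moreover have "\<forall>p \<in> top_flip i j E. \<forall>q \<in> top_flip i j E. p \<noteq> q \<longrightarrow> p \<inter> q = {}"
  proof (intro ballI impI)
    fix p q assume "p \<in> top_flip i j E" "q \<in> top_flip i j E" and pq: "p \<noteq> q"
    then obtain p' q' where p': "p = ?t ` p'" "p' \<in> E" "q = ?t ` q'" "q' \<in> E"
      unfolding top_flip_def by blast
    then have "p' \<inter> q' = {}" using assms(1) pq unfolding flat_tangles_iff by blast
    then show "p \<inter> q = {}" unfolding p' image_Int[OF inj, symmetric] by simp
  qed
  ultimately show ?thesis unfolding flat_tangles_iff by simp
qed

lemma blockwise_image: "blockwise ((`) t ` E) f = blockwise E (f \<circ> t)"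
  unfolding blockwise_def by simp

lemma opV_kern: "opV i (kern E b) = kern (top_flip i (Suc i) E) b"
proof
  fix a
  have "col (a(i := a (Suc i), Suc i := a i)) b = col a b \<circ> flip (0, i) (0, Suc i)"
    by (auto simp: col_def flip_def fun_eq_iff)
  then show "opV i (kern E b) a = kern (top_flip i (Suc i) E) b a"
    by (simp add: opV_def kern_def top_flip_def blockwise_image)
qed

lemma blockwise_insert: "blockwise (insert {x, y} E) f \<longleftrightarrow> f x = f y \<and> blockwise E f"
  unfolding blockwise_def by auto

lemma col_upd: "x \<noteq> (0, i) \<Longrightarrow> x \<noteq> (0, j) \<Longrightarrow> col (a(i := s, j := t)) b x = col a b x"
  by (cases x) (auto simp: col_def)

text \<open>The top arc of \<open>E\<close> closes up with the bottom arc of \<open>E_i\<close>; the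
  two colours of the resulting curve give the factor 2.\<close>

lemma opE_kern_cup:
  assumes E: "E \<in> flat_tangles n" and cup: "{(0, i), (0, Suc i)} \<in> E"
  shows "opE i (kern E b) = (\<lambda>a. 2 * kern E b a)"
proof
  fix a
  define E0 where "E0 = E - {{(0, i), (0, Suc i)}}"
  have E0: "E = insert {(0, i), (0, Suc i)} E0" using cup by (auto simp: E0_def)
  have out: "(0, i) \<notin> \<Union> E0" "(0, Suc i) \<notin> \<Union> E0"
    using flat_block_unique[OF E _ cup] unfolding E0_def by blast+
  have "blockwise E (col (a(i := t, Suc i := t)) b) = blockwise E0 (col a b)" for t
  proof -
    have "blockwise E0 (col (a(i := t, Suc i := t)) b) = blockwise E0 (col a b)"
      using out by (intro blockwise_cong col_upd) metis+
    then show ?thesis unfolding E0 blockwise_insert by (simp add: col_def)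
  qed
  moreover have "blockwise E (col a b) \<longleftrightarrow> a i = a (Suc i) \<and> blockwise E0 (col a b)"
    unfolding E0 blockwise_insert by (simp add: col_def)
  ultimately show "opE i (kern E b) a = 2 * kern E b a" by (simp add: opE_def kern_def)
qed

text \<open>The effect of placing \<open>E_i\<close> above a tangle in which its two points
  \<open>P\<close> and \<open>Q\<close> have partners \<open>p\<close> and \<open>q\<close>: the
  points are joined to each other, and so are their partners.\<close>

definition rejoin :: "nat \<times> nat \<Rightarrow> nat \<times> nat \<Rightarrow> nat \<times> nat \<Rightarrow> nat \<times> nat \<Rightarrow> tangle \<Rightarrow> tangle" where
  "rejoin P p Q q E = insert {P, Q} (insert {p, q} (E - {{P, p}, {Q, q}}))"

lemma rejoin_distinct:
  assumes E: "E \<in> flat_tangles n" and Pp: "{P, p} \<in> E" and Qq: "{Q, q} \<in> E" and PQ: "P \<noteq> Q" "{P, Q} \<notin> E"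
  shows "distinct [P, p, Q, q]" "P \<notin> \<Union> (E - {{P, p}, {Q, q}})" "Q \<notin> \<Union> (E - {{P, p}, {Q, q}})"
    "p \<notin> \<Union> (E - {{P, p}, {Q, q}})" "q \<notin> \<Union> (E - {{P, p}, {Q, q}})"
proof -
  have "p \<noteq> Q" "q \<noteq> P" using assms by (auto simp: insert_commute)
  moreover have "p \<noteq> q" using flat_unique[OF E, of p P Q] Pp Qq PQ by (auto simp: insert_commute)
  ultimately show "distinct [P, p, Q, q]" using flat_distinct(1)[OF E] Pp Qq PQ by auto
  show "P \<notin> \<Union> (E - {{P, p}, {Q, q}})" "Q \<notin> \<Union> (E - {{P, p}, {Q, q}})"
    "p \<notin> \<Union> (E - {{P, p}, {Q, q}})" "q \<notin> \<Union> (E - {{P, p}, {Q, q}})"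
    using flat_block_unique[OF E _ Pp] flat_block_unique[OF E _ Qq] by blast+
qed

lemma rejoin_flat:
  assumes E: "E \<in> flat_tangles n" and Pp: "{P, p} \<in> E" and Qq: "{Q, q} \<in> E" and PQ: "P \<noteq> Q" "{P, Q} \<notin> E"
  shows "rejoin P p Q q E \<in> flat_tangles n"
proof -
  note d = rejoin_distinct[OF assms]
  let ?E0 = "E - {{P, p}, {Q, q}}"
  have U: "\<Union> E = {P, p, Q, q} \<union> \<Union> ?E0" using Pp Qq by auto
  have r: "\<Union> (rejoin P p Q q E) = \<Union> E" "card {P, Q} = 2" "card {p, q} = 2" "{P, Q} \<inter> {p, q} = {}"
    using d(1) unfolding U unfolding rejoin_def by auto
  have r': "{P, Q} \<inter> r = {}" "{p, q} \<inter> r = {}" if "r \<in> ?E0" for r using d(2-5) that by auto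
  show ?thesis unfolding flat_tangles_iff
  proof (intro conjI ballI impI)
    show "\<Union> (rejoin P p Q q E) = tangle_points n" using r(1) E unfolding flat_tangles_iff by simp
    fix s assume s: "s \<in> rejoin P p Q q E"
    then have s': "s = {P, Q} \<or> s = {p, q} \<or> s \<in> ?E0" unfolding rejoin_def by blast
    then show "card s = 2" using r(2,3) E unfolding flat_tangles_iff by blast
    fix s2 assume s2: "s2 \<in> rejoin P p Q q E" "s \<noteq> s2"
    then have "s2 = {P, Q} \<or> s2 = {p, q} \<or> s2 \<in> ?E0" unfolding rejoin_def by blast
    moreover have "s \<inter> s2 = {}" if "s \<in> ?E0" "s2 \<in> ?E0" using that s2(2) E unfolding flat_tangles_iff by blast
    ultimately show "s \<inter> s2 = {}" using s' s2(2) r(4) r' by (metis (no_types) Int_commute)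
  qed
qed

lemma opE_kern_rejoin:
  assumes E: "E \<in> flat_tangles n" and Pp: "{(0, i), p} \<in> E" and Qq: "{(0, Suc i), q} \<in> E"
    and PQ: "{(0, i), (0, Suc i)} \<notin> E"
  shows "opE i (kern E b) = kern (rejoin (0, i) p (0, Suc i) q E) b"
proof
  fix a
  let ?P = "(0::nat, i)" and ?Q = "(0::nat, Suc i)"
  define E0 where "E0 = E - {{?P, p}, {?Q, q}}"
  have E0: "E = insert {?P, p} (insert {?Q, q} E0)" using Pp Qq by (auto simp: E0_def)
  note d = rejoin_distinct[OF E Pp Qq _ PQ, folded E0_def]
  \<comment> \<open>Once both top points have colour \<open>t\<close>, the two arcs force
    \<open>p\<close> and \<open>q\<close> to have colour \<open>t\<close>. Summing over
    \<open>t\<close> leaves the condition that \<open>p\<close> and \<open>q\<close> agree.\<close>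
  have r: "blockwise E (col (a(i := t, Suc i := t)) b) \<longleftrightarrow> col a b p = t \<and> col a b q = t \<and> blockwise E0 (col a b)" for t
  proof -
    let ?c = "col (a(i := t, Suc i := t)) b"
    have "blockwise E0 ?c = blockwise E0 (col a b)" using d(2,3) by (intro blockwise_cong col_upd) (metis prod.inject n_not_Suc_n)+
    moreover have "?c p = col a b p" "?c q = col a b q" using d(1) by (auto intro!: col_upd)
    moreover have "?c ?P = t" "?c ?Q = t" by (simp_all add: col_def)
    ultimately show ?thesis unfolding E0 blockwise_insert by auto
  qed
  have "blockwise (rejoin ?P p ?Q q E) (col a b) \<longleftrightarrow>
      a i = a (Suc i) \<and> col a b p = col a b q \<and> blockwise E0 (col a b)"
    unfolding rejoin_def blockwise_insert E0_def[symmetric] by (simp add: col_def)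
  then show "opE i (kern E b) a = kern (rejoin ?P p ?Q q E) b a"
    unfolding opE_def kern_def r by auto
qed

fun gen_op :: "vtl_gen \<Rightarrow> colour_fn \<Rightarrow> colour_fn" where
  "gen_op (GenE i) = opE i"
| "gen_op (GenV i) = opV i"

primrec rho :: "vtl_gen list \<Rightarrow> colour_fn \<Rightarrow> colour_fn" where
  "rho [] f = f"
| "rho (g # w) f = gen_op g (rho w f)"

lemma rho_append: "rho (u @ w) f = rho u (rho w f)"
  by (induction u) auto

lemma gen_op_scale: "gen_op g (\<lambda>a. c * f a) = (\<lambda>a. c * gen_op g f a)"
  by (cases g) (auto simp: opE_def opV_def fun_eq_iff algebra_simps)

lemma rho_scale: "rho w (\<lambda>a. c * f a) = (\<lambda>a. c * rho w f a)"
  by (induction w) (auto simp: gen_op_scale)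

text \<open>The exponent and the tangle are chosen before \<open>b\<close>, so that they serve all
  columns at once.\<close>

lemma gen_op_kern:
  assumes "E \<in> flat_tangles n" "g \<in> vtl_gens n"
  shows "\<exists>l. \<exists>E' \<in> flat_tangles n. \<forall>b. gen_op g (kern E b) = (\<lambda>a. 2 ^ l * kern E' b a)"
proof (cases g)
  case (GenV i)
  then have "i \<in> {1..n}" "Suc i \<in> {1..n}" using assms by (auto simp: vtl_gens_def)
  then have "top_flip i (Suc i) E \<in> flat_tangles n" using top_flip_flat assms by blast
  then show ?thesis using GenV opV_kern by (intro exI[of _ 0]) auto
next
  case (GenE i)
  then have i: "(0, i) \<in> tangle_points n" "(0, Suc i) \<in> tangle_points n"
    using assms by (auto simp: vtl_gens_def tangle_points_def)
  show ?thesis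
  proof (cases "{(0, i), (0, Suc i)} \<in> E")
    case True
    then show ?thesis using GenE opE_kern_cup assms by (intro exI[of _ 1] bexI[of _ E]) auto
  next
    case False
    obtain p where p: "{(0, i), p} \<in> E" using flat_partner[OF assms(1) i(1)] by blast
    obtain q where q: "{(0, Suc i), q} \<in> E" using flat_partner[OF assms(1) i(2)] by blast
    have "rejoin (0, i) p (0, Suc i) q E \<in> flat_tangles n" using rejoin_flat[OF assms(1) p q _ False] by simp
    then show ?thesis using GenE opE_kern_rejoin[OF assms(1) p q False] by (intro exI[of _ 0]) auto
  qed
qed

lemma rho_kern:
  assumes "E \<in> flat_tangles n" "set w \<subseteq> vtl_gens n"
  shows "\<exists>l. \<exists>E' \<in> flat_tangles n. \<forall>b. rho w (kern E b) = (\<lambda>a. 2 ^ l * kern E' b a)"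
  using assms(2)
proof (induction w)
  case Nil then show ?case using assms by (intro exI[of _ 0] bexI[of _ E]) auto
next
  case (Cons g w)
  then obtain l E' where E': "E' \<in> flat_tangles n" "\<And>b. rho w (kern E b) = (\<lambda>a. 2 ^ l * kern E' b a)" by auto
  obtain m E'' where E'': "E'' \<in> flat_tangles n" "\<And>b. gen_op g (kern E' b) = (\<lambda>a. 2 ^ m * kern E'' b a)"
    using gen_op_kern[OF E'(1), of g] Cons.prems by auto
  show ?case using E'' by (intro exI[of _ "l + m"] bexI[of _ E'']) (auto simp: E'(2) gen_op_scale power_add)
qed

section \<open>Every tangle comes from a word without closed curves\<close>

definition reachable :: "nat \<Rightarrow> tangle set" where
  "reachable n = {E \<in> flat_tangles n. \<exists>w. set w \<subseteq> vtl_gens n \<and> (\<forall>b. rho w (kern (id_tangle n) b) = kern E b)}"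

lemma reachable_gen:
  assumes "E \<in> reachable n" "g \<in> vtl_gens n" "E' \<in> flat_tangles n" "\<And>b. gen_op g (kern E b) = kern E' b"
  shows "E' \<in> reachable n"
proof -
  obtain w where w: "set w \<subseteq> vtl_gens n" "\<And>b. rho w (kern (id_tangle n) b) = kern E b"
    using assms(1) by (auto simp: reachable_def)
  then show ?thesis using assms unfolding reachable_def by (auto intro!: exI[of _ "g # w"])
qed

lemma reachable_flip_adjacent:
  assumes "E \<in> reachable n" "i \<in> {1..n - 1}"
  shows "top_flip i (Suc i) E \<in> reachable n"
proof (rule reachable_gen[OF assms(1), of "GenV i"])
  show "top_flip i (Suc i) E \<in> flat_tangles n"
    using assms by (intro top_flip_flat) (auto simp: reachable_def)
qed (use assms in \<open>auto simp: vtl_gens_def opV_kern\<close>)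

lemma top_flip_self [simp]: "top_flip i i E = E"
proof -
  have "flip (0::nat, i) (0, i) = id" by (auto simp: flip_def)
  then show ?thesis by (simp add: top_flip_def)
qed

lemma top_flip_sym: "top_flip i j E = top_flip j i E"
proof -
  have "flip (0, i) (0, j) = flip (0::nat, j) (0, i)" by (auto simp: flip_def fun_eq_iff)
  then show ?thesis by (simp add: top_flip_def)
qed

lemma reachable_flip:
  assumes "E \<in> reachable n" "i \<in> {1..n}" "j \<in> {1..n}"
  shows "top_flip i j E \<in> reachable n"
proof -
  have up: "i < j \<Longrightarrow> j \<le> n \<Longrightarrow> 1 \<le> i \<Longrightarrow> E \<in> reachable n \<Longrightarrow> top_flip i j E \<in> reachable n" for i j E
  proof (induction j arbitrary: E)
    case (Suc j)
    show ?case
    proof (cases "i = j")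
      case True then show ?thesis using reachable_flip_adjacent Suc by auto
    next
      case False
      \<comment> \<open>A distant transposition is a shorter one conjugated by an adjacent
        one.\<close>
      have "flip (0, i) (0, Suc j) =
          flip (0, j) (0, Suc j) \<circ> (flip (0, i) (0, j) \<circ> flip (0::nat, j) (0, Suc j))"
        using False Suc.prems by (auto simp: flip_def fun_eq_iff)
      then have "top_flip i (Suc j) E = top_flip j (Suc j) (top_flip i j (top_flip j (Suc j) E))"
        unfolding top_flip_def by (simp add: image_comp comp_def)
      moreover have "top_flip j (Suc j) E' \<in> reachable n" if "E' \<in> reachable n" for E'
        using that Suc.prems False by (intro reachable_flip_adjacent) auto
      ultimately show ?thesis using Suc False by simp
    qed
  qed simp
  consider "i < j" | "i = j" | "j < i" by linarith
  then show ?thesis using up[of i j] up[of j i] assms top_flip_sym[of i j] by cases auto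
qed

lemma top_flip_mem: "top_flip i j E = E' \<Longrightarrow> p \<in> E' \<longleftrightarrow> flip (0, i) (0, j) ` p \<in> E"
  unfolding top_flip_def by (auto simp: image_comp comp_def) (metis (no_types, lifting) flip_flip image_cong image_ident image_image rev_image_eqI)

lemma top_flip_rejoin:
  "top_flip i j (rejoin P p Q q E) =
    rejoin (flip (0, i) (0, j) P) (flip (0, i) (0, j) p) (flip (0, i) (0, j) Q) (flip (0, i) (0, j) q) (top_flip i j E)"
proof -
  have inj: "inj (flip (0::nat, i) (0, j))" by (metis flip_flip injI)
  then have "inj ((`) (flip (0::nat, i) (0, j)))" by (simp add: inj_image_eq_iff inj_def)
  then show ?thesis unfolding top_flip_def rejoin_def by (simp add: image_set_diff)
qed

text \<open>Swapping the top points \<open>i + 1\<close> and \<open>j\<close> makes the two points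
  adjacent, where \<open>GenE i\<close> rejoins them; the same swap is then undone.\<close>

lemma reachable_rejoin:
  assumes E: "E \<in> reachable n" and ij: "i < j" "i \<in> {1..n}" "j \<in> {1..n}"
    and Pp: "{(0, i), p} \<in> E" and Qq: "{(0, j), q} \<in> E" and PQ: "{(0, i), (0, j)} \<notin> E"
  shows "rejoin (0, i) p (0, j) q E \<in> reachable n"
proof -
  let ?t = "flip (0, Suc i) (0::nat, j)"
  define E' where "E' = top_flip (Suc i) j E"
  have E': "E' \<in> reachable n" using E ij by (auto simp: E'_def intro!: reachable_flip)
  then have flat': "E' \<in> flat_tangles n" by (simp add: reachable_def)
  have ti: "?t (0, i) = (0, i)" "?t (0, j) = (0, Suc i)" using ij by (auto simp: flip_def)
  have 1: "{(0, i), ?t p} \<in> E'" "{(0, Suc i), ?t q} \<in> E'"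
    using imageI[OF Pp, of "(`) ?t"] imageI[OF Qq, of "(`) ?t"] by (auto simp: E'_def top_flip_def ti)
  have 2: "{(0, i), (0, Suc i)} \<notin> E'"
  proof
    assume "{(0, i), (0, Suc i)} \<in> E'"
    then have "?t ` {(0, i), (0, Suc i)} \<in> E" using top_flip_mem[OF E'_def[symmetric]] by blast
    moreover have "?t (0, Suc i) = (0, j)" by (auto simp: flip_def)
    ultimately show False using PQ ti by simp
  qed
  have "rejoin (0, i) (?t p) (0, Suc i) (?t q) E' \<in> reachable n"
    using 1 2 ij rejoin_flat[OF flat' 1 _ 2] opE_kern_rejoin[OF flat' 1 2]
    by (intro reachable_gen[OF E', of "GenE i"]) (auto simp: vtl_gens_def)
  then have "top_flip (Suc i) j (rejoin (0, i) (?t p) (0, Suc i) (?t q) E') \<in> reachable n"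
    using ij by (intro reachable_flip) auto
  moreover have "top_flip (Suc i) j E' = E"
    unfolding E'_def top_flip_def by (simp add: image_comp comp_def)
  moreover have "?t (0, Suc i) = (0, j)" by (auto simp: flip_def)
  ultimately show ?thesis unfolding top_flip_rejoin using ti by simp
qed

lemma rejoin_sym: "rejoin P p Q q E = rejoin Q q P p E"
  unfolding rejoin_def by (simp add: insert_commute)

text \<open>An exchange at \<open>P\<close> and \<open>Q\<close> is undone by an exchange at
  \<open>P\<close> and \<open>p\<close>. If \<open>p\<close> is a top point and \<open>Q\<close> a
  bottom point, this makes an exchange that moves a bottom point the inverse of one at the
  top.\<close>

lemma rejoin_rejoin:
  assumes "E \<in> flat_tangles n" "{P, p} \<in> E" "{Q, q} \<in> E" "P \<noteq> Q" "{P, Q} \<notin> E"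
  shows "rejoin P Q p q (rejoin P p Q q E) = E"
proof -
  have "{p, q} \<notin> E"
    using flat_unique[OF assms(1), of p q P] rejoin_distinct(1)[OF assms] assms by (auto simp: insert_commute)
  then show ?thesis using assms(2,3,5) unfolding rejoin_def by auto
qed

lemma reachable_rejoin':
  assumes "E \<in> reachable n" "i \<noteq> j" "i \<in> {1..n}" "j \<in> {1..n}"
    and "{(0, i), p} \<in> E" "{(0, j), q} \<in> E" "{(0, i), (0, j)} \<notin> E"
  shows "rejoin (0, i) p (0, j) q E \<in> reachable n"
  using assms reachable_rejoin[of E n i j p q] reachable_rejoin[of E n j i q p] rejoin_sym[of "(0, i)" p "(0, j)" q E]
  by (cases "i < j") (auto simp: insert_commute)

text \<open>Induction on the number of strands that are not vertical. Each step finds a tangle with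
  fewer such strands from which \<open>E\<close> is reached by a move at the top.\<close>

theorem flat_reachable: "E \<in> flat_tangles n \<Longrightarrow> E \<in> reachable n"
proof (induction "card {k \<in> {1..n}. {(0, k), (1, k)} \<notin> E}" arbitrary: E rule: less_induct)
  case less
  define bad where "bad E = {k \<in> {1..n}. {(0, k), (1, k)} \<notin> E}" for E :: tangle
  note E = less.prems
  have IH: "E' \<in> reachable n" if "E' \<in> flat_tangles n" "bad E' \<subset> bad E" for E'
    using that by (intro less.hyps) (auto simp: bad_def intro: psubset_card_mono)
  show ?case
  proof (cases "bad E = {}")
    case True
    have sub: "id_tangle n \<subseteq> E" using True by (auto simp: bad_def id_tangle_def)
    have "E \<subseteq> id_tangle n"
    proof
      fix p assume p: "p \<in> E"
      then have "card p = 2" "p \<subseteq> tangle_points n" using E unfolding flat_tangles_iff by auto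
      then have "p \<noteq> {}" by auto
      then obtain x where "x \<in> p" "x \<in> tangle_points n" using \<open>p \<subseteq> tangle_points n\<close> by blast
      moreover obtain q where "q \<in> id_tangle n" "x \<in> q"
        using id_tangle_flat[of n] calculation unfolding flat_tangles_iff by blast
      ultimately show "p \<in> id_tangle n" using flat_block_unique[OF E p] sub by blast
    qed
    then have "E = id_tangle n" using sub by blast
    then show ?thesis using E by (auto simp: reachable_def intro!: exI[of _ "[]"])
  next
    case ne: False
    show ?thesis
    proof (cases "\<exists>k j. k \<in> bad E \<and> {(1, k), (0, j)} \<in> E")
      case True
      then obtain k j where k: "k \<in> bad E" "{(0, j), (1, k)} \<in> E" by (auto simp: insert_commute)
      have jk: "j \<noteq> k" "j \<in> {1..n}" "k \<in> {1..n}"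
        using k flat_distinct[OF E k(2)] by (auto simp: bad_def tangle_points_def)
      let ?t = "flip (0, j) (0::nat, k)"
      \<comment> \<open>Strand \<open>k\<close> becomes vertical. No vertical strand is lost: top
        point \<open>j\<close> was joined to bottom point \<open>k\<close>, so strand
        \<open>j\<close> was not vertical.\<close>
      define E' where "E' = top_flip j k E"
      have flat': "E' \<in> flat_tangles n" using top_flip_flat E jk by (simp add: E'_def)
      have mem: "p \<in> E' \<longleftrightarrow> ?t ` p \<in> E" for p using top_flip_mem[OF E'_def[symmetric]] by blast
      have "k \<notin> bad E'" using k jk by (simp add: bad_def mem flip_def insert_commute)
      moreover have "bad E' \<subseteq> bad E"
      proof
        fix l assume l: "l \<in> bad E'"
        show "l \<in> bad E"
        proof (rule ccontr)
          assume "l \<notin> bad E"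
          then have lE: "{(0, l), (1, l)} \<in> E" using l by (auto simp: bad_def)
          have "l \<noteq> k" using lE k by (auto simp: bad_def)
          moreover have "l \<noteq> j" using flat_unique[OF E lE, of "(1, k)"] k(2) calculation by auto
          ultimately have "?t ` {(0, l), (1, l)} = {(0, l), (1, l)}" by (simp add: flip_def)
          then show False using l lE by (simp add: bad_def mem)
        qed
      qed
      ultimately have "E' \<in> reachable n" using IH[OF flat'] k(1) by blast
      then have "top_flip j k E' \<in> reachable n" using jk by (intro reachable_flip) auto
      moreover have "top_flip j k E' = E" unfolding E'_def top_flip_def by (simp add: image_comp comp_def)
      ultimately show ?thesis by simp
    next
      case no: False
      then obtain c where c: "c \<in> bad E" using ne by blast
      then have cn: "c \<in> {1..n}" "{(0, c), (1, c)} \<notin> E" by (auto simp: bad_def)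
      have pts: "(1, c) \<in> tangle_points n" "(0, c) \<in> tangle_points n" using cn by (auto simp: tangle_points_def)
      obtain y where y: "{(1, c), y} \<in> E" "y \<in> tangle_points n"
        using flat_partner[OF E pts(1)] by blast
      then obtain d where d: "{(1, c), (1, d)} \<in> E"
        using no c by (cases y) (auto simp: tangle_points_def)
      obtain y' where y': "{(0, c), y'} \<in> E" "y' \<in> tangle_points n" "y' \<noteq> (0, c)"
        using flat_partner[OF E pts(2)] by blast
      \<comment> \<open>A bottom partner \<open>j\<close> of the top point \<open>c\<close> would
        itself be bad and joined to the top, which this case excludes.\<close>
      have "fst y' = 0"
      proof (rule ccontr)
        assume "fst y' \<noteq> 0"
        then obtain j where j: "y' = (1, j)" "j \<in> {1..n}" using y'(2) by (auto simp: tangle_points_def)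
        have "j \<noteq> c" using y' j cn by auto
        then have "j \<in> bad E" using flat_unique[OF E, of "(1, j)" "(0, j)" "(0, c)"] y'(1) j
          by (auto simp: bad_def insert_commute)
        then show False using no y'(1) j by (auto simp: insert_commute)
      qed
      then obtain c' where c': "{(0, c), (0, c')} \<in> E" "c' \<noteq> c" "c' \<in> {1..n}"
        using y' by (cases y') (auto simp: tangle_points_def)
      \<comment> \<open>This exchange makes strand \<open>c\<close> vertical but is no move at the
        top. Its inverse is one, since it acts at the top points \<open>c\<close> and
        \<open>c'\<close> of \<open>E'\<close>.\<close>
      define E' where "E' = rejoin (0, c) (0, c') (1, c) (1, d) E"
      have flat': "E' \<in> flat_tangles n"
        unfolding E'_def using rejoin_flat[OF E c'(1) d _ cn(2)] by simp
      have restored: "rejoin (0, c) (1, c) (0, c') (1, d) E' = E"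
        unfolding E'_def using rejoin_rejoin[OF E c'(1) d _ cn(2)] by simp
      have mem: "{(0, c), (1, c)} \<in> E'" "{(0, c'), (1, d)} \<in> E'" by (auto simp: E'_def rejoin_def)
      have "c \<notin> bad E'" using mem by (simp add: bad_def)
      moreover have "bad E' \<subseteq> bad E"
      proof
        fix l assume "l \<in> bad E'"
        moreover have "{(0::nat, l), (1, l)} \<noteq> {(0, c), (0, c')}" "{(0::nat, l), (1, l)} \<noteq> {(1, c), (1, d)}"
          by (simp_all add: doubleton_eq_iff)
        ultimately show "l \<in> bad E" unfolding bad_def E'_def rejoin_def by blast
      qed
      ultimately have "E' \<in> reachable n" using IH[OF flat'] c by blast
      moreover have "{(0, c), (0, c')} \<notin> E'" using flat_unique[OF flat' mem(1), of "(0, c')"] by auto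
      ultimately have "rejoin (0, c) (1, c) (0, c') (1, d) E' \<in> reachable n"
        using mem cn c' by (intro reachable_rejoin') auto
      then show ?thesis using restored by simp
    qed
  qed
qed

section \<open>Words as finite matrices\<close>

definition colourings :: "nat \<Rightarrow> (nat \<Rightarrow> bool) set" where
  "colourings n = {c. \<forall>k. c k \<longrightarrow> k \<in> {1..n}}"

lemma finite_colourings: "finite (colourings n)"
proof -
  have "colourings n \<subseteq> (\<lambda>S k. k \<in> S) ` Pow {1..n}"
  proof
    fix c assume "c \<in> colourings n"
    then have "c = (\<lambda>k. k \<in> {k. c k})" "{k. c k} \<in> Pow {1..n}" by (auto simp: colourings_def)
    then show "c \<in> (\<lambda>S k. k \<in> S) ` Pow {1..n}" by blast
  qed
  then show ?thesis by (rule finite_subset) simp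
qed

text \<open>Operators act on colourings of all natural numbers; the colours outside the
  \<open>n\<close> strands are retained from \<open>a\<close>.\<close>

definition overwrite :: "nat \<Rightarrow> (nat \<Rightarrow> bool) \<Rightarrow> (nat \<Rightarrow> bool) \<Rightarrow> nat \<Rightarrow> bool" where
  "overwrite n c a k = (if k \<in> {1..n} then c k else a k)"

text \<open>The columns of the identity play the part of unit vectors. The operator of a word is
  thus determined by its tangle data, on functions of colourings of all natural numbers as
  well.\<close>

lemma rho_expand:
  assumes "set w \<subseteq> vtl_gens n"
  shows "rho w f a = (\<Sum>c \<in> colourings n. rho w (kern (id_tangle n) c) a * f (overwrite n c a))"
  using assms
proof (induction w arbitrary: a)
  case Nil
  \<comment> \<open>The restriction of \<open>a\<close> to the \<open>n\<close> strands, the only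
    colouring that contributes to the sum.\<close>
  define c0 where "c0 k = (k \<in> {1..n} \<and> a k)" for k
  have c0: "c0 \<in> colourings n" by (auto simp: c0_def colourings_def)
  have "kern (id_tangle n) c a = of_bool (c = c0)" if "c \<in> colourings n" for c
  proof -
    have "(\<forall>k \<in> {1..n}. a k = c k) \<longleftrightarrow> c = c0" using that unfolding fun_eq_iff c0_def colourings_def by blast
    then show ?thesis by (simp only: kern_id)
  qed
  then have "(\<Sum>c \<in> colourings n. kern (id_tangle n) c a * f (overwrite n c a)) =
      (\<Sum>c \<in> colourings n. if c = c0 then f (overwrite n c a) else 0)"
    by (intro sum.cong) auto
  also have "\<dots> = f (overwrite n c0 a)" using c0 finite_colourings by (simp add: sum.delta)
  also have "overwrite n c0 a = a" by (simp add: fun_eq_iff overwrite_def c0_def)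
  finally show ?case by simp
next
  case (Cons g w)
  have IH: "rho w f b = (\<Sum>c \<in> colourings n. rho w (kern (id_tangle n) c) b * f (overwrite n c b))" for b
    using Cons by simp
  have ow: "overwrite n c (a(i := s, j := t)) = overwrite n c a" if "i \<in> {1..n}" "j \<in> {1..n}" for c i j s t
    using that by (auto simp: overwrite_def fun_eq_iff)
  show ?case
  proof (cases g)
    case (GenE i)
    then have "i \<in> {1..n}" "Suc i \<in> {1..n}" using Cons.prems by (auto simp: vtl_gens_def)
    then show ?thesis using GenE by (simp add: opE_def IH ow sum.distrib[symmetric] distrib_right del: fun_upd_apply)
  next
    case (GenV i)
    then have "i \<in> {1..n}" "Suc i \<in> {1..n}" using Cons.prems by (auto simp: vtl_gens_def)
    then show ?thesis using GenV by (simp add: opV_def IH ow)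
  qed
qed

section \<open>Concatenation is matrix multiplication\<close>

lemma blockwise_Un: "blockwise (A \<union> B) f \<longleftrightarrow> blockwise A f \<and> blockwise B f"
  by (auto simp: blockwise_def)

lemma blockwiseD: "blockwise A f \<Longrightarrow> p \<in> A \<Longrightarrow> x \<in> p \<Longrightarrow> y \<in> p \<Longrightarrow> f x = f y"
  unfolding blockwise_def by blast

locale gluing =
  fixes n :: nat and E E' :: tangle
  assumes E: "E \<in> flat_tangles n" and E': "E' \<in> flat_tangles n"
begin

definition V :: "(nat \<times> nat) set" where
  "V = {0, 1, 2} \<times> {1..n}"

definition conn :: "((nat \<times> nat) \<times> (nat \<times> nat)) set" where
  "conn = {(x, y). {x, y} \<in> glued_edges E E'}\<^sup>*"

abbreviation comps :: "(nat \<times> nat) set set" where "comps \<equiv> glued_components n E E'"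
abbreviation closed :: "(nat \<times> nat) set set" where "closed \<equiv> closed_curves n E E'"

lemma comps_eq: "comps = V // conn"
  by (simp add: glued_components_def V_def conn_def)

lemma edge_subset: "p \<in> glued_edges E E' \<Longrightarrow> p \<subseteq> V"
proof -
  assume "p \<in> glued_edges E E'"
  then consider "p \<in> E" | q where "q \<in> E'" "p = map_prod Suc id ` q" by (auto simp: glued_edges_def)
  then show ?thesis
  proof cases
    case 1
    then have "p \<subseteq> tangle_points n" using E unfolding flat_tangles_iff by blast
    then show ?thesis by (auto simp: tangle_points_def V_def)
  next
    case 2
    then have "q \<subseteq> tangle_points n" using E' unfolding flat_tangles_iff by blast
    then show ?thesis unfolding 2 by (auto simp: tangle_points_def V_def)
  qed
qed

lemma edge_pair: "p \<in> glued_edges E E' \<Longrightarrow> card p = 2"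
proof -
  have "inj (map_prod Suc (id :: nat \<Rightarrow> nat))" by (simp add: prod.inj_map)
  then show "p \<in> glued_edges E E' \<Longrightarrow> card p = 2"
    using E E' unfolding flat_tangles_iff glued_edges_def by (auto simp: card_image inj_on_subset)
qed

lemma conn_refl: "(x, x) \<in> conn" by (simp add: conn_def)

lemma conn_trans: "(x, y) \<in> conn \<Longrightarrow> (y, w) \<in> conn \<Longrightarrow> (x, w) \<in> conn"
  unfolding conn_def by (rule rtrancl_trans)

lemma conn_sym: "(x, y) \<in> conn \<Longrightarrow> (y, x) \<in> conn"
proof -
  have "sym {(x, y). {x, y} \<in> glued_edges E E'}" by (auto intro: symI simp: insert_commute)
  then show "(x, y) \<in> conn \<Longrightarrow> (y, x) \<in> conn" unfolding conn_def by (meson sym_rtrancl symD)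
qed

lemma conn_V: "(x, y) \<in> conn \<Longrightarrow> x \<in> V \<Longrightarrow> y \<in> V"
  unfolding conn_def by (induction rule: rtrancl_induct) (use edge_subset in auto)

lemma comp_of: "x \<in> V \<Longrightarrow> conn `` {x} \<in> comps"
  unfolding comps_eq by (rule quotientI)

lemma comp_eq: "C \<in> comps \<Longrightarrow> x \<in> C \<Longrightarrow> C = conn `` {x}"
  unfolding comps_eq by (auto elim!: quotientE intro: conn_trans conn_sym)

lemma comp_conn: "C \<in> comps \<Longrightarrow> x \<in> C \<Longrightarrow> y \<in> C \<Longrightarrow> (x, y) \<in> conn"
  using comp_eq[of C x] by blast

lemma comp_subset: "C \<in> comps \<Longrightarrow> C \<subseteq> V"
  unfolding comps_eq by (auto elim!: quotientE intro: conn_V)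

lemma comp_nonempty: "C \<in> comps \<Longrightarrow> C \<noteq> {}"
  unfolding comps_eq by (auto elim!: quotientE intro: conn_refl)

lemma self_comp: "x \<in> conn `` {x}" by (simp add: conn_refl)

lemma finite_comps: "finite comps"
proof -
  have "finite V" by (simp add: V_def)
  then show ?thesis unfolding comps_eq quotient_def by simp
qed

lemma closedD: "C \<in> closed \<Longrightarrow> C \<in> comps" "C \<in> closed \<Longrightarrow> x \<in> C \<Longrightarrow> fst x = 1"
  by (auto simp: closed_curves_def middle_level_def)

lemma openD: "C \<in> comps \<Longrightarrow> C \<notin> closed \<Longrightarrow> \<exists>x \<in> C. fst x \<noteq> 1"
  by (fastforce simp: closed_curves_def middle_level_def)

lemma blockwise_edges: "blockwise (glued_edges E E') h = blockwise comps h"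
proof
  assume h: "blockwise (glued_edges E E') h"
  have "h x = h y" if "(x, y) \<in> conn" for x y
    using that unfolding conn_def
  proof (induction rule: rtrancl_induct)
    case (step y w)
    then have "{y, w} \<in> glued_edges E E'" by simp
    then have "h y = h w" using h unfolding blockwise_def by (meson insertCI)
    then show ?case using step.IH by simp
  qed simp
  then show "blockwise comps h" unfolding blockwise_def by (intro ballI) (blast dest: comp_conn)
next
  assume h: "blockwise comps h"
  have "h x = h y" if p: "p \<in> glued_edges E E'" "x \<in> p" "y \<in> p" for p x y
  proof -
    have "card p = 2" using p edge_pair by blast
    then have "x = y \<or> p = {x, y}" using p by (auto simp: card_2_iff)
    then have "(x, y) \<in> conn" using p unfolding conn_def by auto
    moreover have "x \<in> V" using p edge_subset by blast
    ultimately show ?thesis using h comp_of[of x] self_comp[of x] unfolding blockwise_def by blast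
  qed
  then show "blockwise (glued_edges E E') h" unfolding blockwise_def by blast
qed

definition col3 :: "(nat \<Rightarrow> bool) \<Rightarrow> (nat \<Rightarrow> bool) \<Rightarrow> (nat \<Rightarrow> bool) \<Rightarrow> nat \<times> nat \<Rightarrow> bool" where
  "col3 a c b x = (if fst x = 0 then a (snd x) else if fst x = 1 then c (snd x) else b (snd x))"

lemma blockwise_col3:
  "blockwise E (col a c) \<and> blockwise E' (col c b) \<longleftrightarrow> blockwise comps (col3 a c b)"
proof -
  have "blockwise E (col a c) = blockwise E (col3 a c b)"
    using E by (intro blockwise_cong) (auto simp: flat_tangles_iff tangle_points_def col_def col3_def)
  moreover have "blockwise E' (col c b) = blockwise E' (col3 a c b \<circ> map_prod Suc id)"
    using E' by (intro blockwise_cong) (auto simp: flat_tangles_iff tangle_points_def col_def col3_def)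
  moreover have "blockwise (glued_edges E E') h \<longleftrightarrow> blockwise E h \<and> blockwise E' (h \<circ> map_prod Suc id)" for h
    by (simp only: glued_edges_def blockwise_Un blockwise_image)
  ultimately show ?thesis using blockwise_edges by simp
qed

lemma col_rename:
  assumes "x \<in> V" "fst x \<noteq> 1"
  shows "col a b (map_prod (\<lambda>k. k div 2) id x) = col3 a c b x"
  using assms by (auto simp: V_def col_def col3_def)

lemma mem_Diff_middle_level: "x \<in> C - middle_level \<longleftrightarrow> x \<in> C \<and> fst x \<noteq> 1"
  by (cases x) (auto simp: middle_level_def)

definition rename :: "nat \<times> nat \<Rightarrow> nat \<times> nat" where
  "rename = map_prod (\<lambda>k. k div 2) id"

lemma concat_eq: "tangle_concat n E E' = (\<lambda>C. rename ` (C - middle_level)) ` (comps - closed)"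
  by (simp add: tangle_concat_def rename_def)

lemma concatE:
  assumes "p \<in> tangle_concat n E E'"
  obtains C where "C \<in> comps" "C \<notin> closed" "p = rename ` (C - middle_level)"
  using assms unfolding concat_eq by blast

text \<open>Colours are compared off the middle level only, so \<open>c\<close> may be chosen
  freely: below it is once a given compatible colouring and once constantly False. The closed curves
  contribute no condition.\<close>

lemma blockwise_concat:
  "blockwise (tangle_concat n E E') (col a b) \<longleftrightarrow>
    (\<forall>C \<in> comps. \<forall>x \<in> C. \<forall>y \<in> C. fst x \<noteq> 1 \<longrightarrow> fst y \<noteq> 1 \<longrightarrow> col3 a c b x = col3 a c b y)"
    (is "?l \<longleftrightarrow> ?r")
proof -
  let ?t = "map_prod (\<lambda>k. k div 2) id :: nat \<times> nat \<Rightarrow> nat \<times> nat"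
  have "?l \<longleftrightarrow> (\<forall>C \<in> comps - closed. \<forall>x \<in> C - middle_level. \<forall>y \<in> C - middle_level.
      col a b (?t x) = col a b (?t y))"
    by (simp only: tangle_concat_def blockwise_def ball_simps(9))
  also have "\<dots> \<longleftrightarrow> (\<forall>C \<in> comps. \<forall>x \<in> C - middle_level. \<forall>y \<in> C - middle_level.
      col a b (?t x) = col a b (?t y))"
    unfolding closed_curves_def by blast
  also have "\<dots> \<longleftrightarrow> ?r"
  proof -
    have ren: "col a b (?t x) = col3 a c b x" if "C \<in> comps" "x \<in> C" "fst x \<noteq> 1" for C x
      using that comp_subset col_rename by blast
    show ?thesis
    proof
      assume l: "\<forall>C \<in> comps. \<forall>x \<in> C - middle_level. \<forall>y \<in> C - middle_level. col a b (?t x) = col a b (?t y)"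
      show ?r
      proof (intro ballI impI)
        fix C x y assume *: "C \<in> comps" "x \<in> C" "y \<in> C" "fst x \<noteq> 1" "fst y \<noteq> 1"
        then have "x \<in> C - middle_level" "y \<in> C - middle_level" unfolding mem_Diff_middle_level by simp_all
        with l *(1) have "col a b (?t x) = col a b (?t y)" by (meson bspec)
        then show "col3 a c b x = col3 a c b y" using ren[of C x] ren[of C y] * by simp
      qed
    next
      assume r: ?r
      show "\<forall>C \<in> comps. \<forall>x \<in> C - middle_level. \<forall>y \<in> C - middle_level. col a b (?t x) = col a b (?t y)"
      proof (intro ballI)
        fix C x y assume *: "C \<in> comps" "x \<in> C - middle_level" "y \<in> C - middle_level"
        then have **: "x \<in> C" "fst x \<noteq> 1" "y \<in> C" "fst y \<noteq> 1" unfolding mem_Diff_middle_level by simp_all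
        with r *(1) have "col3 a c b x = col3 a c b y" by (meson bspec)
        then show "col a b (?t x) = col a b (?t y)" using ren *(1) ** by simp
      qed
    qed
  qed
  finally show ?thesis .
qed

text \<open>The colour of an open component is forced by its ends, while each closed curve takes
  either colour. Compatible middle colourings therefore correspond to sets of closed curves, namely
  those coloured True.\<close>

lemma card_middle_colourings:
  "card {c \<in> colourings n. blockwise comps (col3 a c b)} =
    (if blockwise (tangle_concat n E E') (col a b) then 2 ^ card closed else 0)" (is "card ?S = _")
proof (cases "blockwise (tangle_concat n E E') (col a b)")
  case False
  have "?S = {}"
  proof (rule ccontr)
    assume "?S \<noteq> {}"
    then obtain c where "blockwise comps (col3 a c b)" by blast
    then have "blockwise (tangle_concat n E E') (col a b)"
      unfolding blockwise_concat[of a b c] unfolding blockwise_def by blast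
    then show False using False by blast
  qed
  then have "card ?S = 0" by (simp only: card.empty)
  then show ?thesis using False by simp
next
  case True
  define ph where "ph c = {C \<in> closed. \<exists>x \<in> C. c (snd x)}" for c :: "nat \<Rightarrow> bool"
  have bd: "col3 a c b x = col3 a c' b x" if "fst x \<noteq> 1" for c c' x using that by (simp add: col3_def)
  have mid: "c k \<longleftrightarrow> C \<in> ph c" if "blockwise comps (col3 a c b)" "C \<in> closed" "(1, k) \<in> C" for c k C
  proof
    show "C \<in> ph c" if "c k"
      using that \<open>C \<in> closed\<close> \<open>(1, k) \<in> C\<close> unfolding ph_def by (metis (mono_tags, lifting) mem_Collect_eq snd_conv)
    assume "C \<in> ph c"
    then obtain x where x: "x \<in> C" "c (snd x)" by (auto simp: ph_def)
    then have "col3 a c b x = col3 a c b (1, k)" using that closedD(1) unfolding blockwise_def by blast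
    moreover have "fst x = 1" using closedD(2) that x by blast
    ultimately show "c k" using x by (simp add: col3_def)
  qed
  have "inj_on ph ?S"
  proof (rule inj_onI)
    fix c c' assume c: "c \<in> ?S" and c': "c' \<in> ?S" and eq: "ph c = ph c'"
    have "c k = c' k" if k: "k \<in> {1..n}" for k
    proof -
      let ?C = "conn `` {(1, k)}"
      have C: "?C \<in> comps" "(1, k) \<in> ?C" using k comp_of self_comp by (auto simp: V_def)
      show ?thesis
      proof (cases "?C \<in> closed")
        case True
        then show ?thesis using mid[OF _ True C(2)] c c' eq by blast
      next
        case False
        \<comment> \<open>A point off the middle level has a prescribed colour, which fixes the
          colour of \<open>(1, k)\<close>.\<close>
        then obtain x where x: "x \<in> ?C" "fst x \<noteq> 1" using openD C by blast
        have "col3 a c b (1, k) = col3 a c b x" "col3 a c' b (1, k) = col3 a c' b x"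
          using c c' by (intro blockwiseD[OF _ C x(1)]; simp)+
        then show ?thesis using bd[OF x(2), of c c'] by (simp add: col3_def)
      qed
    qed
    then show "c = c'" using c c' unfolding colourings_def fun_eq_iff by blast
  qed
  moreover have "ph ` ?S = Pow closed"
  proof
    show "ph ` ?S \<subseteq> Pow closed" by (auto simp: ph_def)
    show "Pow closed \<subseteq> ph ` ?S"
    proof
      fix X assume X: "X \<in> Pow closed"
      define h0 where "h0 = col3 a (\<lambda>_. False) b"
      have conc: "\<forall>C \<in> comps. \<forall>x \<in> C. \<forall>y \<in> C. fst x \<noteq> 1 \<longrightarrow> fst y \<noteq> 1 \<longrightarrow> h0 x = h0 y"
        using True unfolding blockwise_concat[of a b "\<lambda>_. False"] h0_def .
      \<comment> \<open>Closed curves are coloured as \<open>X\<close> prescribes; an open component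
        gets the common colour of its points off the middle level, well defined by
        \<open>conc\<close>.\<close>
      define val where "val C = (if C \<in> closed then C \<in> X else (\<exists>x \<in> C. fst x \<noteq> 1 \<and> h0 x))" for C
      define c where "c k = (k \<in> {1..n} \<and> val (conn `` {(1, k)}))" for k
      have val: "col3 a c b x = val C" if C: "C \<in> comps" "x \<in> C" for C x
      proof (cases "fst x = 1")
        case True
        then obtain k where k: "x = (1, k)" by (cases x) auto
        moreover have "k \<in> {1..n}" using comp_subset[OF C(1)] C(2) k by (auto simp: V_def)
        moreover have "C = conn `` {x}" using C comp_eq by blast
        ultimately show ?thesis by (simp add: col3_def c_def)
      next
        case False
        then have "C \<notin> closed" using closedD(2) C(2) by blast
        have "h0 y = h0 x" if "y \<in> C" "fst y \<noteq> 1" for y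
          using conc C that False by (meson bspec)
        then have "(\<exists>y \<in> C. fst y \<noteq> 1 \<and> h0 y) = h0 x" using C(2) False by blast
        moreover have "col3 a c b x = h0 x" using bd[OF False] by (simp add: h0_def)
        ultimately show ?thesis using \<open>C \<notin> closed\<close> by (simp add: val_def)
      qed
      have "c \<in> colourings n" by (simp add: colourings_def c_def)
      then have cS: "c \<in> ?S" using val unfolding blockwise_def by simp
      have "ph c = X"
      proof -
        have "C \<in> ph c \<longleftrightarrow> C \<in> X" if C: "C \<in> closed" for C
        proof -
          obtain x where x: "x \<in> C" using C closedD comp_nonempty by blast
          moreover have "fst x = 1" using closedD C x by blast
          ultimately obtain k where k: "(1, k) \<in> C" by (cases x) auto
          have "c k = val C" using val[OF closedD(1)[OF C] k] by (simp add: col3_def)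
          then show ?thesis using mid[OF _ C k] cS C by (simp add: val_def)
        qed
        then show ?thesis using X by (auto simp: ph_def)
      qed
      then show "X \<in> ph ` ?S" using cS by blast
    qed
  qed
  ultimately have "card ?S = card (Pow closed)" by (metis card_image)
  moreover have "finite closed" using finite_comps by (simp add: closed_curves_def)
  ultimately show ?thesis using True by (simp add: card_Pow)
qed

lemma kern_concat:
  "(\<Sum>c \<in> colourings n. kern E c a * kern E' b c) = 2 ^ card closed * kern (tangle_concat n E E') b a"
proof -
  have "(\<Sum>c \<in> colourings n. kern E c a * kern E' b c) =
      (\<Sum>c \<in> colourings n. if blockwise comps (col3 a c b) then 1 else 0)"
    unfolding blockwise_col3[symmetric] kern_def by (intro sum.cong) auto
  also have "\<dots> = int (card {c \<in> colourings n. blockwise comps (col3 a c b)})"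
    by (simp add: sum.If_cases finite_colourings Int_def)
  also have "\<dots> = 2 ^ card closed * kern (tangle_concat n E E') b a"
    unfolding card_middle_colourings kern_def by simp
  finally show ?thesis .
qed

text \<open>This suffices for comparing matrices. That the blocks are pairs follows once
  \<open>word_tangle_append\<close> identifies the concatenation with the tangle of a word.\<close>

lemma concat_partition: "partition_on (tangle_points n) (tangle_concat n E E')"
proof (rule partition_onI)
  show "\<Union> (tangle_concat n E E') = tangle_points n"
  proof (intro subset_antisym subsetI)
    fix y assume "y \<in> \<Union> (tangle_concat n E E')"
    then obtain p where p: "p \<in> tangle_concat n E E'" "y \<in> p" by blast
    from p(1) obtain C where C: "C \<in> comps" "p = rename ` (C - middle_level)" by (rule concatE)
    then obtain x where x: "x \<in> C - middle_level" "y = rename x" using p(2) by blast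
    then have "fst x \<noteq> 1" "x \<in> V" using comp_subset[OF C(1)] unfolding mem_Diff_middle_level by auto
    then show "y \<in> tangle_points n" using x(2) by (auto simp: V_def tangle_points_def rename_def)
  next
    fix y assume y: "y \<in> tangle_points n"
    \<comment> \<open>Doubling the level inverts the renaming on levels 0 and 2.\<close>
    let ?x = "map_prod (\<lambda>k. 2 * k) id y"
    have x: "?x \<in> V" "fst ?x \<noteq> 1" "rename ?x = y" using y by (auto simp: V_def tangle_points_def rename_def)
    have "conn `` {?x} \<in> comps - closed" using comp_of[OF x(1)] self_comp[of ?x] closedD(2) x(2) by blast
    then have "rename ` (conn `` {?x} - middle_level) \<in> tangle_concat n E E'"
      unfolding concat_eq by (rule imageI)
    moreover have "?x \<in> conn `` {?x} - middle_level" unfolding mem_Diff_middle_level using self_comp x(2) by blast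
    then have "rename ?x \<in> rename ` (conn `` {?x} - middle_level)" by (rule imageI)
    ultimately show "y \<in> \<Union> (tangle_concat n E E')" unfolding x(3) by (rule UnionI)
  qed
  have "p \<noteq> {}" if "p \<in> tangle_concat n E E'" for p
  proof -
    from that obtain C where "C \<in> comps" "C \<notin> closed" "p = rename ` (C - middle_level)" by (rule concatE)
    moreover then obtain x where "x \<in> C - middle_level" using openD unfolding mem_Diff_middle_level by blast
    ultimately show ?thesis by blast
  qed
  then show "{} \<notin> tangle_concat n E E'" by blast
  show "disjnt p q" if "p \<in> tangle_concat n E E'" "q \<in> tangle_concat n E E'" "p \<noteq> q" for p q
  proof -
    from that(1) obtain C where C: "C \<in> comps" "p = rename ` (C - middle_level)" by (rule concatE)
    from that(2) obtain D where D: "D \<in> comps" "q = rename ` (D - middle_level)" by (rule concatE)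
    show ?thesis
    proof (rule ccontr)
      assume "\<not> disjnt p q"
      then obtain x y where xy: "x \<in> C - middle_level" "y \<in> D - middle_level" "rename x = rename y"
        unfolding C D disjnt_def by blast
      then have "x \<in> V" "y \<in> V" "fst x \<noteq> 1" "fst y \<noteq> 1"
        using comp_subset[OF C(1)] comp_subset[OF D(1)] unfolding mem_Diff_middle_level by auto
      then have "x = y" using xy(3) by (auto simp: V_def rename_def)
      then have "C = D" using xy comp_eq[OF C(1)] comp_eq[OF D(1)] by blast
      then show False using C D that by blast
    qed
  qed
qed

end

section \<open>The evaluation homomorphism\<close>

text \<open>The pair is unique by \<open>word_tangle_unique\<close>; it records the closed curves
  and the tangle obtained by multiplying out the word.\<close>

definition word_data :: "nat \<Rightarrow> vtl_gen list \<Rightarrow> nat \<times> tangle" where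
  "word_data n w = (SOME (l, E). E \<in> flat_tangles n \<and>
     (\<forall>b. rho w (kern (id_tangle n) b) = (\<lambda>a. 2 ^ l * kern E b a)))"

definition loops :: "nat \<Rightarrow> vtl_gen list \<Rightarrow> nat" where "loops n w = fst (word_data n w)"
definition tangle :: "nat \<Rightarrow> vtl_gen list \<Rightarrow> tangle" where "tangle n w = snd (word_data n w)"

lemma word_tangle:
  assumes "set w \<subseteq> vtl_gens n"
  shows "tangle n w \<in> flat_tangles n" "rho w (kern (id_tangle n) b) = (\<lambda>a. 2 ^ loops n w * kern (tangle n w) b a)"
proof -
  have "\<exists>p. case p of (l, E) \<Rightarrow> E \<in> flat_tangles n \<and>
     (\<forall>b. rho w (kern (id_tangle n) b) = (\<lambda>a. 2 ^ l * kern E b a))"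
    using rho_kern[OF id_tangle_flat assms] by auto
  from someI_ex[OF this] show "tangle n w \<in> flat_tangles n"
    "rho w (kern (id_tangle n) b) = (\<lambda>a. 2 ^ loops n w * kern (tangle n w) b a)"
    unfolding word_data_def[symmetric] loops_def tangle_def by (auto simp: split_beta)
qed

lemma word_tangle_unique:
  assumes "set w \<subseteq> vtl_gens n" "partition_on (tangle_points n) E"
    and "\<And>a b. rho w (kern (id_tangle n) b) a = 2 ^ l * kern E b a"
  shows "loops n w = l" "tangle n w = E"
proof -
  have "2 ^ loops n w * kern (tangle n w) b a = 2 ^ l * kern E b a" for a b
    using word_tangle(2)[OF assms(1), of b] assms(3)[of b a] by (simp add: fun_eq_iff)
  note kern_inject[OF flat_partition[OF word_tangle(1)[OF assms(1)]] assms(2) this]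
  then show "loops n w = l" "tangle n w = E" by auto
qed

lemma word_tangle_Nil: "loops n [] = 0" "tangle n [] = id_tangle n"
  using word_tangle_unique[of "[]" n "id_tangle n" 0] flat_partition[OF id_tangle_flat] by auto

text \<open>The operator of \<open>u @ w\<close> is the product of two matrices, which
  \<open>kern_concat\<close> evaluates. Uniqueness of the data then gives both equations.\<close>

lemma word_tangle_append:
  assumes u: "set u \<subseteq> vtl_gens n" and w: "set w \<subseteq> vtl_gens n"
  shows "loops n (u @ w) = loops n u + loops n w + card (closed_curves n (tangle n u) (tangle n w))"
    "tangle n (u @ w) = tangle_concat n (tangle n u) (tangle n w)"
proof -
  let ?U = "tangle n u" and ?W = "tangle n w"
  interpret gluing n ?U ?W by unfold_locales (use u w word_tangle in auto)
  have "rho (u @ w) (kern (id_tangle n) b) a =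
      2 ^ (loops n u + loops n w + card (closed_curves n ?U ?W)) * kern (tangle_concat n ?U ?W) b a" for a b
  proof -
    have "rho (u @ w) (kern (id_tangle n) b) a = rho u (\<lambda>a. 2 ^ loops n w * kern ?W b a) a"
      by (simp add: rho_append word_tangle(2)[OF w])
    also have "\<dots> = (\<Sum>c \<in> colourings n. rho u (kern (id_tangle n) c) a * (2 ^ loops n w * kern ?W b (overwrite n c a)))"
      by (rule rho_expand[OF u])
    also have "\<dots> = (\<Sum>c \<in> colourings n. 2 ^ (loops n u + loops n w) * (kern ?U c a * kern ?W b c))"
    proof (rule sum.cong)
      fix c
      have "kern ?W b (overwrite n c a) = kern ?W b c"
        by (rule kern_cong[OF word_tangle(1)[OF w]]) (auto simp: overwrite_def)
      then show "rho u (kern (id_tangle n) c) a * (2 ^ loops n w * kern ?W b (overwrite n c a)) =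
          2 ^ (loops n u + loops n w) * (kern ?U c a * kern ?W b c)"
        by (simp add: word_tangle(2)[OF u] power_add)
    qed simp
    also have "\<dots> = 2 ^ (loops n u + loops n w) * (2 ^ card (closed_curves n ?U ?W) * kern (tangle_concat n ?U ?W) b a)"
      unfolding sum_distrib_left[symmetric] kern_concat ..
    finally show ?thesis by (simp add: power_add)
  qed
  from word_tangle_unique[OF _ concat_partition this] u w
  show "loops n (u @ w) = loops n u + loops n w + card (closed_curves n ?U ?W)"
    "tangle n (u @ w) = tangle_concat n ?U ?W" by auto
qed

definition word_of :: "nat \<Rightarrow> tangle \<Rightarrow> vtl_gen list" where
  "word_of n E = (SOME w. set w \<subseteq> vtl_gens n \<and> (\<forall>b. rho w (kern (id_tangle n) b) = kern E b))"

lemma word_of: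
  assumes "E \<in> flat_tangles n"
  shows "set (word_of n E) \<subseteq> vtl_gens n" "tangle n (word_of n E) = E" "loops n (word_of n E) = 0"
proof -
  have "\<exists>w. set w \<subseteq> vtl_gens n \<and> (\<forall>b. rho w (kern (id_tangle n) b) = kern E b)"
    using flat_reachable[OF assms] by (simp add: reachable_def)
  from someI_ex[OF this] have *: "set (word_of n E) \<subseteq> vtl_gens n"
    "\<And>b. rho (word_of n E) (kern (id_tangle n) b) = kern E b"
    unfolding word_of_def by auto
  then show "set (word_of n E) \<subseteq> vtl_gens n" "tangle n (word_of n E) = E" "loops n (word_of n E) = 0"
    using word_tangle_unique[OF *(1) flat_partition[OF assms], of 0] by auto
qed

text \<open>The factors \<open>2 ^ k\<close> and \<open>2 ^ l\<close> stand for powers of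
  \<open>z\<close> in front of the words. Together with \<open>rho_eq_if_word_tangle_eq\<close>,
  operator and tangle data of a monomial determine each other.\<close>

lemma word_tangle_eq:
  assumes "set u \<subseteq> vtl_gens n" "set w \<subseteq> vtl_gens n" "\<And>f a. 2 ^ k * rho u f a = 2 ^ l * rho w f a"
  shows "k + loops n u = l + loops n w" "tangle n u = tangle n w"
proof -
  have "2 ^ (k + loops n u) * kern (tangle n u) b a = 2 ^ (l + loops n w) * kern (tangle n w) b a" for a b
    using assms(3)[of "kern (id_tangle n) b" a] word_tangle(2)[OF assms(1), of b] word_tangle(2)[OF assms(2), of b]
    by (simp add: power_add mult.assoc)
  note kern_inject[OF flat_partition[OF word_tangle(1)[OF assms(1)]] flat_partition[OF word_tangle(1)[OF assms(2)]] this]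
  then show "k + loops n u = l + loops n w" "tangle n u = tangle n w" by auto
qed

lemma rho_eq_if_word_tangle_eq:
  assumes "set u \<subseteq> vtl_gens n" "set w \<subseteq> vtl_gens n" "k + loops n u = l + loops n w" "tangle n u = tangle n w"
  shows "2 ^ k * rho u f a = 2 ^ l * rho w f a"
proof -
  have "2 ^ k * rho u (kern (id_tangle n) c) a = 2 ^ l * rho w (kern (id_tangle n) c) a" for c
    using assms(3,4) unfolding word_tangle(2)[OF assms(1)] word_tangle(2)[OF assms(2)]
    by (simp add: mult.assoc[symmetric] power_add[symmetric])
  then have "2 ^ k * (rho u (kern (id_tangle n) c) a * y) = 2 ^ l * (rho w (kern (id_tangle n) c) a * y)" for c y
    by (metis mult.assoc)
  then show ?thesis
    unfolding rho_expand[OF assms(1), of f a] rho_expand[OF assms(2), of f a] sum_distrib_left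
    by (intro sum.cong refl)
qed

section \<open>Tangles of the single generators\<close>

lemma word_tangle_GenV:
  assumes "i \<in> {1..n - 1}"
  shows "loops n [GenV i] = 0" "tangle n [GenV i] = v_tangle n i"
proof -
  have i: "i \<in> {1..n}" "Suc i \<in> {1..n}" using assms by auto
  have "top_flip i (Suc i) (id_tangle n) = v_tangle n i"
  proof -
    let ?t = "flip (0::nat, i) (0, Suc i)"
    define S where "S = {1..n} - {i, i + 1}"
    have "{1..n} = {i, Suc i} \<union> S" using i by (auto simp: S_def)
    then have id: "id_tangle n = (\<lambda>k. {(0, k), (1, k)}) ` ({i, Suc i} \<union> S)" by (simp only: id_tangle_image)
    define g where "g k = ?t ` {(0, k), (1, k)}" for k
    have "top_flip i (Suc i) (id_tangle n) = g ` ({i, Suc i} \<union> S)"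
      unfolding top_flip_def id image_image g_def[symmetric] ..
    also have "\<dots> = {g i, g (Suc i)} \<union> g ` S" by simp
    also have "g i = {(0, Suc i), (1, i)}" by (auto simp: g_def flip_def)
    also have "g (Suc i) = {(0, i), (1, Suc i)}" by (auto simp: g_def flip_def)
    also have "g ` S = (\<lambda>k. {(0, k), (1, k)}) ` S"
      by (intro image_cong) (auto simp: S_def flip_def g_def)
    finally show ?thesis
      unfolding v_tangle_def S_def[symmetric] Setcompr_eq_image by (simp add: insert_commute)
  qed
  moreover have "partition_on (tangle_points n) (top_flip i (Suc i) (id_tangle n))"
    using flat_partition top_flip_flat[OF id_tangle_flat i] by blast
  ultimately show "loops n [GenV i] = 0" "tangle n [GenV i] = v_tangle n i"
    using word_tangle_unique[of "[GenV i]" n "v_tangle n i" 0] assms by (auto simp: opV_kern vtl_gens_def)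
qed

lemma word_tangle_GenE:
  assumes "i \<in> {1..n - 1}"
  shows "loops n [GenE i] = 0" "tangle n [GenE i] = E_tangle n i"
proof -
  have i: "i \<in> {1..n}" "Suc i \<in> {1..n}" using assms by auto
  have mem: "{(0, i), (1, i)} \<in> id_tangle n" "{(0, Suc i), (1, Suc i)} \<in> id_tangle n"
    using i by (auto simp: id_tangle_def)
  have nmem: "{(0, i), (0, Suc i)} \<notin> id_tangle n" by (auto simp: id_tangle_def doubleton_eq_iff)
  let ?E = "rejoin (0, i) (1, i) (0, Suc i) (1, Suc i) (id_tangle n)"
  define g where "g k = {(0::nat, k), (1, k)}" for k :: nat
  have "inj g" by (rule injI) (simp add: g_def doubleton_eq_iff)
  then have "g ` {1..n} - g ` {i, i + 1} = g ` ({1..n} - {i, i + 1})" by (simp only: image_set_diff)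
  then have "id_tangle n - {{(0, i), (1, i)}, {(0, Suc i), (1, Suc i)}} = g ` ({1..n} - {i, i + 1})"
    by (simp add: id_tangle_image g_def[abs_def])
  then have "?E = E_tangle n i"
    unfolding rejoin_def E_tangle_def Setcompr_eq_image by (simp add: g_def[abs_def])
  moreover have "partition_on (tangle_points n) ?E"
    using rejoin_flat[OF id_tangle_flat mem _ nmem] by (intro flat_partition) simp
  moreover have "opE i (kern (id_tangle n) b) = kern ?E b" for b
    by (rule opE_kern_rejoin[OF id_tangle_flat mem nmem])
  ultimately show "loops n [GenE i] = 0" "tangle n [GenE i] = E_tangle n i"
    using word_tangle_unique[of "[GenE i]" n "E_tangle n i" 0] assms by (auto simp: vtl_gens_def)
qed

section \<open>Linear extension from a basis\<close>

lemma pm_scale_zero [simp]: "pm_scale c 0 = 0" "pm_scale 0 x = 0"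
  by (auto intro!: poly_mapping_eqI simp: lookup_pm_scale)

lemma pm_scale_add: "pm_scale c (x + y) = pm_scale c x + pm_scale c y" "pm_scale (c + d) x = pm_scale c x + pm_scale d x"
  by (auto intro!: poly_mapping_eqI simp: lookup_pm_scale lookup_add algebra_simps)

lemma pm_scale_single: "pm_scale c (Poly_Mapping.single k d) = Poly_Mapping.single k (c * d)"
  by (auto intro!: poly_mapping_eqI simp: lookup_pm_scale lookup_single when_def)

lemma pm_scale_scale: "pm_scale c (pm_scale d x) = pm_scale (c * d) x"
  by (auto intro!: poly_mapping_eqI simp: lookup_pm_scale)

lemma pm_scale_sum: "pm_scale c (sum f A) = (\<Sum>x \<in> A. pm_scale c (f x))"
  by (induction A rule: infinite_finite_induct) (auto simp: pm_scale_add)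

lemma poly_mapping_sum_single: "(x :: 'k \<Rightarrow>\<^sub>0 'r::comm_monoid_add) = (\<Sum>k \<in> Poly_Mapping.keys x. Poly_Mapping.single k (Poly_Mapping.lookup x k))"
proof (rule poly_mapping_eqI)
  fix k
  have "(\<Sum>j \<in> Poly_Mapping.keys x. Poly_Mapping.lookup (Poly_Mapping.single j (Poly_Mapping.lookup x j)) k) =
      (\<Sum>j \<in> Poly_Mapping.keys x. if j = k then Poly_Mapping.lookup x j else 0)"
    by (intro sum.cong) (auto simp: lookup_single when_def)
  then show "Poly_Mapping.lookup x k = Poly_Mapping.lookup (\<Sum>k \<in> Poly_Mapping.keys x. Poly_Mapping.single k (Poly_Mapping.lookup x k)) k"
    by (simp add: lookup_sum sum.delta in_keys_iff)
qed

text \<open>Keeping \<open>k\<close> in the support of \<open>x\<close> passes membership in a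
  carrier on to the monomials.\<close>

lemma poly_mapping_span_induct:
  fixes x :: "'k \<Rightarrow>\<^sub>0 'r::comm_monoid_add"
  assumes "P 0" "\<And>a b. P a \<Longrightarrow> P b \<Longrightarrow> P (a + b)"
    and "\<And>k c. k \<in> Poly_Mapping.keys x \<Longrightarrow> P (Poly_Mapping.single k c)"
  shows "P x"
proof -
  have "A \<subseteq> Poly_Mapping.keys x \<Longrightarrow> P (\<Sum>k \<in> A. Poly_Mapping.single k (Poly_Mapping.lookup x k))" for A
    by (induction A rule: infinite_finite_induct) (use assms in auto)
  then show ?thesis using poly_mapping_sum_single[of x] by (metis order_refl)
qed

definition lin :: "('k \<Rightarrow> ('m \<Rightarrow>\<^sub>0 'r::comm_ring_1)) \<Rightarrow> ('k \<Rightarrow>\<^sub>0 'r) \<Rightarrow> ('m \<Rightarrow>\<^sub>0 'r)" where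
  "lin g x = (\<Sum>k \<in> Poly_Mapping.keys x. pm_scale (Poly_Mapping.lookup x k) (g k))"

lemma lin_superset:
  assumes "finite A" "Poly_Mapping.keys x \<subseteq> A"
  shows "lin g x = (\<Sum>k \<in> A. pm_scale (Poly_Mapping.lookup x k) (g k))"
  unfolding lin_def using assms by (intro sum.mono_neutral_left) (auto simp: in_keys_iff)

lemma lin_add: "lin g (x + y) = lin g x + lin g y"
proof -
  let ?A = "Poly_Mapping.keys x \<union> Poly_Mapping.keys y"
  have "Poly_Mapping.keys (x + y) \<subseteq> ?A" by (rule Poly_Mapping.keys_add)
  then show ?thesis
    using lin_superset[of ?A x g] lin_superset[of ?A y g] lin_superset[of ?A "x + y" g]
    by (simp add: lookup_add pm_scale_add sum.distrib)
qed

lemma lin_single: "lin g (Poly_Mapping.single k c) = pm_scale c (g k)"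
  by (simp add: lin_def)

lemma lin_zero [simp]: "lin g 0 = 0" by (simp add: lin_def)

lemma lin_diff: "lin g (x - y) = lin g x - lin g y"
  using lin_add[of g "x - y" y] by simp

lemma lin_scale: "lin g (pm_scale c x) = pm_scale c (lin g x)"
proof -
  have "Poly_Mapping.keys (pm_scale c x) \<subseteq> Poly_Mapping.keys x"
    by (auto simp: in_keys_iff lookup_pm_scale)
  then show ?thesis using lin_superset[of "Poly_Mapping.keys x" "pm_scale c x" g]
    by (simp add: lin_def lookup_pm_scale pm_scale_sum pm_scale_scale)
qed

lemma lin_add_fun: "lin (\<lambda>k. g k + h k) x = lin g x + lin h x"
  by (simp add: lin_def pm_scale_add sum.distrib)

lemma lin_zero_fun [simp]: "lin (\<lambda>k. 0) x = 0" by (simp add: lin_def)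

lemma keys_lin: "Poly_Mapping.keys (lin g x) \<subseteq> (\<Union>k \<in> Poly_Mapping.keys x. Poly_Mapping.keys (g k))"
proof
  fix m assume "m \<in> Poly_Mapping.keys (lin g x)"
  then have "(\<Sum>k \<in> Poly_Mapping.keys x. Poly_Mapping.lookup x k * Poly_Mapping.lookup (g k) m) \<noteq> 0"
    by (simp add: lin_def in_keys_iff lookup_sum lookup_pm_scale)
  then obtain k where "k \<in> Poly_Mapping.keys x" "Poly_Mapping.lookup x k * Poly_Mapping.lookup (g k) m \<noteq> 0"
    by (meson sum.neutral)
  then show "m \<in> (\<Union>k \<in> Poly_Mapping.keys x. Poly_Mapping.keys (g k))"
    by (intro UN_I[of k]) (auto simp: in_keys_iff)
qed

text \<open>Bilinearity of the product becomes an instance of the facts about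
  \<open>lin\<close>.\<close>

lemma VTL_mult_lin:
  "VTL_mult n x y = lin (\<lambda>E. lin (\<lambda>E'. Poly_Mapping.single (tangle_concat n E E')
     (zvar ^ card (closed_curves n E E'))) y) x"
  by (simp add: VTL_mult_def lin_def pm_scale_sum pm_scale_single mult.assoc)

definition phi :: "nat \<Rightarrow> (vtl_gen list \<Rightarrow>\<^sub>0 int poly) \<Rightarrow> (tangle \<Rightarrow>\<^sub>0 int poly)" where
  "phi n = lin (\<lambda>w. Poly_Mapping.single (tangle n w) (zvar ^ loops n w))"

lemma phi_single: "phi n (Poly_Mapping.single w c) = Poly_Mapping.single (tangle n w) (c * zvar ^ loops n w)"
  by (simp add: phi_def lin_single pm_scale_single)

text \<open>Bilinearity reduces this to monomials, where it is
  \<open>word_tangle_append\<close>.\<close>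

lemma phi_mult:
  assumes "u \<in> carrier (free_algebra (vtl_gens n))" "w \<in> carrier (free_algebra (vtl_gens n))"
  shows "phi n (u * w) = VTL_mult n (phi n u) (phi n w)"
proof -
  have words: "set x \<subseteq> vtl_gens n" "set y \<subseteq> vtl_gens n" if "x \<in> Poly_Mapping.keys u" "y \<in> Poly_Mapping.keys w" for x y
    using assms that by (auto simp: free_algebra_def)
  show ?thesis
  proof (rule poly_mapping_span_induct[where x = u])
    fix a b assume "phi n (a * w) = VTL_mult n (phi n a) (phi n w)" "phi n (b * w) = VTL_mult n (phi n b) (phi n w)"
    then show "phi n ((a + b) * w) = VTL_mult n (phi n (a + b)) (phi n w)"
      by (simp add: distrib_right phi_def lin_add VTL_mult_lin)
  next
    fix x c assume x: "x \<in> Poly_Mapping.keys u"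
    show "phi n (Poly_Mapping.single x c * w) = VTL_mult n (phi n (Poly_Mapping.single x c)) (phi n w)"
    proof (rule poly_mapping_span_induct[where x = w])
      fix a b assume "phi n (Poly_Mapping.single x c * a) = VTL_mult n (phi n (Poly_Mapping.single x c)) (phi n a)"
        "phi n (Poly_Mapping.single x c * b) = VTL_mult n (phi n (Poly_Mapping.single x c)) (phi n b)"
      then show "phi n (Poly_Mapping.single x c * (a + b)) = VTL_mult n (phi n (Poly_Mapping.single x c)) (phi n (a + b))"
        by (simp add: distrib_left phi_def lin_add VTL_mult_lin lin_add_fun)
    next
      fix y d assume "y \<in> Poly_Mapping.keys w"
      with x words have "set x \<subseteq> vtl_gens n" "set y \<subseteq> vtl_gens n" by auto
      then show "phi n (Poly_Mapping.single x c * Poly_Mapping.single y d) =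
          VTL_mult n (phi n (Poly_Mapping.single x c)) (phi n (Poly_Mapping.single y d))"
        by (simp add: mult_single phi_single VTL_mult_lin lin_single pm_scale_single plus_list_def
            word_tangle_append power_add algebra_simps)
    qed (simp add: phi_def VTL_mult_lin)
  qed (simp add: phi_def VTL_mult_lin)
qed

abbreviation FA :: "nat \<Rightarrow> (int poly, vtl_gen list \<Rightarrow>\<^sub>0 int poly) module" where
  "FA n \<equiv> free_algebra (vtl_gens n)"

lemma FA_carrier: "u \<in> carrier (FA n) \<longleftrightarrow> (\<forall>w \<in> Poly_Mapping.keys u. set w \<subseteq> vtl_gens n)"
  by (simp add: free_algebra_def)

lemma FA_ops [simp]: "mult (FA n) = (*)" "one (FA n) = 1" "add (FA n) = (+)" "zero (FA n) = 0" "smult (FA n) = pm_scale"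
  by (simp_all add: free_algebra_def)

lemma VTL_ops [simp]: "mult (VTL n) = VTL_mult n" "one (VTL n) = Poly_Mapping.single (id_tangle n) 1"
  "add (VTL n) = (+)" "zero (VTL n) = 0" "smult (VTL n) = pm_scale"
  by (simp_all add: VTL_def)

lemma phi_ring_hom: "phi n \<in> ring_hom (FA n) (VTL n)"
proof (rule ring_hom_memI)
  fix u assume "u \<in> carrier (FA n)"
  then show "phi n u \<in> carrier (VTL n)"
    using keys_lin[of "\<lambda>w. Poly_Mapping.single (tangle n w) (zvar ^ loops n w)" u] word_tangle(1)
    by (fastforce simp: phi_def VTL_def FA_carrier split: if_splits)
  fix w assume "w \<in> carrier (FA n)"
  with \<open>u \<in> carrier (FA n)\<close> show "phi n (u \<otimes>\<^bsub>FA n\<^esub> w) = phi n u \<otimes>\<^bsub>VTL n\<^esub> phi n w"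
    by (simp add: phi_mult)
  show "phi n (u \<oplus>\<^bsub>FA n\<^esub> w) = phi n u \<oplus>\<^bsub>VTL n\<^esub> phi n w" by (simp add: phi_def lin_add)
next
  show "phi n \<one>\<^bsub>FA n\<^esub> = \<one>\<^bsub>VTL n\<^esub>"
    using phi_single[of n "[]" 1] word_tangle_Nil[of n] unfolding FA_ops VTL_ops
    by (metis mult_1 power_0 single_one zero_list_def)
qed

text \<open>A linear right inverse of \<open>phi\<close> on the algebra of tangles; its other
  composite with \<open>phi\<close> computes normal forms modulo the relations.\<close>

definition section_map :: "nat \<Rightarrow> (tangle \<Rightarrow>\<^sub>0 int poly) \<Rightarrow> (vtl_gen list \<Rightarrow>\<^sub>0 int poly)" where
  "section_map n = lin (\<lambda>E. Poly_Mapping.single (word_of n E) 1)"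

lemma phi_surj: "phi n ` carrier (FA n) = carrier (VTL n)"
proof
  show "phi n ` carrier (FA n) \<subseteq> carrier (VTL n)" using ring_hom_closed[OF phi_ring_hom] by (intro image_subsetI)
  show "carrier (VTL n) \<subseteq> phi n ` carrier (FA n)"
  proof
    fix x assume x: "x \<in> carrier (VTL n)"
    have "set w \<subseteq> vtl_gens n" if w: "w \<in> Poly_Mapping.keys (section_map n x)" for w
    proof -
      obtain E where E: "E \<in> Poly_Mapping.keys x" "w \<in> Poly_Mapping.keys (Poly_Mapping.single (word_of n E) (1 :: int poly))"
        using w subsetD[OF keys_lin] unfolding section_map_def by (metis UN_E)
      then have "w = word_of n E" "E \<in> flat_tangles n" using x by (auto simp: VTL_def)
      then show ?thesis using word_of(1) by simp
    qed
    then have "section_map n x \<in> carrier (FA n)" by (simp add: FA_carrier)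
    moreover have "phi n (section_map n x) = x"
    proof (rule poly_mapping_span_induct[where x = x])
      fix E c assume "E \<in> Poly_Mapping.keys x"
      then have "E \<in> flat_tangles n" using x by (auto simp: VTL_def)
      then show "phi n (section_map n (Poly_Mapping.single E c)) = Poly_Mapping.single E c"
        by (simp add: section_map_def lin_single pm_scale_single phi_single word_of)
    qed (simp_all add: section_map_def phi_def lin_add)
    ultimately show "x \<in> phi n ` carrier (FA n)" by force
  qed
qed

text \<open>\<open>ring_hom\<close> presupposes no ring axioms of the target, so these, and
  associativity in particular, are inherited from the free algebra along the surjection.\<close>

lemma VTL_ring: "ring (VTL n)"
proof -
  have "ring (VTL n \<lparr>carrier := phi n ` carrier (FA n), zero := phi n \<zero>\<^bsub>FA n\<^esub>\<rparr>)"
    by (rule ring.ring_hom_imp_img_ring[OF free_algebra_ring phi_ring_hom])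
  then show ?thesis unfolding phi_surj by (simp add: phi_def VTL_def)
qed

lemma phi_ring_hom_ring: "ring_hom_ring (FA n) (VTL n) (phi n)"
  by (intro ring_hom_ringI2 free_algebra_ring VTL_ring phi_ring_hom)

section \<open>The kernel of the evaluation homomorphism\<close>

lemma opE_opE: "opE i (opE i f) = (\<lambda>a. 2 * opE i f a)"
  by (rule ext) (simp add: opE_def)

lemma opV_opV: "opV i (opV i f) = f"
  by (rule ext) (simp add: opV_def fun_upd_twist[of i "Suc i"])

lemma opE_opV: "opE i (opV i f) = opE i f"
  by (rule ext) (simp add: opE_def opV_def)

lemma opV_opE: "opV i (opE i f) = opE i f"
  by (rule ext) (simp add: opE_def opV_def)

lemma upd_commute:
  assumes "i + 2 \<le> j \<or> j + 2 \<le> i"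
  shows "a(i := p, Suc i := q, j := r, Suc j := s) = a(j := r, Suc j := s, i := p, Suc i := q)"
  using assms by (auto simp: fun_eq_iff)

lemma opE_opE_far: "i + 2 \<le> j \<or> j + 2 \<le> i \<Longrightarrow> opE i (opE j f) = opE j (opE i f)"
  by (rule ext, subgoal_tac "i \<noteq> j \<and> Suc i \<noteq> j \<and> i \<noteq> Suc j") (simp_all add: opE_def upd_commute[of i j], linarith)

lemma opV_opV_far: "i + 2 \<le> j \<or> j + 2 \<le> i \<Longrightarrow> opV i (opV j f) = opV j (opV i f)"
  by (rule ext, subgoal_tac "i \<noteq> j \<and> Suc i \<noteq> j \<and> i \<noteq> Suc j") (simp_all add: opV_def upd_commute[of i j], linarith)

lemma opV_opE_far: "i + 2 \<le> j \<or> j + 2 \<le> i \<Longrightarrow> opV i (opE j f) = opE j (opV i f)"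
  by (rule ext, subgoal_tac "i \<noteq> j \<and> Suc i \<noteq> j \<and> i \<noteq> Suc j")
    (simp_all add: opE_def opV_def upd_commute[of i j], linarith)

lemma opV_braid: "i = j + 1 \<or> j = i + 1 \<Longrightarrow> opV i (opV j (opV i f)) = opV j (opV i (opV j f))"
  by (rule ext) (auto simp: opV_def intro!: arg_cong[where f = f], auto simp: fun_eq_iff)

lemma opE_opV_opE: "i = j + 1 \<or> j = i + 1 \<Longrightarrow> opE i (opV j (opE i f)) = opE i f"
  by (rule ext) (auto simp: opE_def opV_def intro!: arg_cong2[where f = "(+)"] arg_cong[where f = f],
    auto simp: fun_eq_iff)

lemma opV_opV_opE: "i = j + 1 \<or> j = i + 1 \<Longrightarrow> opV i (opV j (opE i f)) = opE j (opV i (opV j f))"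
  by (rule ext) (auto simp: opE_def opV_def intro!: arg_cong2[where f = "(+)"] arg_cong[where f = f],
    auto simp: fun_eq_iff)

definition mword :: "nat \<Rightarrow> vtl_gen list \<Rightarrow> (vtl_gen list \<Rightarrow>\<^sub>0 int poly)" where
  "mword k w = Poly_Mapping.single w (zvar ^ k)"

lemma mword_mult: "mword k u * mword l w = mword (k + l) (u @ w)"
  by (simp add: mword_def mult_single plus_list_def power_add)

lemma mword_one: "1 = mword 0 []"
  by (simp add: mword_def zero_list_def[symmetric])

lemma free_gen_mword: "free_gen x = mword 0 [x]"
  by (simp add: free_gen_def mword_def)

lemma scale_mword: "pm_scale zvar (mword k w) = mword (Suc k) w"
  by (simp add: mword_def pm_scale_single)

lemma mword_carrier: "set w \<subseteq> vtl_gens n \<Longrightarrow> mword k w \<in> carrier (FA n)"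
  by (simp add: mword_def FA_carrier)

lemma phi_mword: "phi n (mword k w) = Poly_Mapping.single (tangle n w) (zvar ^ (k + loops n w))"
  by (simp add: mword_def phi_single power_add)

lemma gens_mem: "1 \<le> i \<Longrightarrow> i \<le> n - 1 \<Longrightarrow> GenE i \<in> vtl_gens n" "1 \<le> i \<Longrightarrow> i \<le> n - 1 \<Longrightarrow> GenV i \<in> vtl_gens n"
  by (auto simp: vtl_gens_def)

text \<open>Each relation has the form \<open>z^k u = z^k' w\<close>, so its validity amounts to one
  identity between operators with 2 in place of \<open>z\<close>.\<close>

lemma relations_sound:
  assumes "(l, r) \<in> vtl_relations n"
  shows "\<exists>k u k' w. l = mword k u \<and> r = mword k' w \<and> set u \<subseteq> vtl_gens n \<and> set w \<subseteq> vtl_gens n \<and>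
    (\<forall>f a. 2 ^ k * rho u f a = 2 ^ k' * rho w f a)"
proof -
  define good where "good l r \<longleftrightarrow> (\<exists>k u k' w. l = mword k u \<and> r = mword k' w \<and> set u \<subseteq> vtl_gens n \<and>
    set w \<subseteq> vtl_gens n \<and> (\<forall>f a. 2 ^ k * rho u f a = 2 ^ k' * rho w f a))" for l r
  have goodI: "good (mword k u) (mword k' w)"
    if "set u \<subseteq> vtl_gens n" "set w \<subseteq> vtl_gens n" "\<And>f a. 2 ^ k * rho u f a = 2 ^ k' * rho w f a" for k u k' w
    unfolding good_def using that by blast
  have far: "i + 2 \<le> j \<or> j + 2 \<le> i" if "\<bar>int i - int j\<bar> \<ge> 2" for i j using that by linarith
  have adj: "i = j + 1 \<or> j = i + 1" if "\<bar>int i - int j\<bar> = 1" for i j using that by linarith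
  note mons = free_gen_mword power2_eq_square mword_mult scale_mword mword_one append.simps add_0
  let ?e = "\<lambda>i. free_gen (GenE i) :: vtl_gen list \<Rightarrow>\<^sub>0 int poly"
    and ?v = "\<lambda>i. free_gen (GenV i) :: vtl_gen list \<Rightarrow>\<^sub>0 int poly"
  have 1: "good (?e i ^ 2) (pm_scale zvar (?e i))" "good (?v i ^ 2) 1" "good (?e i * ?v i) (?v i * ?e i)"
    "good (?v i * ?e i) (?e i)" if "i \<in> {1..n - 1}" for i
    unfolding mons using that
    by (auto intro!: goodI gens_mem simp: opE_opE opV_opV opE_opV opV_opE)
  have 2: "good (?e i * ?e j) (?e j * ?e i)" "good (?v i * ?v j) (?v j * ?v i)" "good (?v i * ?e j) (?e j * ?v i)"
    if "i \<in> {1..n - 1}" "j \<in> {1..n - 1}" "\<bar>int i - int j\<bar> \<ge> 2" for i j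
    unfolding mons using that(1,2) far[OF that(3)]
    by (auto intro!: goodI gens_mem simp: opE_opE_far[of i j] opV_opV_far[of i j] opV_opE_far[of i j])
  have 3: "good (?e i * ?v j * ?e i) (?e i)" "good (?v i * ?v j * ?v i) (?v j * ?v i * ?v j)"
    "good (?v i * ?v j * ?e i) (?e j * ?v i * ?v j)"
    if "i \<in> {1..n - 1}" "j \<in> {1..n - 1}" "\<bar>int i - int j\<bar> = 1" for i j
    unfolding mons using that(1,2)
    by (auto intro!: goodI gens_mem simp: opE_opV_opE[OF adj[OF that(3)]] opV_braid[OF adj[OF that(3)]]
        opV_opV_opE[OF adj[OF that(3)]])
  have "good l r"
    using assms unfolding vtl_relations_def Let_def by (auto simp: 1 2 3)
  then show ?thesis unfolding good_def .
qed

lemma phi_relation: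
  assumes "(l, r) \<in> vtl_relations n"
  shows "l \<in> carrier (FA n)" "r \<in> carrier (FA n)" "phi n l = phi n r"
proof -
  obtain k u k' w where lr: "l = mword k u" "r = mword k' w" and gens: "set u \<subseteq> vtl_gens n" "set w \<subseteq> vtl_gens n"
    and "\<And>f a. 2 ^ k * rho u f a = 2 ^ k' * rho w f a"
    using relations_sound[OF assms] by blast
  then show "l \<in> carrier (FA n)" "r \<in> carrier (FA n)" "phi n l = phi n r"
    using word_tangle_eq[of u n w k k'] by (simp_all add: mword_carrier phi_mword)
qed

section \<open>The relation ideal\<close>

abbreviation RI :: "nat \<Rightarrow> (vtl_gen list \<Rightarrow>\<^sub>0 int poly) set" where
  "RI n \<equiv> relation_ideal (vtl_gens n) (vtl_relations n)"

lemma FA_ring: "ring (FA n)" by (rule free_algebra_ring)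

lemma FA_closed:
  "u \<in> carrier (FA n) \<Longrightarrow> w \<in> carrier (FA n) \<Longrightarrow> u * w \<in> carrier (FA n)"
  "u \<in> carrier (FA n) \<Longrightarrow> w \<in> carrier (FA n) \<Longrightarrow> u + w \<in> carrier (FA n)"
  "u \<in> carrier (FA n) \<Longrightarrow> - u \<in> carrier (FA n)"
  "u \<in> carrier (FA n) \<Longrightarrow> w \<in> carrier (FA n) \<Longrightarrow> u - w \<in> carrier (FA n)"
  "1 \<in> carrier (FA n)" "0 \<in> carrier (FA n)"
proof -
  show mult: "u \<in> carrier (FA n) \<Longrightarrow> w \<in> carrier (FA n) \<Longrightarrow> u * w \<in> carrier (FA n)" for u w
    using ring.ring_simprules(5)[OF FA_ring[of n], of u w] by simp
  show add: "u \<in> carrier (FA n) \<Longrightarrow> w \<in> carrier (FA n) \<Longrightarrow> u + w \<in> carrier (FA n)" for u w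
    using ring.ring_simprules(1)[OF FA_ring[of n], of u w] by simp
  show neg: "u \<in> carrier (FA n) \<Longrightarrow> - u \<in> carrier (FA n)" for u by (simp add: FA_carrier)
  show "u \<in> carrier (FA n) \<Longrightarrow> w \<in> carrier (FA n) \<Longrightarrow> u - w \<in> carrier (FA n)"
    using add[of u "- w"] neg[of w] by simp
  show "1 \<in> carrier (FA n)" "0 \<in> carrier (FA n)" by (simp_all add: FA_carrier zero_list_def)
qed

lemma relation_differences: "(\<lambda>(l, r). l - r) ` vtl_relations n \<subseteq> carrier (FA n)"
proof clarify
  fix l r assume "(l, r) \<in> vtl_relations n"
  then show "l - r \<in> carrier (FA n)" using phi_relation FA_closed(4) by blast
qed

lemma RI_ideal: "ideal (RI n) (FA n)"
  unfolding relation_ideal_def by (rule ring.genideal_ideal[OF FA_ring relation_differences])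

lemma RI_relation: "(l, r) \<in> vtl_relations n \<Longrightarrow> l - r \<in> RI n"
  using ring.genideal_self[OF FA_ring relation_differences, of n] unfolding relation_ideal_def by blast

lemma RI_subset_kernel: "RI n \<subseteq> a_kernel (FA n) (VTL n) (phi n)"
  unfolding relation_ideal_def
proof (rule ring.genideal_minimal[OF FA_ring])
  interpret ring_hom_ring "FA n" "VTL n" "phi n" by (rule phi_ring_hom_ring)
  show "ideal (a_kernel (FA n) (VTL n) (phi n)) (FA n)" by (rule kernel_is_ideal)
  show "(\<lambda>(l, r). l - r) ` vtl_relations n \<subseteq> a_kernel (FA n) (VTL n) (phi n)"
  proof clarify
    fix l r assume lr: "(l, r) \<in> vtl_relations n"
    then have "l - r \<in> carrier (FA n)" "phi n (l - r) = 0"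
      using phi_relation[OF lr] FA_closed(4) by (simp_all add: phi_def lin_diff)
    then show "l - r \<in> a_kernel (FA n) (VTL n) (phi n)"
      unfolding a_kernel_def' VTL_ops by (intro CollectI conjI)
  qed
qed

lemma RI_phi: "u \<in> RI n \<Longrightarrow> phi n u = 0"
  using RI_subset_kernel[of n] unfolding a_kernel_def' VTL_ops by blast

lemma RI_closed:
  "u \<in> RI n \<Longrightarrow> u \<in> carrier (FA n)"
  "u \<in> RI n \<Longrightarrow> w \<in> RI n \<Longrightarrow> u + w \<in> RI n"
  "u \<in> RI n \<Longrightarrow> - u \<in> RI n"
  "0 \<in> RI n"
  "u \<in> RI n \<Longrightarrow> c \<in> carrier (FA n) \<Longrightarrow> c * u \<in> RI n"
  "u \<in> RI n \<Longrightarrow> c \<in> carrier (FA n) \<Longrightarrow> u * c \<in> RI n"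
proof -
  interpret ideal "RI n" "FA n" by (rule RI_ideal)
  show c: "u \<in> RI n \<Longrightarrow> u \<in> carrier (FA n)" for u by (rule a_Hcarr)
  show "u \<in> RI n \<Longrightarrow> w \<in> RI n \<Longrightarrow> u + w \<in> RI n" using additive_subgroup.a_closed[OF is_additive_subgroup, of u w] by simp
  show l: "u \<in> RI n \<Longrightarrow> c \<in> carrier (FA n) \<Longrightarrow> c * u \<in> RI n" for u c using I_l_closed[of u c] by simp
  show "u \<in> RI n \<Longrightarrow> c \<in> carrier (FA n) \<Longrightarrow> u * c \<in> RI n" using I_r_closed[of u c] by simp
  show "u \<in> RI n \<Longrightarrow> - u \<in> RI n" using l[of u "- 1"] FA_closed(3)[OF FA_closed(5)] by simp
  show "0 \<in> RI n" using additive_subgroup.zero_closed[OF is_additive_subgroup] by simp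
qed

text \<open>\<open>act n 1\<close> saturates a set under the ideal; the sets it fixes are the unions
  of cosets in the carrier. With congruence built in, composition matches multiplication
  exactly.\<close>

definition act ::
  "nat \<Rightarrow> (vtl_gen list \<Rightarrow>\<^sub>0 int poly) \<Rightarrow> (vtl_gen list \<Rightarrow>\<^sub>0 int poly) set \<Rightarrow>
    (vtl_gen list \<Rightarrow>\<^sub>0 int poly) set" where
  "act n u S = {y \<in> carrier (FA n). \<exists>x \<in> S \<inter> carrier (FA n). u * x - y \<in> RI n}"

lemma act_act:
  assumes u: "u \<in> carrier (FA n)" and w: "w \<in> carrier (FA n)"
  shows "act n u (act n w S) = act n (u * w) S"
proof (intro subset_antisym subsetI)
  fix y assume "y \<in> act n u (act n w S)"
  then obtain x x' where x: "x \<in> S" "x \<in> carrier (FA n)" "x' \<in> carrier (FA n)" "w * x - x' \<in> RI n" "u * x' - y \<in> RI n"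
    and y: "y \<in> carrier (FA n)" by (auto simp: act_def)
  have "u * w * x - y = u * (w * x - x') + (u * x' - y)" by (simp add: algebra_simps)
  also have "\<dots> \<in> RI n" using x u by (intro RI_closed(2) RI_closed(5))
  finally show "y \<in> act n (u * w) S" using x y by (auto simp: act_def)
next
  fix y assume "y \<in> act n (u * w) S"
  then obtain x where x: "x \<in> S" "x \<in> carrier (FA n)" "u * w * x - y \<in> RI n"
    and y: "y \<in> carrier (FA n)" by (auto simp: act_def)
  have wx: "w * x \<in> carrier (FA n)" using w x FA_closed by blast
  then have "w * x \<in> act n w S" using x RI_closed(4) by (auto simp: act_def intro!: bexI[of _ x])
  then show "y \<in> act n u (act n w S)" using x y wx unfolding act_def[of n u] by (auto simp: mult.assoc)
qed

text \<open>
  Left multiplication on unions of cosets of the ideal. Being the identity on all other sets makes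
  \<open>Act n 1 = id\<close>, so that the multiplicative monoid of the quotient embeds into a function type.
\<close>

definition Act ::
  "nat \<Rightarrow> (vtl_gen list \<Rightarrow>\<^sub>0 int poly) \<Rightarrow> (vtl_gen list \<Rightarrow>\<^sub>0 int poly) set \<Rightarrow>
    (vtl_gen list \<Rightarrow>\<^sub>0 int poly) set" where
  "Act n u S = (if act n 1 S = S then act n u S else S)"

text \<open>A set produced by \<open>act\<close> is again saturated, so the test in
  \<open>Act\<close> succeeds a second time.\<close>

lemma Act_comp:
  assumes "u \<in> carrier (FA n)" "w \<in> carrier (FA n)"
  shows "Act n u \<circ> Act n w = Act n (u * w)"
  using act_act[OF assms] act_act[OF FA_closed(5) assms(2)] by (auto simp: Act_def fun_eq_iff)

lemma Act_one: "Act n 1 = id"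
  by (auto simp: Act_def fun_eq_iff)

lemma Act_eq_iff:
  assumes u: "u \<in> carrier (FA n)" and w: "w \<in> carrier (FA n)"
  shows "Act n u = Act n w \<longleftrightarrow> u - w \<in> RI n"
proof
  assume eq: "Act n u = Act n w"
  \<comment> \<open>The coset of 1, a saturated set; its image under \<open>Act n u\<close> is the
    coset of \<open>u\<close>.\<close>
  define S where "S = act n 1 {1}"
  have sat: "act n 1 S = S" using act_act[of 1 n 1 "{1}"] FA_closed(5) by (simp add: S_def)
  have S: "act n x S = act n x {1}" if "x \<in> carrier (FA n)" for x
    using act_act[OF that FA_closed(5), of "{1}"] by (simp add: S_def)
  have "Act n u S = Act n w S" using eq by simp
  then have "act n u {1} = act n w {1}" unfolding Act_def sat S[OF u] S[OF w] by simp
  moreover have "w \<in> act n w {1}" using w FA_closed(5) RI_closed(4) by (simp add: act_def)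
  ultimately have "w \<in> act n u {1}" by simp
  then show "u - w \<in> RI n" by (simp add: act_def)
next
  assume d: "u - w \<in> RI n"
  have "act n x S \<subseteq> act n y S" if xy: "x - y \<in> RI n" for x y S
  proof
    fix s assume "s \<in> act n x S"
    then obtain t where t: "t \<in> S" "t \<in> carrier (FA n)" "x * t - s \<in> RI n" and s: "s \<in> carrier (FA n)"
      by (auto simp: act_def)
    have "y * t - s = (x * t - s) + - ((x - y) * t)" by (simp add: algebra_simps)
    also have "\<dots> \<in> RI n" using t xy by (intro RI_closed(2) RI_closed(3) RI_closed(6))
    finally show "s \<in> act n y S" using s t by (auto simp: act_def)
  qed
  from this[OF d] this[of w u] RI_closed(3)[OF d] have "act n u S = act n w S" for S by auto
  then show "Act n u = Act n w" by (simp add: Act_def fun_eq_iff)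
qed

lemma relations_mword:
  "1 \<le> i \<Longrightarrow> i < n \<Longrightarrow> (mword 0 [GenE i, GenE i], mword 1 [GenE i]) \<in> vtl_relations n"
  "1 \<le> i \<Longrightarrow> i < n \<Longrightarrow> (mword 0 [GenV i, GenV i], mword 0 []) \<in> vtl_relations n"
  "1 \<le> i \<Longrightarrow> i < n \<Longrightarrow> (mword 0 [GenE i, GenV i], mword 0 [GenV i, GenE i]) \<in> vtl_relations n"
  "1 \<le> i \<Longrightarrow> i < n \<Longrightarrow> (mword 0 [GenV i, GenE i], mword 0 [GenE i]) \<in> vtl_relations n"
  "1 \<le> i \<Longrightarrow> i < n \<Longrightarrow> 1 \<le> j \<Longrightarrow> j < n \<Longrightarrow> i + 2 \<le> j \<or> j + 2 \<le> i \<Longrightarrow>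
    (mword 0 [GenE i, GenE j], mword 0 [GenE j, GenE i]) \<in> vtl_relations n"
  "1 \<le> i \<Longrightarrow> i < n \<Longrightarrow> 1 \<le> j \<Longrightarrow> j < n \<Longrightarrow> i + 2 \<le> j \<or> j + 2 \<le> i \<Longrightarrow>
    (mword 0 [GenV i, GenV j], mword 0 [GenV j, GenV i]) \<in> vtl_relations n"
  "1 \<le> i \<Longrightarrow> i < n \<Longrightarrow> 1 \<le> j \<Longrightarrow> j < n \<Longrightarrow> i + 2 \<le> j \<or> j + 2 \<le> i \<Longrightarrow>
    (mword 0 [GenV i, GenE j], mword 0 [GenE j, GenV i]) \<in> vtl_relations n"
  "1 \<le> i \<Longrightarrow> i < n \<Longrightarrow> 1 \<le> j \<Longrightarrow> j < n \<Longrightarrow> i = j + 1 \<or> j = i + 1 \<Longrightarrow>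
    (mword 0 [GenE i, GenV j, GenE i], mword 0 [GenE i]) \<in> vtl_relations n"
  "1 \<le> i \<Longrightarrow> i < n \<Longrightarrow> 1 \<le> j \<Longrightarrow> j < n \<Longrightarrow> i = j + 1 \<or> j = i + 1 \<Longrightarrow>
    (mword 0 [GenV i, GenV j, GenV i], mword 0 [GenV j, GenV i, GenV j]) \<in> vtl_relations n"
  "1 \<le> i \<Longrightarrow> i < n \<Longrightarrow> 1 \<le> j \<Longrightarrow> j < n \<Longrightarrow> i = j + 1 \<or> j = i + 1 \<Longrightarrow>
    (mword 0 [GenV i, GenV j, GenE i], mword 0 [GenE j, GenV i, GenV j]) \<in> vtl_relations n"
proof -
  let ?e = "\<lambda>i. free_gen (GenE i) :: vtl_gen list \<Rightarrow>\<^sub>0 int poly"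
    and ?v = "\<lambda>i. free_gen (GenV i) :: vtl_gen list \<Rightarrow>\<^sub>0 int poly"
  note mons = free_gen_mword power2_eq_square mword_mult scale_mword mword_one append.simps add_0 One_nat_def[symmetric]
  have R1: "(?e i ^ 2, pm_scale zvar (?e i)) \<in> vtl_relations n" "(?v i ^ 2, 1) \<in> vtl_relations n"
    "(?e i * ?v i, ?v i * ?e i) \<in> vtl_relations n" "(?v i * ?e i, ?e i) \<in> vtl_relations n"
    if "1 \<le> i" "i < n" for i
    using that unfolding vtl_relations_def Let_def by (intro UnI1 UN_I[of i]; simp)+
  have R2: "(?e i * ?e j, ?e j * ?e i) \<in> vtl_relations n" "(?v i * ?v j, ?v j * ?v i) \<in> vtl_relations n"
    "(?v i * ?e j, ?e j * ?v i) \<in> vtl_relations n"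
    if "1 \<le> i" "i < n" "1 \<le> j" "j < n" "i + 2 \<le> j \<or> j + 2 \<le> i" for i j
  proof -
    have "(i, j) \<in> {(i, j). i \<in> {1..n - 1} \<and> j \<in> {1..n - 1} \<and> \<bar>int i - int j\<bar> \<ge> 2}" using that by auto
    then show "(?e i * ?e j, ?e j * ?e i) \<in> vtl_relations n" "(?v i * ?v j, ?v j * ?v i) \<in> vtl_relations n"
      "(?v i * ?e j, ?e j * ?v i) \<in> vtl_relations n"
      unfolding vtl_relations_def Let_def by (intro UnI1[OF UnI2] UN_I[of "(i, j)"]; simp)+
  qed
  have R3: "(?e i * ?v j * ?e i, ?e i) \<in> vtl_relations n" "(?v i * ?v j * ?v i, ?v j * ?v i * ?v j) \<in> vtl_relations n"
    "(?v i * ?v j * ?e i, ?e j * ?v i * ?v j) \<in> vtl_relations n"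
    if "1 \<le> i" "i < n" "1 \<le> j" "j < n" "i = j + 1 \<or> j = i + 1" for i j
  proof -
    have "(i, j) \<in> {(i, j). i \<in> {1..n - 1} \<and> j \<in> {1..n - 1} \<and> \<bar>int i - int j\<bar> = 1}" using that by auto
    then show "(?e i * ?v j * ?e i, ?e i) \<in> vtl_relations n" "(?v i * ?v j * ?v i, ?v j * ?v i * ?v j) \<in> vtl_relations n"
      "(?v i * ?v j * ?e i, ?e j * ?v i * ?v j) \<in> vtl_relations n"
      unfolding vtl_relations_def Let_def by (intro UnI2 UN_I[of "(i, j)"]; simp)+
  qed
  show "1 \<le> i \<Longrightarrow> i < n \<Longrightarrow> (mword 0 [GenE i, GenE i], mword 1 [GenE i]) \<in> vtl_relations n"
    "1 \<le> i \<Longrightarrow> i < n \<Longrightarrow> (mword 0 [GenV i, GenV i], mword 0 []) \<in> vtl_relations n"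
    "1 \<le> i \<Longrightarrow> i < n \<Longrightarrow> (mword 0 [GenE i, GenV i], mword 0 [GenV i, GenE i]) \<in> vtl_relations n"
    "1 \<le> i \<Longrightarrow> i < n \<Longrightarrow> (mword 0 [GenV i, GenE i], mword 0 [GenE i]) \<in> vtl_relations n"
    by (fact R1[of i, unfolded mons])+
  show "1 \<le> i \<Longrightarrow> i < n \<Longrightarrow> 1 \<le> j \<Longrightarrow> j < n \<Longrightarrow> i + 2 \<le> j \<or> j + 2 \<le> i \<Longrightarrow>
      (mword 0 [GenE i, GenE j], mword 0 [GenE j, GenE i]) \<in> vtl_relations n"
    "1 \<le> i \<Longrightarrow> i < n \<Longrightarrow> 1 \<le> j \<Longrightarrow> j < n \<Longrightarrow> i + 2 \<le> j \<or> j + 2 \<le> i \<Longrightarrow>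
      (mword 0 [GenV i, GenV j], mword 0 [GenV j, GenV i]) \<in> vtl_relations n"
    "1 \<le> i \<Longrightarrow> i < n \<Longrightarrow> 1 \<le> j \<Longrightarrow> j < n \<Longrightarrow> i + 2 \<le> j \<or> j + 2 \<le> i \<Longrightarrow>
      (mword 0 [GenV i, GenE j], mword 0 [GenE j, GenV i]) \<in> vtl_relations n"
    by (fact R2[of i j, unfolded mons])+
  show "1 \<le> i \<Longrightarrow> i < n \<Longrightarrow> 1 \<le> j \<Longrightarrow> j < n \<Longrightarrow> i = j + 1 \<or> j = i + 1 \<Longrightarrow>
      (mword 0 [GenE i, GenV j, GenE i], mword 0 [GenE i]) \<in> vtl_relations n"
    "1 \<le> i \<Longrightarrow> i < n \<Longrightarrow> 1 \<le> j \<Longrightarrow> j < n \<Longrightarrow> i = j + 1 \<or> j = i + 1 \<Longrightarrow>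
      (mword 0 [GenV i, GenV j, GenV i], mword 0 [GenV j, GenV i, GenV j]) \<in> vtl_relations n"
    "1 \<le> i \<Longrightarrow> i < n \<Longrightarrow> 1 \<le> j \<Longrightarrow> j < n \<Longrightarrow> i = j + 1 \<or> j = i + 1 \<Longrightarrow>
      (mword 0 [GenV i, GenV j, GenE i], mword 0 [GenE j, GenV i, GenV j]) \<in> vtl_relations n"
    by (fact R3[of i j, unfolded mons])+
qed

lemma zvar_power_inject: "zvar ^ p = zvar ^ q \<Longrightarrow> p = q"
proof -
  have "degree (zvar ^ p) = p" for p by (simp add: zvar_def degree_power_eq)
  then show "zvar ^ p = zvar ^ q \<Longrightarrow> p = q" by metis
qed

lemma single_zvar_inject:
  assumes "Poly_Mapping.single s (zvar ^ p) = Poly_Mapping.single t (zvar ^ q)"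
  shows "s = t" "p = q"
proof -
  have "zvar \<noteq> 0" by (simp add: zvar_def)
  then have "Poly_Mapping.keys (Poly_Mapping.single s (zvar ^ p)) = {s}"
    "Poly_Mapping.keys (Poly_Mapping.single t (zvar ^ q)) = {t}" by simp_all
  then show st: "s = t" using assms by simp
  then have "zvar ^ p = zvar ^ q" using assms by (metis lookup_single_eq)
  then show "p = q" by (rule zvar_power_inject)
qed

lemma Act_relation: "(l, r) \<in> vtl_relations n \<Longrightarrow> Act n l = Act n r"
  using Act_eq_iff phi_relation RI_relation by blast

lemma Act_mword_comp:
  assumes "set u \<subseteq> vtl_gens n" "set w \<subseteq> vtl_gens n"
  shows "Act n (mword k u) \<circ> Act n (mword l w) = Act n (mword (k + l) (u @ w))"
  using Act_comp[OF mword_carrier[OF assms(1)] mword_carrier[OF assms(2)]] by (simp add: mword_mult)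

text \<open>Congruent monomials have the same image under \<open>phi\<close>, hence the same tangle
  and total exponent of \<open>z\<close>. This makes \<open>Act_rep\<close> independent of the
  chosen monomial.\<close>

lemma rho_eq_if_Act_eq:
  assumes u: "set u \<subseteq> vtl_gens n" and w: "set w \<subseteq> vtl_gens n" and eq: "Act n (mword k u) = Act n (mword l w)"
  shows "2 ^ k * rho u f a = 2 ^ l * rho w f a"
proof -
  have "mword k u - mword l w \<in> RI n" using eq Act_eq_iff mword_carrier u w by blast
  then have "phi n (mword k u) = phi n (mword l w)" using RI_phi by (force simp: phi_def lin_diff)
  then have "tangle n u = tangle n w" "k + loops n u = l + loops n w"
    unfolding phi_mword by (rule single_zvar_inject)+
  then show ?thesis using rho_eq_if_word_tangle_eq[OF u w] by blast
qed

definition Act_rep ::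
  "nat \<Rightarrow> ((vtl_gen list \<Rightarrow>\<^sub>0 int poly) set \<Rightarrow> (vtl_gen list \<Rightarrow>\<^sub>0 int poly) set) \<Rightarrow>
    colour_fn \<Rightarrow> colour_fn" where
  "Act_rep n x f a = (case (SOME (k, w). set w \<subseteq> vtl_gens n \<and> x = Act n (mword k w)) of (k, w) \<Rightarrow> 2 ^ k * rho w f a)"

lemma Act_rep:
  assumes w: "set w \<subseteq> vtl_gens n"
  shows "Act_rep n (Act n (mword k w)) = (\<lambda>f a. 2 ^ k * rho w f a)"
proof (intro ext)
  fix f a
  let ?P = "\<lambda>(l, u). set u \<subseteq> vtl_gens n \<and> Act n (mword k w) = Act n (mword l u)"
  have "?P (k, w)" using w by simp
  then have "?P (SOME p. ?P p)" by (rule someI)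
  then obtain l u where lu: "(SOME p. ?P p) = (l, u)" "set u \<subseteq> vtl_gens n" "Act n (mword k w) = Act n (mword l u)"
    by (auto split: prod.splits)
  show "Act_rep n (Act n (mword k w)) f a = 2 ^ k * rho w f a"
    unfolding Act_rep_def lu(1) using rho_eq_if_Act_eq[OF w lu(2,3)] by simp
qed

lemma brauer_Act:
  "brauer_relations (\<circ>) id (Act n (mword 1 [])) (\<lambda>i. Act n (mword 0 [GenE i])) (\<lambda>i. Act n (mword 0 [GenV i])) n"
proof -
  have gens: "GenE i \<in> vtl_gens n" "GenV i \<in> vtl_gens n" if "1 \<le> i" "i < n" for i
    using that by (auto simp: vtl_gens_def)
  have one: "Act n (mword 0 []) = id" using Act_one mword_one by metis
  note rel = relations_mword[THEN Act_relation]
  show ?thesis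
  proof
    fix i assume i: "1 \<le> i" "i < n"
    \<comment> \<open>The locale assumes both absorption laws; the presentation states this one
      through \<open>E_i v_i = v_i E_i\<close> and \<open>v_i E_i = E_i\<close>.\<close>
    show "Act n (mword 0 [GenE i]) \<circ> Act n (mword 0 [GenV i]) = Act n (mword 0 [GenE i])"
      using i gens[OF i] rel(3)[OF i] rel(4)[OF i] by (simp add: Act_mword_comp)
  next
    fix i j assume "1 \<le> i" "i < n" "1 \<le> j" "j < n" and far: "i + 2 \<le> j \<or> j + 2 \<le> i"
    note ij = this(1-4)
    show "Act n (mword 0 [GenE i]) \<circ> Act n (mword 0 [GenE j]) = Act n (mword 0 [GenE j]) \<circ> Act n (mword 0 [GenE i])"
      "Act n (mword 0 [GenV i]) \<circ> Act n (mword 0 [GenV j]) = Act n (mword 0 [GenV j]) \<circ> Act n (mword 0 [GenV i])"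
      using gens ij rel(5,6)[OF ij far] by (simp_all add: Act_mword_comp)
  next
    fix i j assume "1 \<le> i" "i < n" "1 \<le> j" "j < n" and adj: "i = j + 1 \<or> j = i + 1"
    note ij = this(1-4)
    show "Act n (mword 0 [GenV i]) \<circ> Act n (mword 0 [GenV j]) \<circ> Act n (mword 0 [GenV i]) =
        Act n (mword 0 [GenV j]) \<circ> Act n (mword 0 [GenV i]) \<circ> Act n (mword 0 [GenV j])"
      using gens ij rel(9)[OF ij adj] by (simp add: Act_mword_comp)
  qed (simp_all add: gens Act_mword_comp rel one o_assoc)
qed

lemma brauer_rep_Act:
  "brauer_representation (\<circ>) id (Act n (mword 1 [])) (\<lambda>i. Act n (mword 0 [GenE i])) (\<lambda>i. Act n (mword 0 [GenV i])) n (Act_rep n)"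
proof -
  interpret brauer_relations "(\<circ>)" id "Act n (mword 1 [])" "\<lambda>i. Act n (mword 0 [GenE i])" "\<lambda>i. Act n (mword 0 [GenV i])" n
    by (rule brauer_Act)
  have gens: "GenE i \<in> vtl_gens n" "GenV i \<in> vtl_gens n" if "1 \<le> i" "i < n" for i
    using that by (auto simp: vtl_gens_def)
  have one: "Act n (mword 0 []) = id" using Act_one mword_one by metis
  have Q: "\<exists>k w. set w \<subseteq> vtl_gens n \<and> x = Act n (mword k w)" if "x \<in> Q n" for x
    using that
  proof (induction rule: Q.induct)
    case Q_unit show ?case using one by (intro exI[of _ 0] exI[of _ "[]"]) simp
  next
    case Q_z show ?case by (intro exI[of _ 1] exI[of _ "[]"]) simp
  next
    case (Q_e i) then show ?case using gens by (intro exI[of _ 0] exI[of _ "[GenE i]"]) simp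
  next
    case (Q_v i) then show ?case using gens by (intro exI[of _ 0] exI[of _ "[GenV i]"]) simp
  next
    case (Q_mul x y)
    then obtain k w l u where "set w \<subseteq> vtl_gens n" "x = Act n (mword k w)" "set u \<subseteq> vtl_gens n" "y = Act n (mword l u)"
      by blast
    then show ?case using Act_mword_comp by (intro exI[of _ "k + l"] exI[of _ "w @ u"]) simp
  qed
  show ?thesis
  proof
    show "Act_rep n id = id" using Act_rep[of "[]" n 0] one by (simp add: fun_eq_iff)
    show "Act_rep n (Act n (mword 1 [])) = opZ" using Act_rep[of "[]" n 1] by (simp add: fun_eq_iff opZ_def)
    fix i assume i: "1 \<le> i" "i < n"
    show "Act_rep n (Act n (mword 0 [GenE i])) = opE i" using Act_rep[of "[GenE i]" n 0] gens i by (simp add: fun_eq_iff)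
    show "Act_rep n (Act n (mword 0 [GenV i])) = opV i" using Act_rep[of "[GenV i]" n 0] gens i by (simp add: fun_eq_iff)
  next
    fix x y assume "x \<in> Q n" "y \<in> Q n"
    then obtain k w l u where *: "set w \<subseteq> vtl_gens n" "x = Act n (mword k w)" "set u \<subseteq> vtl_gens n" "y = Act n (mword l u)"
      using Q by meson
    show "Act_rep n (x \<circ> y) = Act_rep n x \<circ> Act_rep n y"
      unfolding *(2,4) Act_mword_comp[OF *(1,3)] using *(1,3)
      by (subst (1 2 3) Act_rep) (simp_all add: fun_eq_iff rho_append rho_scale power_add)
  qed
qed

text \<open>Completeness of the relations for monomials: \<open>R_inj\<close> at
  \<open>m = n\<close>, applied in the monoid of the functions \<open>Act n u\<close>.\<close>

lemma mword_congruent: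
  assumes n: "1 \<le> n" and u: "set u \<subseteq> vtl_gens n" and w: "set w \<subseteq> vtl_gens n"
    and eq: "\<And>f a. 2 ^ k * rho u f a = 2 ^ l * rho w f a"
  shows "mword k u - mword l w \<in> RI n"
proof -
  interpret brauer_representation "(\<circ>)" id "Act n (mword 1 [])" "\<lambda>i. Act n (mword 0 [GenE i])"
    "\<lambda>i. Act n (mword 0 [GenV i])" n "Act_rep n"
    by (rule brauer_rep_Act)
  have one: "Act n (mword 0 []) = id" using Act_one mword_one by metis
  have z: "Act n (mword k []) \<in> Q n" for k
  proof (induction k)
    case (Suc k)
    have "Act n (mword 1 []) \<circ> Act n (mword k []) = Act n (mword (Suc k) [])"
      using Act_mword_comp[of "[]" n "[]" 1 k] by simp
    then show ?case using Q_mul[OF Q_z Suc.IH] by (simp only:)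
  qed (simp only: one Q_unit)
  have w0: "Act n (mword 0 w) \<in> Q n" if "set w \<subseteq> vtl_gens n" for w
    using that
  proof (induction w)
    case (Cons g w)
    have "Act n (mword 0 [g]) \<in> Q n" 
    proof (cases g)
      case (GenE i)
      then have "1 \<le> i" "i < n" using Cons.prems by (auto simp: vtl_gens_def)
      then show ?thesis unfolding GenE by (rule Q_e)
    next
      case (GenV i)
      then have "1 \<le> i" "i < n" using Cons.prems by (auto simp: vtl_gens_def)
      then show ?thesis unfolding GenV by (rule Q_v)
    qed
    moreover have "set w \<subseteq> vtl_gens n" using Cons.prems by simp
    ultimately have "Act n (mword 0 [g]) \<circ> Act n (mword 0 w) \<in> Q n" by (intro Q_mul Cons.IH)
    moreover have "Act n (mword 0 [g]) \<circ> Act n (mword 0 w) = Act n (mword 0 (g # w))"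
      using Cons.prems Act_mword_comp[of "[g]" n w 0 0] by simp
    ultimately show ?case by (simp only:)
  qed (simp only: one Q_unit)
  have "Act n (mword k w) \<in> Q n" if "set w \<subseteq> vtl_gens n" for k w
  proof -
    have "Act n (mword k []) \<circ> Act n (mword 0 w) = Act n (mword k w)"
      using that Act_mword_comp[of "[]" n w k 0] by simp
    then show ?thesis using Q_mul[OF z[of k] w0[OF that]] by (simp only:)
  qed
  then have "Act n (mword k u) = Act n (mword l w)"
    using u w eq n by (intro R_inj[of n]) (auto simp: Act_rep)
  then show ?thesis using Act_eq_iff mword_carrier u w by blast
qed

text \<open>A word and \<open>z^l\<close> times the chosen word of its tangle, with \<open>l\<close>
  its number of loops, have the same operator and so are congruent. Hence an element is determined
  modulo the ideal by its image under \<open>phi\<close>.\<close>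

lemma section_phi:
  assumes n: "1 \<le> n" and u: "u \<in> carrier (FA n)"
  shows "u - section_map n (phi n u) \<in> RI n"
proof (rule poly_mapping_span_induct[where x = u])
  show "0 - section_map n (phi n 0) \<in> RI n" using RI_closed(4) by (simp add: section_map_def phi_def)
next
  fix a b assume "a - section_map n (phi n a) \<in> RI n" "b - section_map n (phi n b) \<in> RI n"
  then have "(a - section_map n (phi n a)) + (b - section_map n (phi n b)) \<in> RI n" by (rule RI_closed(2))
  then show "a + b - section_map n (phi n (a + b)) \<in> RI n"
    by (simp add: section_map_def phi_def lin_add algebra_simps)
next
  fix w c assume "w \<in> Poly_Mapping.keys u"
  then have w: "set w \<subseteq> vtl_gens n" using u by (simp add: FA_carrier)
  let ?w = "word_of n (tangle n w)"
  have w': "set ?w \<subseteq> vtl_gens n" "tangle n ?w = tangle n w" "loops n ?w = 0"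
    using word_of[OF word_tangle(1)[OF w]] by auto
  have "mword 0 w - mword (loops n w) ?w \<in> RI n"
    using w w' by (intro mword_congruent[OF n] rho_eq_if_word_tangle_eq[of _ n]) auto
  \<comment> \<open>As a multiple of the empty word, the coefficient \<open>c\<close> is a factor
    that the ideal absorbs.\<close>
  moreover have "Poly_Mapping.single [] c \<in> carrier (FA n)" by (simp add: FA_carrier)
  ultimately have "Poly_Mapping.single [] c * (mword 0 w - mword (loops n w) ?w) \<in> RI n" by (rule RI_closed(5))
  then show "Poly_Mapping.single w c - section_map n (phi n (Poly_Mapping.single w c)) \<in> RI n"
    by (simp add: right_diff_distrib mword_def mult_single plus_list_def section_map_def phi_single lin_single pm_scale_single)
qed

lemma kernel_phi:
  assumes "1 \<le> n"
  shows "a_kernel (FA n) (VTL n) (phi n) = RI n"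
proof (rule subset_antisym[OF subsetI RI_subset_kernel])
  fix u assume "u \<in> a_kernel (FA n) (VTL n) (phi n)"
  then have "u \<in> carrier (FA n)" "phi n u = 0" unfolding a_kernel_def' VTL_ops by blast+
  then show "u \<in> RI n" using section_phi[OF assms, of u] by (simp add: section_map_def)
qed

lemma phi_coset:
  assumes "u \<in> carrier (FA n)"
  shows "the_elem (phi n ` (RI n +>\<^bsub>FA n\<^esub> u)) = phi n u"
proof -
  have "RI n +>\<^bsub>FA n\<^esub> u = (\<lambda>i. i + u) ` RI n" unfolding a_r_coset_def' by auto
  moreover have "phi n (i + u) = phi n u" if "i \<in> RI n" for i
    using RI_phi[OF that] by (simp add: phi_def lin_add)
  ultimately have "phi n ` (RI n +>\<^bsub>FA n\<^esub> u) = {phi n u}" using RI_closed(4)[of n] by (force simp: image_image)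
  then show ?thesis by simp
qed

theorem proposition2p2:
  fixes n :: nat
  assumes "n \<ge> 2"
  shows "has_presentation (VTL n) (vtl_gens n) (vtl_gen_val n) (vtl_relations n)"
proof -
  interpret ring_hom_ring "FA n" "VTL n" "phi n" by (rule phi_ring_hom_ring)
  let ?h = "\<lambda>X. the_elem (phi n ` X)"
  have n: "1 \<le> n" using assms by simp
  have iso: "?h \<in> ring_iso (FA n Quot RI n) (VTL n)"
    using FactRing_iso_set[OF phi_surj] unfolding kernel_phi[OF n] .
  have gen: "?h (RI n +>\<^bsub>FA n\<^esub> free_gen x) = vtl_gen_val n x" if x: "x \<in> vtl_gens n" for x
  proof -
    have "?h (RI n +>\<^bsub>FA n\<^esub> free_gen x) = phi n (mword 0 [x])"
      using phi_coset[of "free_gen x" n] x by (simp add: free_gen_mword mword_carrier)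
    also have "\<dots> = vtl_gen_val n x"
      using x by (auto simp: vtl_gens_def phi_mword word_tangle_GenE word_tangle_GenV)
    finally show ?thesis .
  qed
  have scale: "?h (RI n +>\<^bsub>FA n\<^esub> (c \<odot>\<^bsub>FA n\<^esub> u)) = c \<odot>\<^bsub>VTL n\<^esub> ?h (RI n +>\<^bsub>FA n\<^esub> u)" if u: "u \<in> carrier (FA n)" for c u
  proof -
    have "Poly_Mapping.keys (pm_scale c u) \<subseteq> Poly_Mapping.keys u" by (auto simp: in_keys_iff lookup_pm_scale)
    then have "pm_scale c u \<in> carrier (FA n)" using u unfolding FA_carrier by blast
    then show ?thesis using phi_coset u by (simp add: phi_def lin_scale)
  qed
  show ?thesis unfolding has_presentation_def Let_def by (intro bexI[OF _ iso] conjI ballI allI gen scale)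
qed

end
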